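(* Let $\mathcal{A}$ be an abelian category. For a homology-determined preaisle $\mathcal{U}\subseteq D^b\mathcal{A}$ put $\mu(\mathcal{U})=(H_k\,\mathcal{U})_{k\in\mathbb{Z}}$, and for a narrow sequence $(\mathcal{N}(k))_{k\in\mathbb{Z}}$ in $\mathcal{A}$ put $\theta((\mathcal{N}(k))_k)=\{X\in D^b\mathcal{A}\mid H_k(X)\in\mathcal{N}(k)\text{ for all }k\in\mathbb{Z}\}$. Then $\theta$ and $\mu$ are mutually inverse bijections $$\{\text{narrow sequences in }\mathcal{A}\}\longleftrightarrow\{\text{homology-determined preaisles in }D^b\mathcal{A}\}.$$
   Context: All subcategories are full, nonempty and closed under isomorphisms. $D^b\mathcal{A}$ is the bounded derived category with suspension $[1]$; $H_k=H^{-k}$ denotes homology, so $H_k(X)=H_0(X[-k])$; an object $A\in\mathcal{A}$ is identified with the stalk complex $A[0]$ in degree $0$, and $A[n]=(A[0])[n]$. For a subcategory $\mathcal{U}\subseteq D^b\mathcal{A}$, $H_k\,\mathcal{U}$ is the essential image of $\mathcal{U}$ under $H_k$. A preaisle in a triangulated category is a full subcategory closed under the suspension $[1]$ and under extensions (the middle term of a triangle with outer terms $X,Z$ in the subcategory is again in it). A preaisle $\mathcal{U}\subseteq D^b\mathcal{A}$ is homology-determined if for all $X\in D^b\mathcal{A}$: $X\in\mathcal{U}$ if and only if $(H_kX)[k]\in\mathcal{U}$ for all $k\in\mathbb{Z}$. A full subcategory of $\mathcal{A}$ is narrow if it is closed under extensions and cokernels. A narrow sequence in $\mathcal{A}$ is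 a sequence $(\mathcal{N}(k))_{k\in\mathbb{Z}}$ of narrow subcategories such that for all $k\in\mathbb{Z}$: (1) $\mathcal{N}(k)\subseteq\mathcal{N}(k+1)$; (2) if $A\to B\to C\to D\to E$ is exact in $\mathcal{A}$ with $A\in\mathcal{N}(k+1)$, $B,D\in\mathcal{N}(k)$ and $E\in\mathcal{N}(k-1)$, then $C\in\mathcal{N}(k)$. *)

theory Defs
  imports "HOL-Algebra.Group"
begin

section \<open>Categories\<close>

record ('o, 'm) cat =
  Obj :: "'o set"
  Arr :: "'m set"
  Dom :: "'m \<Rightarrow> 'o"
  Cod :: "'m \<Rightarrow> 'o"
  Ident :: "'o \<Rightarrow> 'm"
  Comp :: "'m \<Rightarrow> 'm \<Rightarrow> 'm"  (infixr \<open>\<bullet>\<index>\<close> 70)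

text \<open>Composition is written in the usual order: \<open>g \<bullet> f\<close> is "first \<open>f\<close>, then \<open>g\<close>".\<close>

definition Hom :: "('o, 'm, 'z) cat_scheme \<Rightarrow> 'o \<Rightarrow> 'o \<Rightarrow> 'm set" where
  "Hom C X Y = {f \<in> Arr C. Dom C f = X \<and> Cod C f = Y}"

locale category =
  fixes C :: "('o, 'm, 'z) cat_scheme" (structure)
  assumes dom_in: "f \<in> Arr C \<Longrightarrow> Dom C f \<in> Obj C"
    and cod_in: "f \<in> Arr C \<Longrightarrow> Cod C f \<in> Obj C"
    and ident_in: "X \<in> Obj C \<Longrightarrow> Ident C X \<in> Hom C X X"
    and comp_in: "f \<in> Hom C X Y \<Longrightarrow> g \<in> Hom C Y Z \<Longrightarrow> g \<bullet> f \<in> Hom C X Z"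
    and ident_left: "f \<in> Hom C X Y \<Longrightarrow> Ident C Y \<bullet> f = f"
    and ident_right: "f \<in> Hom C X Y \<Longrightarrow> f \<bullet> Ident C X = f"
    and comp_assoc: "f \<in> Hom C W X \<Longrightarrow> g \<in> Hom C X Y \<Longrightarrow> h \<in> Hom C Y Z \<Longrightarrow>
      (h \<bullet> g) \<bullet> f = h \<bullet> (g \<bullet> f)"

definition isomorphism :: "('o, 'm, 'z) cat_scheme \<Rightarrow> 'm \<Rightarrow> bool" where
  "isomorphism C f \<longleftrightarrow> f \<in> Arr C \<and>
     (\<exists>g \<in> Hom C (Cod C f) (Dom C f).
        g \<bullet>\<^bsub>C\<^esub> f = Ident C (Dom C f) \<and> f \<bullet>\<^bsub>C\<^esub> g = Ident C (Cod C f))"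

definition isomorphic :: "('o, 'm, 'z) cat_scheme \<Rightarrow> 'o \<Rightarrow> 'o \<Rightarrow> bool" where
  "isomorphic C X Y \<longleftrightarrow> (\<exists>f \<in> Hom C X Y. isomorphism C f)"

definition monomorphism :: "('o, 'm, 'z) cat_scheme \<Rightarrow> 'm \<Rightarrow> bool" where
  "monomorphism C f \<longleftrightarrow> f \<in> Arr C \<and>
     (\<forall>W. \<forall>g \<in> Hom C W (Dom C f). \<forall>h \<in> Hom C W (Dom C f).
        f \<bullet>\<^bsub>C\<^esub> g = f \<bullet>\<^bsub>C\<^esub> h \<longrightarrow> g = h)"

definition epimorphism :: "('o, 'm, 'z) cat_scheme \<Rightarrow> 'm \<Rightarrow> bool" where
  "epimorphism C f \<longleftrightarrow> f \<in> Arr C \<and>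
     (\<forall>Z. \<forall>g \<in> Hom C (Cod C f) Z. \<forall>h \<in> Hom C (Cod C f) Z.
        g \<bullet>\<^bsub>C\<^esub> f = h \<bullet>\<^bsub>C\<^esub> f \<longrightarrow> g = h)"

definition zero_object :: "('o, 'm, 'z) cat_scheme \<Rightarrow> 'o \<Rightarrow> bool" where
  "zero_object C Z \<longleftrightarrow> Z \<in> Obj C \<and>
     (\<forall>X \<in> Obj C. (\<exists>!f. f \<in> Hom C X Z) \<and> (\<exists>!f. f \<in> Hom C Z X))"

text \<open>A full, nonempty subcategory closed under isomorphisms is given by its class of objects.\<close>

definition strict_full_subcategory :: "('o, 'm, 'z) cat_scheme \<Rightarrow> 'o set \<Rightarrow> bool" where
  "strict_full_subcategory C S \<longleftrightarrow> S \<subseteq> Obj C \<and> S \<noteq> {} \<and>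
     (\<forall>X \<in> S. \<forall>Y \<in> Obj C. isomorphic C X Y \<longrightarrow> Y \<in> S)"


section \<open>Abelian categories\<close>

record ('o, 'm) add_cat = "('o, 'm) cat" +
  Add :: "'m \<Rightarrow> 'm \<Rightarrow> 'm"  (infixl \<open>\<boxplus>\<index>\<close> 65)
  Zero :: "'o \<Rightarrow> 'o \<Rightarrow> 'm"

definition hom_group :: "('o, 'm, 'z) add_cat_scheme \<Rightarrow> 'o \<Rightarrow> 'o \<Rightarrow> 'm monoid" where
  "hom_group C X Y = \<lparr>carrier = Hom C X Y, Group.monoid.mult = Add C, one = Zero C X Y\<rparr>"

definition Neg :: "('o, 'm, 'z) add_cat_scheme \<Rightarrow> 'm \<Rightarrow> 'm" where
  "Neg C f = inv\<^bsub>hom_group C (Dom C f) (Cod C f)\<^esub> f"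

definition is_kernel :: "('o, 'm, 'z) add_cat_scheme \<Rightarrow> 'm \<Rightarrow> 'm \<Rightarrow> bool" where
  "is_kernel C f k \<longleftrightarrow> f \<in> Arr C \<and> k \<in> Arr C \<and> Cod C k = Dom C f \<and>
     f \<bullet>\<^bsub>C\<^esub> k = Zero C (Dom C k) (Cod C f) \<and>
     (\<forall>W. \<forall>g \<in> Hom C W (Dom C f). f \<bullet>\<^bsub>C\<^esub> g = Zero C W (Cod C f) \<longrightarrow>
        (\<exists>!h. h \<in> Hom C W (Dom C k) \<and> k \<bullet>\<^bsub>C\<^esub> h = g))"

definition is_cokernel :: "('o, 'm, 'z) add_cat_scheme \<Rightarrow> 'm \<Rightarrow> 'm \<Rightarrow> bool" where
  "is_cokernel C f c \<longleftrightarrow> f \<in> Arr C \<and> c \<in> Arr C \<and> Dom C c = Cod C f \<and>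
     c \<bullet>\<^bsub>C\<^esub> f = Zero C (Dom C f) (Cod C c) \<and>
     (\<forall>Z. \<forall>g \<in> Hom C (Cod C f) Z. g \<bullet>\<^bsub>C\<^esub> f = Zero C (Dom C f) Z \<longrightarrow>
        (\<exists>!h. h \<in> Hom C (Cod C c) Z \<and> h \<bullet>\<^bsub>C\<^esub> c = g))"

text \<open>A biproduct is recorded as \<open>(P, i1, i2, p1, p2)\<close> with injections \<open>i\<close> and projections \<open>p\<close>.\<close>

type_synonym ('o, 'm) biproduct = "'o \<times> 'm \<times> 'm \<times> 'm \<times> 'm"

definition is_biproduct ::
  "('o, 'm, 'z) add_cat_scheme \<Rightarrow> 'o \<Rightarrow> 'o \<Rightarrow> ('o, 'm) biproduct \<Rightarrow> bool" where
  "is_biproduct C X Y = (\<lambda>(P, i1, i2, p1, p2). P \<in> Obj C \<and>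
     i1 \<in> Hom C X P \<and> i2 \<in> Hom C Y P \<and> p1 \<in> Hom C P X \<and> p2 \<in> Hom C P Y \<and>
     p1 \<bullet>\<^bsub>C\<^esub> i1 = Ident C X \<and> p2 \<bullet>\<^bsub>C\<^esub> i2 = Ident C Y \<and>
     p1 \<bullet>\<^bsub>C\<^esub> i2 = Zero C Y X \<and> p2 \<bullet>\<^bsub>C\<^esub> i1 = Zero C X Y \<and>
     (i1 \<bullet>\<^bsub>C\<^esub> p1) \<boxplus>\<^bsub>C\<^esub> (i2 \<bullet>\<^bsub>C\<^esub> p2) = Ident C P)"

locale abelian_category = category C
  for C :: "('o, 'm, 'z) add_cat_scheme" (structure) +
  assumes hom_comm_group: "X \<in> Obj C \<Longrightarrow> Y \<in> Obj C \<Longrightarrow> comm_group (hom_group C X Y)"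
    and comp_add_right: "f \<in> Hom C X Y \<Longrightarrow> f' \<in> Hom C X Y \<Longrightarrow> g \<in> Hom C Y Z \<Longrightarrow>
      g \<bullet> (f \<boxplus> f') = (g \<bullet> f) \<boxplus> (g \<bullet> f')"
    and comp_add_left: "f \<in> Hom C X Y \<Longrightarrow> g \<in> Hom C Y Z \<Longrightarrow> g' \<in> Hom C Y Z \<Longrightarrow>
      (g \<boxplus> g') \<bullet> f = (g \<bullet> f) \<boxplus> (g' \<bullet> f)"
    and ex_zero_object: "\<exists>Z. zero_object C Z"
    and ex_biproduct: "X \<in> Obj C \<Longrightarrow> Y \<in> Obj C \<Longrightarrow> \<exists>b. is_biproduct C X Y b"
    and ex_kernel: "f \<in> Arr C \<Longrightarrow> \<exists>k. is_kernel C f k"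
    and ex_cokernel: "f \<in> Arr C \<Longrightarrow> \<exists>c. is_cokernel C f c"
    and mono_is_kernel: "monomorphism C k \<Longrightarrow> \<exists>f. is_kernel C f k"
    and epi_is_cokernel: "epimorphism C c \<Longrightarrow> \<exists>f. is_cokernel C f c"

text \<open>Chosen zero object, kernels, cokernels and biproducts.\<close>

definition zero_obj :: "('o, 'm, 'z) add_cat_scheme \<Rightarrow> 'o" where
  "zero_obj C = (SOME Z. zero_object C Z)"

definition ker :: "('o, 'm, 'z) add_cat_scheme \<Rightarrow> 'm \<Rightarrow> 'm" where
  "ker C f = (SOME k. is_kernel C f k)"

definition coker :: "('o, 'm, 'z) add_cat_scheme \<Rightarrow> 'm \<Rightarrow> 'm" where
  "coker C f = (SOME c. is_cokernel C f c)"

definition biprod :: "('o, 'm, 'z) add_cat_scheme \<Rightarrow> 'o \<Rightarrow> 'o \<Rightarrow> ('o, 'm) biproduct" where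
  "biprod C X Y = (SOME b. is_biproduct C X Y b)"

text \<open>Exactness of \<open>f\<close> followed by \<open>g\<close> in the middle: the image \<open>ker (coker f)\<close> of \<open>f\<close> is
  a kernel of \<open>g\<close>.\<close>

definition exact_pair :: "('o, 'm, 'z) add_cat_scheme \<Rightarrow> 'm \<Rightarrow> 'm \<Rightarrow> bool" where
  "exact_pair C f g \<longleftrightarrow> f \<in> Arr C \<and> g \<in> Arr C \<and> Cod C f = Dom C g \<and>
     is_kernel C g (ker C (coker C f))"

definition short_exact :: "('o, 'm, 'z) add_cat_scheme \<Rightarrow> 'm \<Rightarrow> 'm \<Rightarrow> bool" where
  "short_exact C f g \<longleftrightarrow> monomorphism C f \<and> exact_pair C f g \<and> epimorphism C g"


section \<open>Bounded complexes\<close>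

text \<open>Complexes are graded cohomologically: \<open>cdiff X i\<close> goes from degree \<open>i\<close> to degree \<open>i + 1\<close>.\<close>

datatype ('o, 'm) cpx = Cpx (cobj: "int \<Rightarrow> 'o") (cdiff: "int \<Rightarrow> 'm")

datatype ('o, 'm) cmap =
  CMap (cdom: "('o, 'm) cpx") (ccod: "('o, 'm) cpx") (ccomp: "int \<Rightarrow> 'm")

definition bounded_complex :: "('o, 'm, 'z) add_cat_scheme \<Rightarrow> ('o, 'm) cpx \<Rightarrow> bool" where
  "bounded_complex C X \<longleftrightarrow>
     (\<forall>i. cobj X i \<in> Obj C \<and> cdiff X i \<in> Hom C (cobj X i) (cobj X (i + 1)) \<and>
          cdiff X (i + 1) \<bullet>\<^bsub>C\<^esub> cdiff X i = Zero C (cobj X i) (cobj X (i + 2))) \<and>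
     (\<exists>n. \<forall>i. \<bar>i\<bar> > n \<longrightarrow> zero_object C (cobj X i))"

definition chain_map :: "('o, 'm, 'z) add_cat_scheme \<Rightarrow> ('o, 'm) cmap \<Rightarrow> bool" where
  "chain_map C f \<longleftrightarrow> bounded_complex C (cdom f) \<and> bounded_complex C (ccod f) \<and>
     (\<forall>i. ccomp f i \<in> Hom C (cobj (cdom f) i) (cobj (ccod f) i) \<and>
          cdiff (ccod f) i \<bullet>\<^bsub>C\<^esub> ccomp f i = ccomp f (i + 1) \<bullet>\<^bsub>C\<^esub> cdiff (cdom f) i)"

definition Chb :: "('o, 'm, 'z) add_cat_scheme \<Rightarrow> (('o, 'm) cpx, ('o, 'm) cmap) cat" where
  "Chb C = \<lparr>Obj = {X. bounded_complex C X}, Arr = {f. chain_map C f}, Dom = cdom, Cod = ccod,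
     Ident = (\<lambda>X. CMap X X (\<lambda>i. Ident C (cobj X i))),
     Comp = (\<lambda>g f. CMap (cdom f) (ccod g) (\<lambda>i. ccomp g i \<bullet>\<^bsub>C\<^esub> ccomp f i))\<rparr>"

text \<open>The \<open>n\<close>-fold suspension \<open>X[n]\<close> has \<open>X[n]\<^sup>i = X\<^sup>n\<^sup>+\<^sup>i\<close> and differential
  \<open>(-1)\<^sup>n d\<close>.\<close>

definition shift :: "('o, 'm, 'z) add_cat_scheme \<Rightarrow> int \<Rightarrow> ('o, 'm) cpx \<Rightarrow> ('o, 'm) cpx" where
  "shift C n X = Cpx (\<lambda>i. cobj X (i + n))
     (\<lambda>i. if even n then cdiff X (i + n) else Neg C (cdiff X (i + n)))"

definition shift_map :: "('o, 'm, 'z) add_cat_scheme \<Rightarrow> int \<Rightarrow> ('o, 'm) cmap \<Rightarrow> ('o, 'm) cmap" where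
  "shift_map C n f = CMap (shift C n (cdom f)) (shift C n (ccod f)) (\<lambda>i. ccomp f (i + n))"

definition stalk :: "('o, 'm, 'z) add_cat_scheme \<Rightarrow> 'o \<Rightarrow> ('o, 'm) cpx" where
  "stalk C A = (let X = (\<lambda>i::int. if i = 0 then A else zero_obj C)
     in Cpx X (\<lambda>i. Zero C (X i) (X (i + 1))))"

text \<open>Cohomology in degree \<open>i\<close>: the cokernel of the map from \<open>X\<^sup>i\<^sup>-\<^sup>1\<close> to the cycles
  \<open>ker d\<^sup>i\<close> that \<open>d\<^sup>i\<^sup>-\<^sup>1\<close> induces.\<close>

definition cycles :: "('o, 'm, 'z) add_cat_scheme \<Rightarrow> int \<Rightarrow> ('o, 'm) cpx \<Rightarrow> 'm" where
  "cycles C i X = ker C (cdiff X i)"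

definition to_cycles :: "('o, 'm, 'z) add_cat_scheme \<Rightarrow> int \<Rightarrow> ('o, 'm) cpx \<Rightarrow> 'm" where
  "to_cycles C i X = (THE b. b \<in> Hom C (cobj X (i - 1)) (Dom C (cycles C i X)) \<and>
     cycles C i X \<bullet>\<^bsub>C\<^esub> b = cdiff X (i - 1))"

definition cohom_proj :: "('o, 'm, 'z) add_cat_scheme \<Rightarrow> int \<Rightarrow> ('o, 'm) cpx \<Rightarrow> 'm" where
  "cohom_proj C i X = coker C (to_cycles C i X)"

definition cohom :: "('o, 'm, 'z) add_cat_scheme \<Rightarrow> int \<Rightarrow> ('o, 'm) cpx \<Rightarrow> 'o" where
  "cohom C i X = Cod C (cohom_proj C i X)"

definition cycles_map :: "('o, 'm, 'z) add_cat_scheme \<Rightarrow> int \<Rightarrow> ('o, 'm) cmap \<Rightarrow> 'm" where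
  "cycles_map C i f =
     (THE g. g \<in> Hom C (Dom C (cycles C i (cdom f))) (Dom C (cycles C i (ccod f))) \<and>
        cycles C i (ccod f) \<bullet>\<^bsub>C\<^esub> g = ccomp f i \<bullet>\<^bsub>C\<^esub> cycles C i (cdom f))"

definition cohom_map :: "('o, 'm, 'z) add_cat_scheme \<Rightarrow> int \<Rightarrow> ('o, 'm) cmap \<Rightarrow> 'm" where
  "cohom_map C i f =
     (THE h. h \<in> Hom C (cohom C i (cdom f)) (cohom C i (ccod f)) \<and>
        h \<bullet>\<^bsub>C\<^esub> cohom_proj C i (cdom f) = cohom_proj C i (ccod f) \<bullet>\<^bsub>C\<^esub> cycles_map C i f)"

abbreviation homology :: "('o, 'm, 'z) add_cat_scheme \<Rightarrow> int \<Rightarrow> ('o, 'm) cpx \<Rightarrow> 'o" where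
  "homology C k X \<equiv> cohom C (- k) X"

definition quasi_isos :: "('o, 'm, 'z) add_cat_scheme \<Rightarrow> ('o, 'm) cmap set" where
  "quasi_isos C = {f. chain_map C f \<and> (\<forall>i. isomorphism C (cohom_map C i f))}"

text \<open>The mapping cone of \<open>f : X \<rightarrow> Y\<close> is \<open>X\<^sup>i\<^sup>+\<^sup>1 \<oplus> Y\<^sup>i\<close> in degree \<open>i\<close>, with differential
  \<open>(x, y) \<mapsto> (- d x, f x + d y)\<close>.\<close>

definition cone :: "('o, 'm, 'z) add_cat_scheme \<Rightarrow> ('o, 'm) cmap \<Rightarrow> ('o, 'm) cpx" where
  "cone C f = (let X = cdom f; Y = ccod f; B = (\<lambda>i. biprod C (cobj X (i + 1)) (cobj Y i)) in
     Cpx (\<lambda>i. fst (B i))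
       (\<lambda>i. case (B i, B (i + 1)) of ((P, i1, i2, p1, p2), (Q, j1, j2, q1, q2)) \<Rightarrow>
          (j1 \<bullet>\<^bsub>C\<^esub> Neg C (cdiff X (i + 1)) \<bullet>\<^bsub>C\<^esub> p1) \<boxplus>\<^bsub>C\<^esub>
          (j2 \<bullet>\<^bsub>C\<^esub> ccomp f (i + 1) \<bullet>\<^bsub>C\<^esub> p1) \<boxplus>\<^bsub>C\<^esub>
          (j2 \<bullet>\<^bsub>C\<^esub> cdiff Y i \<bullet>\<^bsub>C\<^esub> p2)))"

definition cone_inj :: "('o, 'm, 'z) add_cat_scheme \<Rightarrow> ('o, 'm) cmap \<Rightarrow> ('o, 'm) cmap" where
  "cone_inj C f = CMap (ccod f) (cone C f)
     (\<lambda>i. case biprod C (cobj (cdom f) (i + 1)) (cobj (ccod f) i) of (P, i1, i2, p1, p2) \<Rightarrow> i2)"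

definition cone_proj :: "('o, 'm, 'z) add_cat_scheme \<Rightarrow> ('o, 'm) cmap \<Rightarrow> ('o, 'm) cmap" where
  "cone_proj C f = CMap (cone C f) (shift C 1 (cdom f))
     (\<lambda>i. case biprod C (cobj (cdom f) (i + 1)) (cobj (ccod f) i) of (P, i1, i2, p1, p2) \<Rightarrow> p1)"


section \<open>Localization of a category\<close>

text \<open>Gabriel--Zisman localization of \<open>C\<close> at a set \<open>W\<close> of arrows: morphisms are zigzags of arrows
  of \<open>C\<close> and formal inverses of arrows of \<open>W\<close>, modulo the relations below.  Zigzags are read
  from source to target, so composition is concatenation in the opposite order.\<close>

datatype 'm zz_letter = Fwd 'm | Bwd 'm

type_synonym 'm zigzag = "'m zz_letter list"

inductive zz_path ::
  "('o, 'm, 'z) cat_scheme \<Rightarrow> 'm set \<Rightarrow> 'o \<Rightarrow> 'm zigzag \<Rightarrow> 'o \<Rightarrow> bool"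
  for C :: "('o, 'm, 'z) cat_scheme" and W :: "'m set" where
  nil: "X \<in> Obj C \<Longrightarrow> zz_path C W X [] X"
| fwd: "f \<in> Hom C X Y \<Longrightarrow> zz_path C W Y p Z \<Longrightarrow> zz_path C W X (Fwd f # p) Z"
| bwd: "w \<in> W \<Longrightarrow> w \<in> Hom C Y X \<Longrightarrow> zz_path C W Y p Z \<Longrightarrow> zz_path C W X (Bwd w # p) Z"

inductive zz_rel ::
  "('o, 'm, 'z) cat_scheme \<Rightarrow> 'm set \<Rightarrow> 'm zigzag \<Rightarrow> 'm zigzag \<Rightarrow> bool"
  for C :: "('o, 'm, 'z) cat_scheme" and W :: "'m set" where
  ident: "X \<in> Obj C \<Longrightarrow> zz_rel C W [Fwd (Ident C X)] []"
| comp: "f \<in> Hom C X Y \<Longrightarrow> g \<in> Hom C Y Z \<Longrightarrow> zz_rel C W [Fwd f, Fwd g] [Fwd (g \<bullet>\<^bsub>C\<^esub> f)]"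
| fwd_bwd: "w \<in> W \<Longrightarrow> zz_rel C W [Fwd w, Bwd w] []"
| bwd_fwd: "w \<in> W \<Longrightarrow> zz_rel C W [Bwd w, Fwd w] []"

definition zz_step ::
  "('o, 'm, 'z) cat_scheme \<Rightarrow> 'm set \<Rightarrow> 'o \<Rightarrow> 'o \<Rightarrow> 'm zigzag \<Rightarrow> 'm zigzag \<Rightarrow> bool" where
  "zz_step C W X Y p q \<longleftrightarrow> zz_path C W X p Y \<and> zz_path C W X q Y \<and>
     (\<exists>a l r b. zz_rel C W l r \<and> p = a @ l @ b \<and> q = a @ r @ b)"

definition zz_class ::
  "('o, 'm, 'z) cat_scheme \<Rightarrow> 'm set \<Rightarrow> 'o \<Rightarrow> 'o \<Rightarrow> 'm zigzag \<Rightarrow> 'm zigzag set" where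
  "zz_class C W X Y p = {q. equivclp (zz_step C W X Y) p q}"

datatype ('o, 'm) loc_arr = LArr (ldom: 'o) (lcod: 'o) (lcls: "'m zigzag set")

definition loc_of_zz ::
  "('o, 'm, 'z) cat_scheme \<Rightarrow> 'm set \<Rightarrow> 'o \<Rightarrow> 'o \<Rightarrow> 'm zigzag \<Rightarrow> ('o, 'm) loc_arr" where
  "loc_of_zz C W X Y p = LArr X Y (zz_class C W X Y p)"

definition loc_map :: "('o, 'm, 'z) cat_scheme \<Rightarrow> 'm set \<Rightarrow> 'm \<Rightarrow> ('o, 'm) loc_arr" where
  "loc_map C W f = loc_of_zz C W (Dom C f) (Cod C f) [Fwd f]"

definition localization ::
  "('o, 'm, 'z) cat_scheme \<Rightarrow> 'm set \<Rightarrow> ('o, ('o, 'm) loc_arr) cat" where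
  "localization C W = \<lparr>Obj = Obj C,
     Arr = {loc_of_zz C W X Y p | X Y p. zz_path C W X p Y},
     Dom = ldom, Cod = lcod,
     Ident = (\<lambda>X. loc_of_zz C W X X []),
     Comp = (\<lambda>g f. LArr (ldom f) (lcod g)
       (\<Union>p \<in> lcls f. \<Union>q \<in> lcls g. zz_class C W (ldom f) (lcod g) (p @ q)))\<rparr>"


section \<open>The bounded derived category and preaisles\<close>

text \<open>A category with a suspension and a class of distinguished triangles;
  the triangle \<open>X \<rightarrow> Y \<rightarrow> Z \<rightarrow> X[1]\<close> is recorded by its three arrows.\<close>

record ('o, 'm) tri_cat = "('o, 'm) cat" +
  Susp :: "'o \<Rightarrow> 'o"
  SuspArr :: "'m \<Rightarrow> 'm"
  Triangles :: "('m \<times> 'm \<times> 'm) set"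

type_synonym ('o, 'm) db_arr = "(('o, 'm) cpx, ('o, 'm) cmap) loc_arr"

definition Db_cat :: "('o, 'm, 'z) add_cat_scheme \<Rightarrow> (('o, 'm) cpx, ('o, 'm) db_arr) cat" where
  "Db_cat C = localization (Chb C) (quasi_isos C)"

definition Db_of :: "('o, 'm, 'z) add_cat_scheme \<Rightarrow> ('o, 'm) cmap \<Rightarrow> ('o, 'm) db_arr" where
  "Db_of C f = loc_map (Chb C) (quasi_isos C) f"

definition Db_susp :: "('o, 'm, 'z) add_cat_scheme \<Rightarrow> ('o, 'm) db_arr \<Rightarrow> ('o, 'm) db_arr" where
  "Db_susp C f = LArr (shift C 1 (ldom f)) (shift C 1 (lcod f))
     (\<Union>p \<in> lcls f. zz_class (Chb C) (quasi_isos C) (shift C 1 (ldom f)) (shift C 1 (lcod f))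
        (map (map_zz_letter (shift_map C 1)) p))"

text \<open>The distinguished triangles are those isomorphic to the standard triangle
  \<open>X \<rightarrow> Y \<rightarrow> cone u \<rightarrow> X[1]\<close> of some chain map \<open>u : X \<rightarrow> Y\<close>.\<close>

definition Db_triangles ::
  "('o, 'm, 'z) add_cat_scheme \<Rightarrow>
    (('o, 'm) db_arr \<times> ('o, 'm) db_arr \<times> ('o, 'm) db_arr) set" where
  "Db_triangles C = {(f, g, h). \<exists>X Y Z.
     f \<in> Hom (Db_cat C) X Y \<and> g \<in> Hom (Db_cat C) Y Z \<and> h \<in> Hom (Db_cat C) Z (shift C 1 X) \<and>
     (\<exists>u a b c. chain_map C u \<and>
        isomorphism (Db_cat C) a \<and> a \<in> Hom (Db_cat C) X (cdom u) \<and>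
        isomorphism (Db_cat C) b \<and> b \<in> Hom (Db_cat C) Y (ccod u) \<and>
        isomorphism (Db_cat C) c \<and> c \<in> Hom (Db_cat C) Z (cone C u) \<and>
        b \<bullet>\<^bsub>Db_cat C\<^esub> f = Db_of C u \<bullet>\<^bsub>Db_cat C\<^esub> a \<and>
        c \<bullet>\<^bsub>Db_cat C\<^esub> g = Db_of C (cone_inj C u) \<bullet>\<^bsub>Db_cat C\<^esub> b \<and>
        Db_susp C a \<bullet>\<^bsub>Db_cat C\<^esub> h = Db_of C (cone_proj C u) \<bullet>\<^bsub>Db_cat C\<^esub> c)}"

definition Db :: "('o, 'm, 'z) add_cat_scheme \<Rightarrow> (('o, 'm) cpx, ('o, 'm) db_arr) tri_cat" where
  "Db C = cat.extend (Db_cat C) (tri_cat.fields (shift C 1) (Db_susp C) (Db_triangles C))"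

definition preaisle :: "('o, 'm, 'z) tri_cat_scheme \<Rightarrow> 'o set \<Rightarrow> bool" where
  "preaisle T U \<longleftrightarrow> strict_full_subcategory T U \<and>
     (\<forall>X \<in> U. Susp T X \<in> U) \<and>
     (\<forall>(f, g, h) \<in> Triangles T. Dom T f \<in> U \<and> Cod T g \<in> U \<longrightarrow> Cod T f \<in> U)"

definition homology_determined ::
  "('o, 'm, 'z) add_cat_scheme \<Rightarrow> ('o, 'm) cpx set \<Rightarrow> bool" where
  "homology_determined C U \<longleftrightarrow>
     (\<forall>X \<in> Obj (Db C). X \<in> U \<longleftrightarrow> (\<forall>k. shift C k (stalk C (homology C k X)) \<in> U))"

definition hd_preaisles :: "('o, 'm, 'z) add_cat_scheme \<Rightarrow> ('o, 'm) cpx set set" where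
  "hd_preaisles C = {U. preaisle (Db C) U \<and> homology_determined C U}"


section \<open>Narrow sequences\<close>

definition narrow :: "('o, 'm, 'z) add_cat_scheme \<Rightarrow> 'o set \<Rightarrow> bool" where
  "narrow C N \<longleftrightarrow> strict_full_subcategory C N \<and>
     (\<forall>f g. short_exact C f g \<and> Dom C f \<in> N \<and> Cod C g \<in> N \<longrightarrow> Cod C f \<in> N) \<and>
     (\<forall>f c. is_cokernel C f c \<and> Dom C f \<in> N \<and> Cod C f \<in> N \<longrightarrow> Cod C c \<in> N)"

definition narrow_sequence :: "('o, 'm, 'z) add_cat_scheme \<Rightarrow> (int \<Rightarrow> 'o set) \<Rightarrow> bool" where
  "narrow_sequence C N \<longleftrightarrow> (\<forall>k. narrow C (N k)) \<and> (\<forall>k. N k \<subseteq> N (k + 1)) \<and>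
     (\<forall>k A B X D E p q r s.
        p \<in> Hom C A B \<and> q \<in> Hom C B X \<and> r \<in> Hom C X D \<and> s \<in> Hom C D E \<and>
        exact_pair C p q \<and> exact_pair C q r \<and> exact_pair C r s \<and>
        A \<in> N (k + 1) \<and> B \<in> N k \<and> D \<in> N k \<and> E \<in> N (k - 1) \<longrightarrow> X \<in> N k)"

definition narrow_sequences :: "('o, 'm, 'z) add_cat_scheme \<Rightarrow> (int \<Rightarrow> 'o set) set" where
  "narrow_sequences C = {N. narrow_sequence C N}"

definition theta :: "('o, 'm, 'z) add_cat_scheme \<Rightarrow> (int \<Rightarrow> 'o set) \<Rightarrow> ('o, 'm) cpx set" where
  "theta C N = {X \<in> Obj (Db C). \<forall>k. homology C k X \<in> N k}"

text \<open>The essential image of \<open>U\<close> under \<open>H\<^sub>k\<close>, for each \<open>k\<close>.\<close>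

definition mu :: "('o, 'm, 'z) add_cat_scheme \<Rightarrow> ('o, 'm) cpx set \<Rightarrow> int \<Rightarrow> 'o set" where
  "mu C U k = {A \<in> Obj C. \<exists>X \<in> U. isomorphic C (homology C k X) A}"

end

theory Submission
  imports Defs
begin

text \<open>
  That \<open>\<theta>(N)\<close> is closed under extensions is the five-term condition on \<open>N\<close> applied to the long
  exact homology sequence of a mapping cone; stalk complexes give \<open>\<mu>(\<theta>(N)) = N\<close>.
  Conversely, let \<open>U\<close> be a homology-determined preaisle.  If \<open>X \<rightarrow> Y \<rightarrow> Z\<close> is a degreewise short
  exact sequence of complexes with \<open>X\<close> and \<open>Z\<close> in \<open>U\<close>, then the cone of \<open>X \<rightarrow> Y\<close> has the same
  homology as \<open>Z\<close> and hence lies in \<open>U\<close>, so that \<open>Y\<close> does too.  For stalk complexes this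
  shows that \<open>\<mu>(U)(k)\<close> is closed under extensions.  Applied to the two-term complex of a map
  \<open>f : A \<rightarrow> B\<close> with \<open>A\<close> in \<open>\<mu>(U)(k + 1)\<close> and \<open>B\<close> in \<open>\<mu>(U)(k)\<close>, it puts the kernel of \<open>f\<close> in
  \<open>\<mu>(U)(k + 1)\<close> and its cokernel in \<open>\<mu>(U)(k)\<close>.  In an exact sequence
  \<open>A \<rightarrow> B \<rightarrow> X \<rightarrow> D \<rightarrow> E\<close> the object \<open>X\<close> is an extension of such a kernel by such a cokernel,
  which gives the five-term condition.  All diagram chases use generalized elements, that is,
  arrows into the object considered, which are lifted after composition with an epimorphism.
\<close>

section \<open>Arrows in a category\<close>

text \<open>Homology-determinedness makes membership in \<open>U\<close> depend only on the
  isomorphism classes of the single homology objects. Two complexes may therefore be exchanged as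
  soon as their homology agrees degree by degree, without any isomorphism between them in the
  derived category. The obstacle is that arrows of the derived category are classes of zigzags of
  arbitrary length. Three facts control them: cohomology inverts quasi-isomorphisms, so isomorphic
  objects of \<open>Db C\<close> have isomorphic cohomology; isomorphic objects of \<open>C\<close>
  have isomorphic stalk complexes; and up to isomorphism of objects the distinguished triangles are
  the cone triangles. The degrees in the five-term condition are those of a triangle
  \<open>X -> Y -> Z\<close>: around the homology of \<open>Y\<close> in degree \<open>k\<close>
  stand that of \<open>Z\<close> in degree \<open>k + 1\<close>, of \<open>X\<close> and
  \<open>Z\<close> in degree \<open>k\<close>, and of \<open>X\<close> in degree
  \<open>k - 1\<close>. They also fit two-term complexes: \<open>A -> B\<close> starts in degree
  \<open>k + 1\<close> and has its cokernel in degree \<open>k\<close>, while \<open>D -> E\<close>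
  starts in degree \<open>k\<close> and has its kernel there.\<close>

lemma in_Hom: "f \<in> Hom C X Y \<longleftrightarrow> f \<in> Arr C \<and> Dom C f = X \<and> Cod C f = Y"
  by (auto simp: Hom_def)

context category
begin

lemma dom_obj [simp]: "f \<in> Arr C \<Longrightarrow> Dom C f \<in> Obj C"
  by (rule dom_in)

lemma cod_obj [simp]: "f \<in> Arr C \<Longrightarrow> Cod C f \<in> Obj C"
  by (rule cod_in)

text \<open>Typing is stored as separate facts about the arrow and its two endpoints rather than as
  membership in \<open>Hom\<close>. Side conditions of later laws then reduce to computing endpoints
  by simplification.\<close>

lemma comp_arr [simp]:
  assumes "f \<in> Arr C" "g \<in> Arr C" "Cod C f = Dom C g"
  shows "g \<bullet> f \<in> Arr C" "Dom C (g \<bullet> f) = Dom C f" "Cod C (g \<bullet> f) = Cod C g"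
  using comp_in[of f "Dom C f" "Dom C g" g "Cod C g"] assms by (auto simp: in_Hom)

lemma ident_arr [simp]:
  assumes "X \<in> Obj C"
  shows "Ident C X \<in> Arr C" "Dom C (Ident C X) = X" "Cod C (Ident C X) = X"
  using ident_in[OF assms] by (auto simp: in_Hom)

lemma ident_comp [simp]: "f \<in> Arr C \<Longrightarrow> Cod C f = X \<Longrightarrow> Ident C X \<bullet> f = f"
  using ident_left by (auto simp: in_Hom)

lemma comp_ident [simp]: "f \<in> Arr C \<Longrightarrow> Dom C f = X \<Longrightarrow> f \<bullet> Ident C X = f"
  using ident_right by (auto simp: in_Hom)

lemma assoc [simp]:
  "f \<in> Arr C \<Longrightarrow> g \<in> Arr C \<Longrightarrow> h \<in> Arr C \<Longrightarrow> Cod C f = Dom C g \<Longrightarrow> Cod C g = Dom C h \<Longrightarrow>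
    (h \<bullet> g) \<bullet> f = h \<bullet> g \<bullet> f"
  using comp_assoc[of f _ _ g _ h] by (auto simp: in_Hom)

text \<open>Simplification nests composites to the right, so the left side of an equation between
  composites no longer occurs as a subterm once something is composed on the right. This form
  restores the rewrite; most steps of the diagram chases go through it.\<close>

lemma comp_eq_left:
  assumes "h \<bullet> g = k" "f \<in> Arr C" "g \<in> Arr C" "h \<in> Arr C" "Cod C f = Dom C g" "Cod C g = Dom C h"
  shows "h \<bullet> g \<bullet> f = k \<bullet> f"
  using assms assoc[of f g h] by simp

lemma isomorphismI:
  assumes "f \<in> Arr C" "g \<in> Arr C" "Dom C g = Cod C f" "Cod C g = Dom C f"
    and "g \<bullet> f = Ident C (Dom C f)" "f \<bullet> g = Ident C (Cod C f)"
  shows "isomorphism C f"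
  using assms unfolding isomorphism_def by (auto simp: in_Hom)

lemma isomorphism_obtain:
  assumes "isomorphism C f"
  obtains g where "g \<in> Arr C" "Dom C g = Cod C f" "Cod C g = Dom C f"
    "g \<bullet> f = Ident C (Dom C f)" "f \<bullet> g = Ident C (Cod C f)" "f \<in> Arr C"
  using assms unfolding isomorphism_def by (auto simp: in_Hom)

lemma isomorphism_ident: "X \<in> Obj C \<Longrightarrow> isomorphism C (Ident C X)"
  by (rule isomorphismI[of _ "Ident C X"]) auto

lemma isomorphic_refl: "X \<in> Obj C \<Longrightarrow> isomorphic C X X"
  unfolding isomorphic_def using isomorphism_ident[of X] ident_in by blast

lemma isomorphic_sym: "isomorphic C X Y \<Longrightarrow> isomorphic C Y X"
  unfolding isomorphic_def
  by (metis in_Hom isomorphismI isomorphism_obtain)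

lemma isomorphic_obj: "isomorphic C X Y \<Longrightarrow> X \<in> Obj C \<and> Y \<in> Obj C"
  unfolding isomorphic_def by (auto simp: in_Hom)

lemma zero_object_ex1:
  assumes "zero_object C Z" "X \<in> Obj C"
  shows "\<exists>!f. f \<in> Hom C X Z" "\<exists>!f. f \<in> Hom C Z X"
  using assms by (simp_all add: zero_object_def)

lemma monoD:
  assumes "monomorphism C f" "g \<in> Arr C" "h \<in> Arr C" "Cod C g = Dom C f" "Cod C h = Dom C f"
    "Dom C g = Dom C h" "f \<bullet> g = f \<bullet> h"
  shows "g = h"
  using assms unfolding monomorphism_def by (auto simp: in_Hom)

lemma epiD:
  assumes "epimorphism C f" "g \<in> Arr C" "h \<in> Arr C" "Dom C g = Cod C f" "Dom C h = Cod C f"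
    "Cod C g = Cod C h" "g \<bullet> f = h \<bullet> f"
  shows "g = h"
  using assms unfolding epimorphism_def by (auto simp: in_Hom)

lemma mono_arr: "monomorphism C f \<Longrightarrow> f \<in> Arr C"
  by (simp add: monomorphism_def)

lemma epi_arr: "epimorphism C f \<Longrightarrow> f \<in> Arr C"
  by (simp add: epimorphism_def)

lemma epi_ident [simp]: "X \<in> Obj C \<Longrightarrow> epimorphism C (Ident C X)"
  unfolding epimorphism_def by (auto simp: in_Hom)

lemma mono_ident [simp]: "X \<in> Obj C \<Longrightarrow> monomorphism C (Ident C X)"
  unfolding monomorphism_def by (auto simp: in_Hom)

lemma epi_comp:
  assumes "epimorphism C f" "epimorphism C g" "Cod C f = Dom C g"
  shows "epimorphism C (g \<bullet> f)"
  unfolding epimorphism_def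
proof (intro conjI allI ballI impI)
  have [simp]: "f \<in> Arr C" "g \<in> Arr C" using assms by (auto intro: epi_arr)
  show "g \<bullet> f \<in> Arr C" using assms by simp
  fix Z h k
  assume "h \<in> Hom C (Cod C (g \<bullet> f)) Z" "k \<in> Hom C (Cod C (g \<bullet> f)) Z"
    and eq: "h \<bullet> g \<bullet> f = k \<bullet> g \<bullet> f"
  then have [simp]: "h \<in> Arr C" "k \<in> Arr C" "Dom C h = Cod C g" "Dom C k = Cod C g"
    "Cod C h = Z" "Cod C k = Z"
    using assms(3) by (auto simp: in_Hom)
  have hk: "h \<bullet> g = k \<bullet> g"
    by (rule epiD[OF assms(1)]) (use eq assms(3) in simp_all)
  show "h = k" by (rule epiD[OF assms(2) _ _ _ _ _ hk]) simp_all
qed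

text \<open>Lifting a cover through \<open>g\<close> exhibits an epimorphism as a composite that
  ends in \<open>g\<close>; the criterion is meant for such lifts.\<close>

lemma epi_cancel:
  assumes "epimorphism C (g \<bullet> f)" "f \<in> Arr C" "g \<in> Arr C" "Cod C f = Dom C g"
  shows "epimorphism C g"
  unfolding epimorphism_def
proof (intro conjI allI ballI impI)
  show "g \<in> Arr C" by fact
  fix Z h k
  assume h: "h \<in> Hom C (Cod C g) Z" "k \<in> Hom C (Cod C g) Z" and eq: "h \<bullet> g = k \<bullet> g"
  have hk: "h \<bullet> g \<bullet> f = k \<bullet> g \<bullet> f"
    using h assms eq by (metis assoc in_Hom)
  show "h = k"
    by (rule epiD[OF assms(1)]) (use h hk assms in \<open>auto simp: in_Hom\<close>)
qed

lemma isomorphism_mono: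
  assumes "isomorphism C f"
  shows "monomorphism C f"
proof -
  obtain g where g: "g \<in> Arr C" "Dom C g = Cod C f" "Cod C g = Dom C f"
    "g \<bullet> f = Ident C (Dom C f)" "f \<in> Arr C"
    using assms by (rule isomorphism_obtain)
  have "x = y" if "x \<in> Hom C W (Dom C f)" "y \<in> Hom C W (Dom C f)" "f \<bullet> x = f \<bullet> y" for W x y
  proof -
    have "z = g \<bullet> f \<bullet> z" if "z \<in> Hom C W (Dom C f)" for z
      using that g comp_eq_left[OF g(4), of z] by (simp add: in_Hom)
    then show ?thesis using that by metis
  qed
  then show ?thesis using g unfolding monomorphism_def by blast
qed

lemma isomorphism_epi:
  assumes "isomorphism C f"
  shows "epimorphism C f"
proof -
  obtain g where g: "g \<in> Arr C" "Dom C g = Cod C f" "Cod C g = Dom C f"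
    "f \<bullet> g = Ident C (Cod C f)" "f \<in> Arr C"
    using assms by (rule isomorphism_obtain)
  have "x = y" if "x \<in> Hom C (Cod C f) W" "y \<in> Hom C (Cod C f) W" "x \<bullet> f = y \<bullet> f" for W x y
  proof -
    have "(x \<bullet> f) \<bullet> g = (y \<bullet> f) \<bullet> g" using that by simp
    then show ?thesis using that(1,2) g by (simp add: in_Hom)
  qed
  then show ?thesis using g unfolding epimorphism_def by blast
qed

end

section \<open>Elementary theory of abelian categories\<close>

context abelian_category
begin

subsection \<open>Arithmetic of arrows\<close>

context
  fixes X Y
  assumes XY: "X \<in> Obj C" "Y \<in> Obj C"
begin

interpretation G: comm_group "hom_group C X Y"
  using hom_comm_group XY .

lemma zero_in_Hom: "Zero C X Y \<in> Hom C X Y"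
  using G.one_closed by (simp add: hom_group_def)

lemma add_in_Hom: "f \<in> Hom C X Y \<Longrightarrow> g \<in> Hom C X Y \<Longrightarrow> f \<boxplus> g \<in> Hom C X Y"
  using G.m_closed[of f g] by (simp add: hom_group_def)

lemma neg_in_Hom: "f \<in> Hom C X Y \<Longrightarrow> Neg C f \<in> Hom C X Y"
  using G.inv_closed[of f] by (simp add: hom_group_def Neg_def in_Hom)

lemma Hom_add_assoc:
  "f \<in> Hom C X Y \<Longrightarrow> g \<in> Hom C X Y \<Longrightarrow> h \<in> Hom C X Y \<Longrightarrow> f \<boxplus> g \<boxplus> h = f \<boxplus> (g \<boxplus> h)"
  using G.m_assoc[of f g h] by (simp add: hom_group_def)

lemma Hom_add_comm: "f \<in> Hom C X Y \<Longrightarrow> g \<in> Hom C X Y \<Longrightarrow> f \<boxplus> g = g \<boxplus> f"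
  using G.m_comm[of f g] by (simp add: hom_group_def)

lemma Hom_zero_add: "f \<in> Hom C X Y \<Longrightarrow> Zero C X Y \<boxplus> f = f"
  using G.l_one[of f] by (simp add: hom_group_def)

lemma Hom_neg_add: "f \<in> Hom C X Y \<Longrightarrow> Neg C f \<boxplus> f = Zero C X Y"
  using G.l_inv[of f] by (simp add: hom_group_def in_Hom Neg_def)

end

lemma zero_arr [simp]:
  assumes "X \<in> Obj C" "Y \<in> Obj C"
  shows "Zero C X Y \<in> Arr C" "Dom C (Zero C X Y) = X" "Cod C (Zero C X Y) = Y"
  using zero_in_Hom[OF assms] by (auto simp: in_Hom)

lemma add_arr [simp]:
  assumes "f \<in> Arr C" "g \<in> Arr C" "Dom C f = Dom C g" "Cod C f = Cod C g"
  shows "f \<boxplus> g \<in> Arr C" "Dom C (f \<boxplus> g) = Dom C g" "Cod C (f \<boxplus> g) = Cod C g"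
  using add_in_Hom[of "Dom C g" "Cod C g" f g] assms by (auto simp: in_Hom)

lemma neg_arr [simp]:
  assumes "f \<in> Arr C"
  shows "Neg C f \<in> Arr C" "Dom C (Neg C f) = Dom C f" "Cod C (Neg C f) = Cod C f"
  using neg_in_Hom[of "Dom C f" "Cod C f" f] assms by (auto simp: in_Hom)

lemma add_assoc:
  "f \<in> Arr C \<Longrightarrow> g \<in> Arr C \<Longrightarrow> h \<in> Arr C \<Longrightarrow> Dom C f = Dom C g \<Longrightarrow> Dom C g = Dom C h \<Longrightarrow>
    Cod C f = Cod C g \<Longrightarrow> Cod C g = Cod C h \<Longrightarrow> f \<boxplus> g \<boxplus> h = f \<boxplus> (g \<boxplus> h)"
  using Hom_add_assoc[of "Dom C h" "Cod C h" f g h] by (auto simp: in_Hom)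

lemma add_comm:
  "f \<in> Arr C \<Longrightarrow> g \<in> Arr C \<Longrightarrow> Dom C f = Dom C g \<Longrightarrow> Cod C f = Cod C g \<Longrightarrow> f \<boxplus> g = g \<boxplus> f"
  using Hom_add_comm[of "Dom C g" "Cod C g" f g] by (auto simp: in_Hom)

lemma add_left_comm:
  assumes "f \<in> Arr C" "g \<in> Arr C" "h \<in> Arr C" "Dom C f = Dom C g" "Dom C g = Dom C h"
    "Cod C f = Cod C g" "Cod C g = Cod C h"
  shows "f \<boxplus> (g \<boxplus> h) = g \<boxplus> (f \<boxplus> h)"
proof -
  have "f \<boxplus> (g \<boxplus> h) = f \<boxplus> g \<boxplus> h" by (rule add_assoc[symmetric]) (use assms in simp_all)
  also have "\<dots> = g \<boxplus> f \<boxplus> h" using add_comm[of f g] assms by simp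
  also have "\<dots> = g \<boxplus> (f \<boxplus> h)" by (rule add_assoc) (use assms in simp_all)
  finally show ?thesis .
qed

lemmas add_ac = add_assoc add_comm add_left_comm

lemma zero_add [simp]: "f \<in> Arr C \<Longrightarrow> Dom C f = X \<Longrightarrow> Cod C f = Y \<Longrightarrow> Zero C X Y \<boxplus> f = f"
  using Hom_zero_add[of X Y f] by (auto simp: in_Hom)

lemma add_zero [simp]: "f \<in> Arr C \<Longrightarrow> Dom C f = X \<Longrightarrow> Cod C f = Y \<Longrightarrow> f \<boxplus> Zero C X Y = f"
  using zero_add[of f X Y] add_comm[of f "Zero C X Y"] by auto

lemma neg_add [simp]: "f \<in> Arr C \<Longrightarrow> Neg C f \<boxplus> f = Zero C (Dom C f) (Cod C f)"
  using Hom_neg_add[of "Dom C f" "Cod C f" f] by (auto simp: in_Hom)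

lemma add_neg [simp]: "f \<in> Arr C \<Longrightarrow> f \<boxplus> Neg C f = Zero C (Dom C f) (Cod C f)"
  using add_comm[of f "Neg C f"] by simp

lemma add_neg_cancel [simp]:
  "f \<in> Arr C \<Longrightarrow> g \<in> Arr C \<Longrightarrow> Dom C f = Dom C g \<Longrightarrow> Cod C f = Cod C g \<Longrightarrow>
    f \<boxplus> (Neg C f \<boxplus> g) = g"
  "f \<in> Arr C \<Longrightarrow> g \<in> Arr C \<Longrightarrow> Dom C f = Dom C g \<Longrightarrow> Cod C f = Cod C g \<Longrightarrow>
    Neg C f \<boxplus> (f \<boxplus> g) = g"
  using add_assoc[of f "Neg C f" g] add_assoc[of "Neg C f" f g] by simp_all

text \<open>Additive inverses are unique. The later sign rules, from \<open>neg_neg\<close> to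
  \<open>neg_comp\<close>, are read off from this.\<close>

lemma add_eq_zero_imp:
  assumes "f \<in> Arr C" "g \<in> Arr C" "Dom C f = Dom C g" "Cod C f = Cod C g"
    and "f \<boxplus> g = Zero C (Dom C g) (Cod C g)"
  shows "g = Neg C f"
proof -
  have "g = Neg C f \<boxplus> (f \<boxplus> g)" using assms(1-4) by simp
  then show ?thesis using assms by simp
qed

lemma neg_neg [simp]: "f \<in> Arr C \<Longrightarrow> Neg C (Neg C f) = f"
  by (rule add_eq_zero_imp[symmetric]) simp_all

lemma neg_zero [simp]: "X \<in> Obj C \<Longrightarrow> Y \<in> Obj C \<Longrightarrow> Neg C (Zero C X Y) = Zero C X Y"
  by (rule add_eq_zero_imp[symmetric]) simp_all

lemma neg_distrib [simp]:
  assumes "f \<in> Arr C" "g \<in> Arr C" "Dom C f = Dom C g" "Cod C f = Cod C g"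
  shows "Neg C (f \<boxplus> g) = Neg C f \<boxplus> Neg C g"
  by (rule add_eq_zero_imp[symmetric]) (use assms in \<open>simp_all add: add_ac\<close>)

lemma diff_zero_imp_eq:
  assumes "f \<in> Arr C" "g \<in> Arr C" "Dom C f = Dom C g" "Cod C f = Cod C g"
    and "f \<boxplus> Neg C g = Zero C (Dom C g) (Cod C g)"
  shows "f = g"
  using add_eq_zero_imp[of f "Neg C g"] assms by (metis neg_arr neg_neg)

lemma comp_add [simp]:
  "f \<in> Arr C \<Longrightarrow> f' \<in> Arr C \<Longrightarrow> g \<in> Arr C \<Longrightarrow> Dom C f = Dom C f' \<Longrightarrow> Cod C f = Dom C g \<Longrightarrow>
    Cod C f' = Dom C g \<Longrightarrow> g \<bullet> (f \<boxplus> f') = (g \<bullet> f) \<boxplus> (g \<bullet> f')"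
  using comp_add_right[of f _ _ f' g] by (auto simp: in_Hom)

lemma add_comp [simp]:
  "f \<in> Arr C \<Longrightarrow> g \<in> Arr C \<Longrightarrow> g' \<in> Arr C \<Longrightarrow> Cod C g = Cod C g' \<Longrightarrow> Dom C g = Cod C f \<Longrightarrow>
    Dom C g' = Cod C f \<Longrightarrow> (g \<boxplus> g') \<bullet> f = (g \<bullet> f) \<boxplus> (g' \<bullet> f)"
  using comp_add_left[of f _ _ g _ g'] by (auto simp: in_Hom)

lemma add_self_imp_zero:
  assumes "f \<in> Arr C" "f \<boxplus> f = f"
  shows "f = Zero C (Dom C f) (Cod C f)"
  using add_neg_cancel(2)[of f f] assms by simp

text \<open>Additivity of composition forces this: the composite equals its own double, and in a
  group only the neutral element does.\<close>

lemma comp_zero [simp]: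
  assumes "g \<in> Arr C" "Dom C g = Y" "X \<in> Obj C"
  shows "g \<bullet> Zero C X Y = Zero C X (Cod C g)"
proof -
  have [simp]: "Y \<in> Obj C" using assms by auto
  have "g \<bullet> Zero C X Y \<boxplus> g \<bullet> Zero C X Y = g \<bullet> (Zero C X Y \<boxplus> Zero C X Y)"
    using assms by (simp del: zero_add add_zero)
  then have "g \<bullet> Zero C X Y \<boxplus> g \<bullet> Zero C X Y = g \<bullet> Zero C X Y"
    using assms by simp
  from add_self_imp_zero[OF _ this] show ?thesis using assms by simp
qed

lemma zero_comp [simp]:
  assumes "f \<in> Arr C" "Cod C f = X" "Y \<in> Obj C"
  shows "Zero C X Y \<bullet> f = Zero C (Dom C f) Y"
proof -
  have [simp]: "X \<in> Obj C" using assms by auto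
  have "Zero C X Y \<bullet> f \<boxplus> Zero C X Y \<bullet> f = (Zero C X Y \<boxplus> Zero C X Y) \<bullet> f"
    using assms by (simp del: zero_add add_zero)
  then have "Zero C X Y \<bullet> f \<boxplus> Zero C X Y \<bullet> f = Zero C X Y \<bullet> f"
    using assms by simp
  from add_self_imp_zero[OF _ this] show ?thesis using assms by simp
qed

lemma comp_neg [simp]:
  assumes "f \<in> Arr C" "g \<in> Arr C" "Cod C f = Dom C g"
  shows "g \<bullet> Neg C f = Neg C (g \<bullet> f)"
proof (rule add_eq_zero_imp)
  show "g \<bullet> f \<boxplus> g \<bullet> Neg C f = Zero C (Dom C (g \<bullet> Neg C f)) (Cod C (g \<bullet> Neg C f))"
    using comp_add[of f "Neg C f" g] assms by simp
qed (use assms in simp_all)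

lemma neg_comp [simp]:
  assumes "f \<in> Arr C" "g \<in> Arr C" "Cod C f = Dom C g"
  shows "Neg C g \<bullet> f = Neg C (g \<bullet> f)"
proof (rule add_eq_zero_imp)
  show "g \<bullet> f \<boxplus> Neg C g \<bullet> f = Zero C (Dom C (Neg C g \<bullet> f)) (Cod C (Neg C g \<bullet> f))"
    using add_comp[of f g "Neg C g"] assms by simp
qed (use assms in simp_all)

lemma neg_eq_zero_iff [simp]:
  "f \<in> Arr C \<Longrightarrow> X = Dom C f \<Longrightarrow> Y = Cod C f \<Longrightarrow> Neg C f = Zero C X Y \<longleftrightarrow> f = Zero C X Y"
  by (metis cod_obj dom_obj neg_neg neg_zero)

section \<open>Monomorphisms and epimorphisms tested on zero arrows\<close>

lemma monoI:
  assumes "f \<in> Arr C"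
    and "\<And>g. g \<in> Arr C \<Longrightarrow> Cod C g = Dom C f \<Longrightarrow> f \<bullet> g = Zero C (Dom C g) (Cod C f) \<Longrightarrow>
      g = Zero C (Dom C g) (Dom C f)"
  shows "monomorphism C f"
  unfolding monomorphism_def
proof (intro conjI allI ballI impI)
  fix W g h
  assume gh: "g \<in> Hom C W (Dom C f)" "h \<in> Hom C W (Dom C f)" and eq: "f \<bullet> g = f \<bullet> h"
  have d: "g \<boxplus> Neg C h = Zero C W (Dom C f)"
    using assms(2)[of "g \<boxplus> Neg C h"] assms(1) gh eq by (simp add: in_Hom)
  show "g = h" by (rule diff_zero_imp_eq) (use d gh in \<open>auto simp: in_Hom\<close>)
qed fact

lemma epiI:
  assumes "f \<in> Arr C"
    and "\<And>g. g \<in> Arr C \<Longrightarrow> Dom C g = Cod C f \<Longrightarrow> g \<bullet> f = Zero C (Dom C f) (Cod C g) \<Longrightarrow>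
      g = Zero C (Cod C f) (Cod C g)"
  shows "epimorphism C f"
  unfolding epimorphism_def
proof (intro conjI allI ballI impI)
  fix Z g h
  assume gh: "g \<in> Hom C (Cod C f) Z" "h \<in> Hom C (Cod C f) Z" and eq: "g \<bullet> f = h \<bullet> f"
  have d: "g \<boxplus> Neg C h = Zero C (Cod C f) Z"
    using assms(2)[of "g \<boxplus> Neg C h"] assms(1) gh eq by (simp add: in_Hom)
  show "g = h" by (rule diff_zero_imp_eq) (use d gh in \<open>auto simp: in_Hom\<close>)
qed fact

lemma mono_zeroD:
  assumes "monomorphism C f" "g \<in> Arr C" "Cod C g = Dom C f"
    "f \<bullet> g = Zero C (Dom C g) (Cod C f)"
  shows "g = Zero C (Dom C g) (Dom C f)"
  by (rule monoD[OF assms(1)]) (use mono_arr[OF assms(1)] assms(2-) in auto)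

lemma epi_zeroD:
  assumes "epimorphism C f" "g \<in> Arr C" "Dom C g = Cod C f"
    "g \<bullet> f = Zero C (Dom C f) (Cod C g)"
  shows "g = Zero C (Cod C f) (Cod C g)"
  by (rule epiD[OF assms(1)]) (use epi_arr[OF assms(1)] assms(2-) in auto)

subsection \<open>Zero objects\<close>

lemma zero_obj_zero: "zero_object C (zero_obj C)"
  unfolding zero_obj_def using ex_zero_object by (rule someI_ex)

lemma zero_object_obj: "zero_object C Z \<Longrightarrow> Z \<in> Obj C"
  by (simp add: zero_object_def)

lemma zero_obj_obj [simp]: "zero_obj C \<in> Obj C"
  using zero_obj_zero zero_object_obj by blast

lemma to_zero_object:
  assumes "zero_object C Z" "f \<in> Arr C" "Cod C f = Z"
  shows "f = Zero C (Dom C f) Z"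
  using zero_object_ex1(1)[OF assms(1), of "Dom C f"] zero_in_Hom[of "Dom C f" Z] assms
    zero_object_obj[OF assms(1)] by (auto simp: in_Hom)

lemma from_zero_object:
  assumes "zero_object C Z" "f \<in> Arr C" "Dom C f = Z"
  shows "f = Zero C Z (Cod C f)"
  using zero_object_ex1(2)[OF assms(1), of "Cod C f"] zero_in_Hom[of Z "Cod C f"] assms
    zero_object_obj[OF assms(1)] by (auto simp: in_Hom)

text \<open>If the identity vanishes, so does every arrow into or out of the object. This equation
  is easier to verify than two unique-existence statements, for instance for cohomology objects and
  for cones.\<close>

lemma zero_object_iff_ident:
  "zero_object C Z \<longleftrightarrow> Z \<in> Obj C \<and> Ident C Z = Zero C Z Z" (is "?l \<longleftrightarrow> ?r")
proof
  assume ?l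
  then show ?r using to_zero_object[of Z "Ident C Z"] by (auto simp: zero_object_obj)
next
  assume r: ?r
  have "f = Zero C X Z" if "X \<in> Obj C" "f \<in> Hom C X Z" for f X
    using that r ident_comp[of f Z] by (simp add: in_Hom)
  moreover have "f = Zero C Z X" if "X \<in> Obj C" "f \<in> Hom C Z X" for f X
    using that r comp_ident[of f Z] by (simp add: in_Hom)
  ultimately show ?l using r unfolding zero_object_def by (metis zero_in_Hom)
qed

subsection \<open>Kernels, cokernels and exactness\<close>

lemma is_kernelD:
  assumes "is_kernel C f k"
  shows "f \<in> Arr C" "k \<in> Arr C" "Cod C k = Dom C f" "f \<bullet> k = Zero C (Dom C k) (Cod C f)"
  using assms unfolding is_kernel_def by auto

lemma is_cokernelD:
  assumes "is_cokernel C f c"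
  shows "f \<in> Arr C" "c \<in> Arr C" "Dom C c = Cod C f" "c \<bullet> f = Zero C (Dom C f) (Cod C c)"
  using assms unfolding is_cokernel_def by auto

lemma is_kernel_univ:
  "is_kernel C f k \<Longrightarrow> g \<in> Hom C W (Dom C f) \<Longrightarrow> f \<bullet> g = Zero C W (Cod C f) \<Longrightarrow>
    \<exists>!h. h \<in> Hom C W (Dom C k) \<and> k \<bullet> h = g"
  unfolding is_kernel_def by blast

lemma is_cokernel_univ:
  "is_cokernel C f c \<Longrightarrow> g \<in> Hom C (Cod C f) Z \<Longrightarrow> g \<bullet> f = Zero C (Dom C f) Z \<Longrightarrow>
    \<exists>!h. h \<in> Hom C (Cod C c) Z \<and> h \<bullet> c = g"
  unfolding is_cokernel_def by blast

lemma kernel_lift: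
  assumes "is_kernel C f k" "g \<in> Arr C" "Cod C g = Dom C f"
    "f \<bullet> g = Zero C (Dom C g) (Cod C f)"
  obtains h where "h \<in> Arr C" "Dom C h = Dom C g" "Cod C h = Dom C k" "k \<bullet> h = g"
proof -
  have "\<exists>!h. h \<in> Hom C (Dom C g) (Dom C k) \<and> k \<bullet> h = g"
    using assms(1) by (rule is_kernel_univ) (use assms in \<open>simp_all add: in_Hom\<close>)
  then show ?thesis using that by (auto simp: in_Hom)
qed

lemma cokernel_desc:
  assumes "is_cokernel C f c" "g \<in> Arr C" "Dom C g = Cod C f"
    "g \<bullet> f = Zero C (Dom C f) (Cod C g)"
  obtains h where "h \<in> Arr C" "Dom C h = Cod C c" "Cod C h = Cod C g" "h \<bullet> c = g"
proof -
  have "\<exists>!h. h \<in> Hom C (Cod C c) (Cod C g) \<and> h \<bullet> c = g"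
    using assms(1) by (rule is_cokernel_univ) (use assms in \<open>simp_all add: in_Hom\<close>)
  then show ?thesis using that by (auto simp: in_Hom)
qed

lemma kernel_mono:
  assumes "is_kernel C f k"
  shows "monomorphism C k"
proof -
  note k = is_kernelD[OF assms]
  show ?thesis unfolding monomorphism_def
  proof (intro conjI allI ballI impI)
    fix W g h
    assume "g \<in> Hom C W (Dom C k)" "h \<in> Hom C W (Dom C k)" and eq: "k \<bullet> g = k \<bullet> h"
    then have gh: "g \<in> Arr C" "Dom C g = W" "Cod C g = Dom C k"
      "h \<in> Arr C" "Dom C h = W" "Cod C h = Dom C k" by (auto simp: in_Hom)
    have "f \<bullet> k \<bullet> g = Zero C W (Cod C f)"
      using comp_eq_left[OF k(4)] gh k by simp
    then have "\<exists>!x. x \<in> Hom C W (Dom C k) \<and> k \<bullet> x = k \<bullet> g"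
      by (intro is_kernel_univ[OF assms]) (use gh k in \<open>simp_all add: in_Hom\<close>)
    then show "g = h" using gh eq in_Hom by metis
  qed (rule k)
qed

lemma cokernel_epi:
  assumes "is_cokernel C f c"
  shows "epimorphism C c"
proof -
  note c = is_cokernelD[OF assms]
  show ?thesis unfolding epimorphism_def
  proof (intro conjI allI ballI impI)
    fix W g h
    assume "g \<in> Hom C (Cod C c) W" "h \<in> Hom C (Cod C c) W" and eq: "g \<bullet> c = h \<bullet> c"
    then have gh: "g \<in> Arr C" "Cod C g = W" "Dom C g = Cod C c"
      "h \<in> Arr C" "Cod C h = W" "Dom C h = Cod C c" by (auto simp: in_Hom)
    have "(g \<bullet> c) \<bullet> f = Zero C (Dom C f) W"
      using gh c by simp
    then have "\<exists>!x. x \<in> Hom C (Cod C c) W \<and> x \<bullet> c = g \<bullet> c"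
      by (intro is_cokernel_univ[OF assms]) (use gh c in \<open>simp_all add: in_Hom\<close>)
    then show "g = h" using gh eq in_Hom by metis
  qed (rule c)
qed

lemma is_kernelI:
  assumes "f \<in> Arr C" "monomorphism C k" "Cod C k = Dom C f"
    "f \<bullet> k = Zero C (Dom C k) (Cod C f)"
    and lift: "\<And>g. g \<in> Arr C \<Longrightarrow> Cod C g = Dom C f \<Longrightarrow> f \<bullet> g = Zero C (Dom C g) (Cod C f) \<Longrightarrow>
      \<exists>h \<in> Hom C (Dom C g) (Dom C k). k \<bullet> h = g"
  shows "is_kernel C f k"
  unfolding is_kernel_def
proof (intro conjI allI ballI impI)
  show "k \<in> Arr C" using assms mono_arr by blast
  fix W g
  assume "g \<in> Hom C W (Dom C f)" "f \<bullet> g = Zero C W (Cod C f)"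
  then obtain h where "h \<in> Hom C W (Dom C k)" "k \<bullet> h = g"
    using lift[of g] by (auto simp: in_Hom)
  then show "\<exists>!h. h \<in> Hom C W (Dom C k) \<and> k \<bullet> h = g"
    using assms(2) unfolding monomorphism_def by blast
qed fact+

lemma is_cokernelI:
  assumes "f \<in> Arr C" "epimorphism C c" "Dom C c = Cod C f"
    "c \<bullet> f = Zero C (Dom C f) (Cod C c)"
    and desc: "\<And>g. g \<in> Arr C \<Longrightarrow> Dom C g = Cod C f \<Longrightarrow> g \<bullet> f = Zero C (Dom C f) (Cod C g) \<Longrightarrow>
      \<exists>h \<in> Hom C (Cod C c) (Cod C g). h \<bullet> c = g"
  shows "is_cokernel C f c"
  unfolding is_cokernel_def
proof (intro conjI allI ballI impI)
  show "c \<in> Arr C" using assms epi_arr by blast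
  fix W g
  assume "g \<in> Hom C (Cod C f) W" "g \<bullet> f = Zero C (Dom C f) W"
  then obtain h where "h \<in> Hom C (Cod C c) W" "h \<bullet> c = g"
    using desc[of g] by (auto simp: in_Hom)
  then show "\<exists>!h. h \<in> Hom C (Cod C c) W \<and> h \<bullet> c = g"
    using assms(2) unfolding epimorphism_def by blast
qed fact+

lemma kernel_of_zero:
  "X \<in> Obj C \<Longrightarrow> Y \<in> Obj C \<Longrightarrow> is_kernel C (Zero C X Y) (Ident C X)"
  by (rule is_kernelI) (auto simp: in_Hom)

lemma cokernel_of_zero:
  "X \<in> Obj C \<Longrightarrow> Y \<in> Obj C \<Longrightarrow> is_cokernel C (Zero C X Y) (Ident C Y)"
  by (rule is_cokernelI) (auto simp: in_Hom)

lemma ker_is_kernel: "f \<in> Arr C \<Longrightarrow> is_kernel C f (ker C f)"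
  unfolding ker_def using ex_kernel by (rule someI_ex)

lemma coker_is_cokernel: "f \<in> Arr C \<Longrightarrow> is_cokernel C f (coker C f)"
  unfolding coker_def using ex_cokernel by (rule someI_ex)

lemma ker_arr [simp]:
  assumes "f \<in> Arr C"
  shows "ker C f \<in> Arr C" "Cod C (ker C f) = Dom C f"
    "f \<bullet> ker C f = Zero C (Dom C (ker C f)) (Cod C f)" "monomorphism C (ker C f)"
  using is_kernelD[OF ker_is_kernel[OF assms]] kernel_mono[OF ker_is_kernel[OF assms]] by auto

lemma coker_arr [simp]:
  assumes "f \<in> Arr C"
  shows "coker C f \<in> Arr C" "Dom C (coker C f) = Cod C f"
    "coker C f \<bullet> f = Zero C (Dom C f) (Cod C (coker C f))" "epimorphism C (coker C f)"
  using is_cokernelD[OF coker_is_cokernel[OF assms]] cokernel_epi[OF coker_is_cokernel[OF assms]]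
  by auto

lemma kernel_unique:
  assumes "is_kernel C f k" "is_kernel C f k'"
  obtains h where "isomorphism C h" "h \<in> Hom C (Dom C k) (Dom C k')" "k' \<bullet> h = k"
proof -
  note k = is_kernelD[OF assms(1)] is_kernelD[OF assms(2)]
  obtain h where h: "h \<in> Arr C" "Dom C h = Dom C k" "Cod C h = Dom C k'" "k' \<bullet> h = k"
    using kernel_lift[OF assms(2), of k] k by auto
  obtain g where g: "g \<in> Arr C" "Dom C g = Dom C k'" "Cod C g = Dom C k" "k \<bullet> g = k'"
    using kernel_lift[OF assms(1), of k'] k by auto
  have "g \<bullet> h = Ident C (Dom C h)"
    by (rule monoD[OF kernel_mono[OF assms(1)]]) (use h g k in \<open>simp_all add: comp_eq_left[OF g(4)]\<close>)
  moreover have "h \<bullet> g = Ident C (Cod C h)"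
    by (rule monoD[OF kernel_mono[OF assms(2)]]) (use h g k in \<open>simp_all add: comp_eq_left[OF h(4)]\<close>)
  ultimately have "isomorphism C h" using h g by (intro isomorphismI[of h g]) simp_all
  then show ?thesis using that h by (simp add: in_Hom)
qed

lemma cokernel_unique:
  assumes "is_cokernel C f c" "is_cokernel C f c'"
  shows "isomorphic C (Cod C c) (Cod C c')"
proof -
  note c = is_cokernelD[OF assms(1)] is_cokernelD[OF assms(2)]
  obtain h where h: "h \<in> Arr C" "Dom C h = Cod C c" "Cod C h = Cod C c'" "h \<bullet> c = c'"
    using cokernel_desc[OF assms(1), of c'] c by auto
  obtain g where g: "g \<in> Arr C" "Dom C g = Cod C c'" "Cod C g = Cod C c" "g \<bullet> c' = c"
    using cokernel_desc[OF assms(2), of c] c by auto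
  have "g \<bullet> h = Ident C (Dom C h)"
    by (rule epiD[OF cokernel_epi[OF assms(1)]]) (use h g c in simp_all)
  moreover have "h \<bullet> g = Ident C (Cod C h)"
    by (rule epiD[OF cokernel_epi[OF assms(2)]]) (use h g c in simp_all)
  ultimately have "isomorphism C h" using h g by (intro isomorphismI[of h g]) simp_all
  then show ?thesis using h by (auto simp: in_Hom isomorphic_def)
qed

text \<open>Write \<open>m\<close> for the image and \<open>f = m e\<close>. If
  \<open>g e = 0\<close>, then \<open>e\<close> factors through \<open>ker g\<close>. The
  monomorphism \<open>m (ker g)\<close> is the kernel of some \<open>h\<close>; this
  \<open>h\<close> kills \<open>f\<close>, hence factors through \<open>coker f\<close> and kills
  \<open>m\<close>. So \<open>m\<close> factors through \<open>m (ker g)\<close>, which gives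
  \<open>ker g\<close> a right inverse and forces \<open>g = 0\<close>.\<close>

lemma image_factorization:
  assumes [simp]: "f \<in> Arr C"
  obtains e where "epimorphism C e" "Dom C e = Dom C f" "Cod C e = Dom C (ker C (coker C f))"
    "ker C (coker C f) \<bullet> e = f"
proof -
  define m where "m = ker C (coker C f)"
  have m [simp]: "m \<in> Arr C" "Cod C m = Cod C f" "monomorphism C m"
    by (simp_all add: m_def)
  obtain e where e [simp]: "e \<in> Arr C" "Dom C e = Dom C f" "Cod C e = Dom C m" and me: "m \<bullet> e = f"
    using kernel_lift[OF ker_is_kernel[of "coker C f"], of f] by (auto simp: m_def)
  have "epimorphism C e"
  proof (rule epiI)
    fix g
    assume g [simp]: "g \<in> Arr C" "Dom C g = Cod C e" and ge: "g \<bullet> e = Zero C (Dom C e) (Cod C g)"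
    obtain e' where e' [simp]: "e' \<in> Arr C" "Dom C e' = Dom C f" "Cod C e' = Dom C (ker C g)"
      and ee': "ker C g \<bullet> e' = e"
      using kernel_lift[OF ker_is_kernel[of g], of e] ge by auto
    have "monomorphism C (m \<bullet> ker C g)"
    proof (rule monoI)
      fix x
      assume x [simp]: "x \<in> Arr C" "Cod C x = Dom C (m \<bullet> ker C g)"
        and "(m \<bullet> ker C g) \<bullet> x = Zero C (Dom C x) (Cod C (m \<bullet> ker C g))"
      then have "ker C g \<bullet> x = Zero C (Dom C x) (Dom C m)"
        using mono_zeroD[of m "ker C g \<bullet> x"] by simp
      then show "x = Zero C (Dom C x) (Dom C (m \<bullet> ker C g))"
        using mono_zeroD[of "ker C g" x] by simp
    qed simp
    then obtain h where h: "is_kernel C h (m \<bullet> ker C g)" using mono_is_kernel by blast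
    note hD = is_kernelD[OF h]
    have h1 [simp]: "h \<in> Arr C" "Dom C h = Cod C f" using hD by auto
    have "h \<bullet> m \<bullet> ker C g = Zero C (Dom C (ker C g)) (Cod C h)" using hD by simp
    moreover have "m \<bullet> ker C g \<bullet> e' = f" using me ee' by simp
    ultimately have "h \<bullet> f = Zero C (Dom C f) (Cod C h)"
      using comp_eq_left[of h "m \<bullet> ker C g" _ e'] by simp
    then obtain h' where h' [simp]: "h' \<in> Arr C" "Dom C h' = Cod C (coker C f)"
      and hh': "h' \<bullet> coker C f = h" using cokernel_desc[OF coker_is_cokernel, of f h] by auto
    have "h \<bullet> m = h' \<bullet> coker C f \<bullet> m" using hh' by (metis assoc coker_arr(1,2) h' m(1,2) assms)
    also have "\<dots> = Zero C (Dom C m) (Cod C h)" using hh' by (auto simp: m_def)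
    finally obtain t where t [simp]: "t \<in> Arr C" "Dom C t = Dom C m" "Cod C t = Dom C (ker C g)"
      and mt: "(m \<bullet> ker C g) \<bullet> t = m"
      using kernel_lift[OF h, of m] by auto
    have "ker C g \<bullet> t = Ident C (Dom C m)"
      by (rule monoD[OF m(3)]) (use mt in simp_all)
    then have "g = g \<bullet> ker C g \<bullet> t" by simp
    also have "\<dots> = Zero C (Dom C g) (Cod C g)"
      using comp_eq_left[OF ker_arr(3)[of g], of t] by simp
    finally show "g = Zero C (Cod C e) (Cod C g)" by simp
  qed simp
  then show ?thesis using that me by (simp add: m_def)
qed

text \<open>A monomorphism is the kernel of some \<open>h\<close>, and \<open>h f = 0\<close> with
  \<open>f\<close> epimorphic forces \<open>h = 0\<close>. The identity of the codomain then lifts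
  through \<open>f\<close>.\<close>

lemma mono_epi_isomorphism:
  assumes "monomorphism C f" "epimorphism C f"
  shows "isomorphism C f"
proof -
  have [simp]: "f \<in> Arr C" using assms mono_arr by blast
  obtain h where h: "is_kernel C h f" using mono_is_kernel[OF assms(1)] by blast
  note hD = is_kernelD[OF h]
  have "h = Zero C (Cod C f) (Cod C h)"
    by (rule epi_zeroD[OF assms(2)]) (use hD in simp_all)
  then have "h \<bullet> Ident C (Cod C f) = Zero C (Cod C f) (Cod C h)"
    using hD by simp
  then obtain t where t [simp]: "t \<in> Arr C" "Dom C t = Cod C f" "Cod C t = Dom C f"
    and ft: "f \<bullet> t = Ident C (Cod C f)"
    using kernel_lift[OF h, of "Ident C (Cod C f)"] hD by auto
  have "t \<bullet> f = Ident C (Dom C f)"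
    by (rule monoD[OF assms(1)]) (use comp_eq_left[OF ft, of f] in simp_all)
  then show ?thesis using ft by (intro isomorphismI[of f t]) simp_all
qed

text \<open>The epimorphism is a cokernel of some \<open>k\<close>, and \<open>k\<close> factors
  through \<open>ker C f\<close>. An arrow that kills \<open>ker C f\<close> therefore kills
  \<open>k\<close> and descends.\<close>

lemma epi_cokernel_of_ker:
  assumes "epimorphism C f" "g \<in> Arr C" "Dom C g = Dom C f"
    "g \<bullet> ker C f = Zero C (Dom C (ker C f)) (Cod C g)"
  obtains h where "h \<in> Arr C" "Dom C h = Cod C f" "Cod C h = Cod C g" "h \<bullet> f = g"
proof -
  have [simp]: "f \<in> Arr C" using assms epi_arr by blast
  obtain k where k: "is_cokernel C k f" using epi_is_cokernel[OF assms(1)] by blast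
  note kD = is_cokernelD[OF k]
  obtain l where l: "l \<in> Arr C" "Dom C l = Dom C k" "Cod C l = Dom C (ker C f)" "ker C f \<bullet> l = k"
    using kernel_lift[OF ker_is_kernel[of f], of k] kD by auto
  have "g \<bullet> k = Zero C (Dom C k) (Cod C g)"
    using comp_eq_left[OF assms(4), of l] l assms by simp
  then show ?thesis using cokernel_desc[OF k, of g] that assms kD by metis
qed

section \<open>Pullbacks of epimorphisms, local lifting and exactness\<close>

lemma biprod_is_biproduct: "X \<in> Obj C \<Longrightarrow> Y \<in> Obj C \<Longrightarrow> is_biproduct C X Y (biprod C X Y)"
  unfolding biprod_def by (rule someI_ex) (rule ex_biproduct)

text \<open>Stability of epimorphisms under pullback, in the form used for diagram chases with generalized
  elements: an arrow into the target of an epimorphism lifts after passing to a cover.\<close>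

lemma epi_local_lift:
  assumes "epimorphism C g" "h \<in> Arr C" "Cod C h = Cod C g"
  obtains e b where "epimorphism C e" "Cod C e = Dom C h" "b \<in> Arr C" "Dom C b = Dom C e"
    "Cod C b = Dom C g" "g \<bullet> b = h \<bullet> e"
proof -
  have [simp]: "g \<in> Arr C" using assms epi_arr by blast
  note [simp] = assms(2,3)
  obtain P i1 i2 p1 p2 where "is_biproduct C (Dom C g) (Dom C h) (P, i1, i2, p1, p2)"
    using ex_biproduct[of "Dom C g" "Dom C h"] by auto
  then have [simp]: "P \<in> Obj C" "i1 \<in> Arr C" "i2 \<in> Arr C" "p1 \<in> Arr C" "p2 \<in> Arr C"
    "Dom C i1 = Dom C g" "Cod C i1 = P" "Dom C i2 = Dom C h" "Cod C i2 = P"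
    "Dom C p1 = P" "Cod C p1 = Dom C g" "Dom C p2 = P" "Cod C p2 = Dom C h"
    and p: "p1 \<bullet> i1 = Ident C (Dom C g)" "p2 \<bullet> i2 = Ident C (Dom C h)"
    "p2 \<bullet> i1 = Zero C (Dom C g) (Dom C h)"
    by (auto simp: is_biproduct_def in_Hom)
  \<comment> \<open>The kernel of \<phi> is the pullback of \<open>g\<close> and \<open>h\<close>,
    realized inside the biproduct. Its two projections become the lift \<open>b\<close> and the
    cover \<open>e\<close>.\<close>
  define \<phi> where "\<phi> = g \<bullet> p1 \<boxplus> Neg C (h \<bullet> p2)"
  have \<phi> [simp]: "\<phi> \<in> Arr C" "Dom C \<phi> = P" "Cod C \<phi> = Cod C g" by (simp_all add: \<phi>_def)
  have \<phi>i: "\<phi> \<bullet> i1 = g" by (simp add: \<phi>_def p)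
  have "epimorphism C \<phi>" by (rule epi_cancel[of \<phi> i1]) (use assms(1) in \<open>simp_all add: \<phi>i\<close>)
  define k where "k = ker C \<phi>"
  have k [simp]: "k \<in> Arr C" "Cod C k = P" by (simp_all add: k_def)
  have \<phi>k: "\<phi> \<bullet> k = Zero C (Dom C k) (Cod C g)" by (simp add: k_def)
  have "g \<bullet> p1 \<bullet> k = h \<bullet> p2 \<bullet> k"
    by (rule diff_zero_imp_eq) (use \<phi>k in \<open>simp_all add: \<phi>_def\<close>)
  \<comment> \<open>If \<open>t p2\<close> kills the pullback, it factors as
    \<open>s \<phi>\<close>. On the first summand this reads \<open>s g = 0\<close>, so
    \<open>s = 0\<close>; the second summand then gives \<open>t = 0\<close>.\<close>
  moreover have "epimorphism C (p2 \<bullet> k)"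
  proof (rule epiI)
    fix t
    assume t [simp]: "t \<in> Arr C" "Dom C t = Cod C (p2 \<bullet> k)"
      and "t \<bullet> p2 \<bullet> k = Zero C (Dom C (p2 \<bullet> k)) (Cod C t)"
    then have "(t \<bullet> p2) \<bullet> ker C \<phi> = Zero C (Dom C (ker C \<phi>)) (Cod C (t \<bullet> p2))"
      unfolding k_def by simp
    then obtain s where s [simp]: "s \<in> Arr C" "Dom C s = Cod C g" "Cod C s = Cod C t"
      and st: "s \<bullet> \<phi> = t \<bullet> p2"
      using epi_cokernel_of_ker[OF \<open>epimorphism C \<phi>\<close>, of "t \<bullet> p2"] by auto
    have "s \<bullet> g = (s \<bullet> \<phi>) \<bullet> i1" using \<phi>i by simp
    also have "\<dots> = Zero C (Dom C g) (Cod C t)" unfolding st by (simp add: p)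
    finally have "s = Zero C (Cod C g) (Cod C t)" using epi_zeroD[OF assms(1), of s] by simp
    then have "(t \<bullet> p2) \<bullet> i2 = Zero C (Dom C h) (Cod C t)" using st[symmetric] by simp
    then show "t = Zero C (Cod C (p2 \<bullet> k)) (Cod C t)" by (simp add: p)
  qed simp
  ultimately show ?thesis using that[of "p2 \<bullet> k" "p1 \<bullet> k"] by simp
qed

text \<open>It is enough that an element \<open>y\<close> killed by \<open>g\<close> comes from
  \<open>f\<close> over a cover: \<open>coker C f\<close> kills \<open>y\<close> there, hence
  already before the cover since epimorphisms cancel, and so \<open>y\<close> factors through the
  image.\<close>

lemma exact_pairI:
  assumes "f \<in> Arr C" "g \<in> Arr C" "Cod C f = Dom C g" "g \<bullet> f = Zero C (Dom C f) (Cod C g)"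
    and loc: "\<And>y. y \<in> Arr C \<Longrightarrow> Cod C y = Dom C g \<Longrightarrow> g \<bullet> y = Zero C (Dom C y) (Cod C g) \<Longrightarrow>
      \<exists>e x. epimorphism C e \<and> Cod C e = Dom C y \<and> x \<in> Hom C (Dom C e) (Dom C f) \<and> f \<bullet> x = y \<bullet> e"
  shows "exact_pair C f g"
proof -
  note [simp] = assms(1-3)
  obtain g' where g' [simp]: "g' \<in> Arr C" "Dom C g' = Cod C (coker C f)" "Cod C g' = Cod C g"
    and gg': "g' \<bullet> coker C f = g"
    using cokernel_desc[OF coker_is_cokernel, of f g] assms by auto
  have "g \<bullet> ker C (coker C f) = (g' \<bullet> coker C f) \<bullet> ker C (coker C f)" using gg' by simp
  also have "\<dots> = Zero C (Dom C (ker C (coker C f))) (Cod C g)" by simp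
  finally have z: "g \<bullet> ker C (coker C f) = Zero C (Dom C (ker C (coker C f))) (Cod C g)" .
  have "is_kernel C g (ker C (coker C f))"
  proof (rule is_kernelI)
    fix y
    assume y [simp]: "y \<in> Arr C" "Cod C y = Dom C g" and "g \<bullet> y = Zero C (Dom C y) (Cod C g)"
    then obtain e x where e: "epimorphism C e" and [simp]: "Cod C e = Dom C y" "x \<in> Arr C"
      "Dom C x = Dom C e" "Cod C x = Dom C f" and fx: "f \<bullet> x = y \<bullet> e"
      using loc[of y] by (auto simp: in_Hom)
    have [simp]: "e \<in> Arr C" using e epi_arr by blast
    have "(coker C f \<bullet> y) \<bullet> e = coker C f \<bullet> f \<bullet> x" using fx by simp
    also have "\<dots> = Zero C (Dom C e) (Cod C (coker C f))"
      using comp_eq_left[OF coker_arr(3)[of f], of x] by simp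
    finally have "coker C f \<bullet> y = Zero C (Dom C y) (Cod C (coker C f))"
      using epi_zeroD[OF e, of "coker C f \<bullet> y"] by simp
    then obtain h where "h \<in> Arr C" "Dom C h = Dom C y" "Cod C h = Dom C (ker C (coker C f))"
      "ker C (coker C f) \<bullet> h = y"
      using kernel_lift[OF ker_is_kernel[of "coker C f"], of y] by auto
    then show "\<exists>h \<in> Hom C (Dom C y) (Dom C (ker C (coker C f))). ker C (coker C f) \<bullet> h = y"
      by (auto simp: in_Hom)
  qed (use z in simp_all)
  then show ?thesis by (simp add: exact_pair_def)
qed

lemma exact_pairD:
  assumes "exact_pair C f g"
  shows "f \<in> Arr C" "g \<in> Arr C" "Cod C f = Dom C g" "g \<bullet> f = Zero C (Dom C f) (Cod C g)"
proof -
  show f [simp]: "f \<in> Arr C" "g \<in> Arr C" "Cod C f = Dom C g"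
    using assms by (auto simp: exact_pair_def)
  obtain e where "epimorphism C e" and [simp]: "Dom C e = Dom C f"
    "Cod C e = Dom C (ker C (coker C f))" and e: "ker C (coker C f) \<bullet> e = f"
    using image_factorization[OF f(1)] .
  then have [simp]: "e \<in> Arr C" using epi_arr by blast
  have "is_kernel C g (ker C (coker C f))" using assms by (simp add: exact_pair_def)
  then have "g \<bullet> ker C (coker C f) = Zero C (Dom C (ker C (coker C f))) (Cod C g)"
    by (rule is_kernelD)
  from comp_eq_left[OF this, of e] show "g \<bullet> f = Zero C (Dom C f) (Cod C g)"
    using e by simp
qed

text \<open>Being killed by the cokernel means factoring through the image
  \<open>ker C (coker C f)\<close>; that factorization lifts locally along the epimorphic part of
  \<open>f\<close>.\<close>

lemma ker_coker_local_lift: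
  assumes "f \<in> Arr C" "y \<in> Arr C" "Cod C y = Cod C f"
    "coker C f \<bullet> y = Zero C (Dom C y) (Cod C (coker C f))"
  obtains e x where "epimorphism C e" "Cod C e = Dom C y" "x \<in> Arr C" "Dom C x = Dom C e"
    "Cod C x = Dom C f" "f \<bullet> x = y \<bullet> e"
proof -
  note [simp] = assms(1-3)
  obtain q where q: "epimorphism C q" and [simp]: "Dom C q = Dom C f"
    "Cod C q = Dom C (ker C (coker C f))" and qf: "ker C (coker C f) \<bullet> q = f"
    using image_factorization[OF assms(1)] .
  then have [simp]: "q \<in> Arr C" using epi_arr by blast
  obtain h where h [simp]: "h \<in> Arr C" "Dom C h = Dom C y" "Cod C h = Dom C (ker C (coker C f))"
    and hy: "ker C (coker C f) \<bullet> h = y"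
    using kernel_lift[OF ker_is_kernel[of "coker C f"], of y] assms(4) by auto
  obtain e x where e: "epimorphism C e" and [simp]: "Cod C e = Dom C h" "x \<in> Arr C"
    "Dom C x = Dom C e" "Cod C x = Dom C q" and qx: "q \<bullet> x = h \<bullet> e"
    by (rule epi_local_lift[OF q, of h]) auto
  have [simp]: "e \<in> Arr C" using e epi_arr by blast
  have "f \<bullet> x = ker C (coker C f) \<bullet> q \<bullet> x" using comp_eq_left[OF qf, of x] by simp
  also have "\<dots> = y \<bullet> e" unfolding qx using comp_eq_left[OF hy, of e] by simp
  finally show ?thesis using that[of e x] e by simp
qed

lemma exact_local_lift:
  assumes "exact_pair C f g" "y \<in> Arr C" "Cod C y = Dom C g"
    "g \<bullet> y = Zero C (Dom C y) (Cod C g)"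
  obtains e x where "epimorphism C e" "Cod C e = Dom C y" "x \<in> Arr C" "Dom C x = Dom C e"
    "Cod C x = Dom C f" "f \<bullet> x = y \<bullet> e"
proof -
  note [simp] = exact_pairD[OF assms(1)] assms(2,3)
  have "is_kernel C g (ker C (coker C f))" using assms by (simp add: exact_pair_def)
  then obtain h where h [simp]: "h \<in> Arr C" "Dom C h = Dom C y" "Cod C h = Dom C (ker C (coker C f))"
    and hy: "ker C (coker C f) \<bullet> h = y"
    using kernel_lift[of g _ y] assms by (metis)
  have "coker C f \<bullet> y = Zero C (Dom C y) (Cod C (coker C f))"
    using comp_eq_left[OF ker_arr(3)[of "coker C f"], of h] hy by simp
  then show ?thesis using that ker_coker_local_lift[of f y] by auto
qed

end

section \<open>Cohomology through generalized elements\<close>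

context abelian_category
begin

lemma complex_arr [simp]:
  assumes "bounded_complex C X"
  shows "cobj X i \<in> Obj C" "cdiff X i \<in> Arr C" "Dom C (cdiff X i) = cobj X i"
    "Cod C (cdiff X i) = cobj X (i + 1)"
  using assms by (auto simp: bounded_complex_def in_Hom)

text \<open>Rewriting does not match \<open>i\<close> with \<open>i - 1 + 1\<close>, so the law is
  recorded once with \<open>i\<close> at the first and once with \<open>i\<close> at the second
  differential.\<close>

lemma diff_diff [simp]:
  assumes "bounded_complex C X"
  shows "cdiff X (i + 1) \<bullet> cdiff X i = Zero C (cobj X i) (cobj X (i + 2))"
    "cdiff X i \<bullet> cdiff X (i - 1) = Zero C (cobj X (i - 1)) (cobj X (i + 1))"
proof -
  have *: "cdiff X (i + 1) \<bullet> cdiff X i = Zero C (cobj X i) (cobj X (i + 2))" for i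
    using assms by (auto simp: bounded_complex_def)
  show "cdiff X (i + 1) \<bullet> cdiff X i = Zero C (cobj X i) (cobj X (i + 2))" by (rule *)
  show "cdiff X i \<bullet> cdiff X (i - 1) = Zero C (cobj X (i - 1)) (cobj X (i + 1))"
    using *[of "i - 1"] by (simp add: add.commute)
qed

lemma diff_diff_comp [simp]:
  assumes "bounded_complex C X" "w \<in> Arr C"
  shows "Cod C w = cobj X i \<Longrightarrow> cdiff X (i + 1) \<bullet> cdiff X i \<bullet> w = Zero C (Dom C w) (cobj X (i + 2))"
    "Cod C w = cobj X (i - 1) \<Longrightarrow>
      cdiff X i \<bullet> cdiff X (i - 1) \<bullet> w = Zero C (Dom C w) (cobj X (i + 1))"
  using assms comp_eq_left[OF diff_diff(1)[of X i], of w] comp_eq_left[OF diff_diff(2)[of X i], of w]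
  by simp_all

definition cycle :: "('o, 'm) cpx \<Rightarrow> int \<Rightarrow> 'm \<Rightarrow> bool" where
  "cycle X i x \<longleftrightarrow> x \<in> Arr C \<and> Cod C x = cobj X i \<and>
     cdiff X i \<bullet> x = Zero C (Dom C x) (cobj X (i + 1))"

text \<open>Only after passing to an epimorphic cover is a cycle with vanishing cohomology class the
  image of an element under the differential.\<close>

definition boundary :: "('o, 'm) cpx \<Rightarrow> int \<Rightarrow> 'm \<Rightarrow> bool" where
  "boundary X i x \<longleftrightarrow> (\<exists>e w. epimorphism C e \<and> Cod C e = Dom C x \<and>
     w \<in> Hom C (Dom C e) (cobj X (i - 1)) \<and> cdiff X (i - 1) \<bullet> w = x \<bullet> e)"

text \<open>The class of a generalized cycle as an arrow into cohomology: lift through the kernel,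
  then project. The lift is unique because a kernel is a monomorphism; if \<open>x\<close> is not a
  cycle, the value is unspecified.\<close>

definition cls :: "('o, 'm) cpx \<Rightarrow> int \<Rightarrow> 'm \<Rightarrow> 'm" where
  "cls X i x = cohom_proj C i X \<bullet>
     (THE x'. x' \<in> Hom C (Dom C x) (Dom C (cycles C i X)) \<and> cycles C i X \<bullet> x' = x)"

lemma cycleD:
  assumes "cycle X i x"
  shows "x \<in> Arr C" "Cod C x = cobj X i" "cdiff X i \<bullet> x = Zero C (Dom C x) (cobj X (i + 1))"
  using assms by (auto simp: cycle_def)

lemma boundaryI:
  assumes "w \<in> Arr C" "Cod C w = cobj X (i - 1)" "Dom C w = Dom C x" "x \<in> Arr C"
    "cdiff X (i - 1) \<bullet> w = x"
  shows "boundary X i x"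
  unfolding boundary_def
  by (rule exI[of _ "Ident C (Dom C x)"], rule exI[of _ w]) (use assms in \<open>simp add: in_Hom\<close>)

lemma boundary_obtain:
  assumes "boundary X i x"
  obtains e w where "epimorphism C e" "e \<in> Arr C" "Cod C e = Dom C x" "w \<in> Arr C"
    "Dom C w = Dom C e" "Cod C w = cobj X (i - 1)" "cdiff X (i - 1) \<bullet> w = x \<bullet> e"
  using assms epi_arr unfolding boundary_def by (auto simp: in_Hom)

text \<open>Covers compose, so passing to a further cover does no harm.\<close>

lemma boundary_local:
  assumes "boundary X i (x \<bullet> e)" "epimorphism C e" "x \<in> Arr C" "Cod C e = Dom C x"
  shows "boundary X i x"
proof -
  have [simp]: "e \<in> Arr C" using assms epi_arr by blast
  note [simp] = assms(3,4)
  obtain f w where f: "epimorphism C f" and [simp]: "f \<in> Arr C" "Cod C f = Dom C (x \<bullet> e)"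
    "w \<in> Arr C" "Dom C w = Dom C f" "Cod C w = cobj X (i - 1)"
    and d: "cdiff X (i - 1) \<bullet> w = (x \<bullet> e) \<bullet> f"
    using boundary_obtain[OF assms(1)] .
  have "epimorphism C (e \<bullet> f)" by (rule epi_comp[OF f assms(2)]) simp
  then show ?thesis unfolding boundary_def
    by (intro exI[of _ "e \<bullet> f"] exI[of _ w]) (use d in \<open>simp add: in_Hom\<close>)
qed

section \<open>Cohomology classes of generalized cycles\<close>

context
  fixes X :: "('o, 'm) cpx"
  assumes X [simp]: "bounded_complex C X"
begin

lemma cycles_arr [simp]:
  "cycles C i X \<in> Arr C" "Cod C (cycles C i X) = cobj X i" "monomorphism C (cycles C i X)"
  by (simp_all add: cycles_def)

lemma cycles_kernel: "is_kernel C (cdiff X i) (cycles C i X)"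
  unfolding cycles_def by (rule ker_is_kernel) simp

lemma cycle_cycles: "cycle X i (cycles C i X)"
  by (simp add: cycle_def) (simp add: cycles_def)

lemma to_cycles_arr [simp]:
  "to_cycles C i X \<in> Arr C" "Dom C (to_cycles C i X) = cobj X (i - 1)"
  "Cod C (to_cycles C i X) = Dom C (cycles C i X)"
  "cycles C i X \<bullet> to_cycles C i X = cdiff X (i - 1)"
proof -
  have "\<exists>!b. b \<in> Hom C (cobj X (i - 1)) (Dom C (cycles C i X)) \<and>
     cycles C i X \<bullet> b = cdiff X (i - 1)"
    by (rule is_kernel_univ[OF cycles_kernel]) (simp_all add: in_Hom)
  from theI'[OF this] show "to_cycles C i X \<in> Arr C" "Dom C (to_cycles C i X) = cobj X (i - 1)"
    "Cod C (to_cycles C i X) = Dom C (cycles C i X)"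
    "cycles C i X \<bullet> to_cycles C i X = cdiff X (i - 1)"
    unfolding to_cycles_def by (auto simp: in_Hom)
qed

lemma cohom_proj_arr [simp]:
  "cohom_proj C i X \<in> Arr C" "Dom C (cohom_proj C i X) = Dom C (cycles C i X)"
  "Cod C (cohom_proj C i X) = cohom C i X" "epimorphism C (cohom_proj C i X)"
  "cohom_proj C i X \<bullet> to_cycles C i X = Zero C (cobj X (i - 1)) (cohom C i X)"
  by (simp_all add: cohom_proj_def cohom_def)

lemma cohom_obj [simp]: "cohom C i X \<in> Obj C"
  using cod_obj[OF cohom_proj_arr(1)[of i]] by simp

lemma cls_eq:
  assumes "x' \<in> Arr C" "Dom C x' = Dom C x" "Cod C x' = Dom C (cycles C i X)" "cycles C i X \<bullet> x' = x"
  shows "cls X i x = cohom_proj C i X \<bullet> x'"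
proof -
  have "(THE x'. x' \<in> Hom C (Dom C x) (Dom C (cycles C i X)) \<and> cycles C i X \<bullet> x' = x) = x'"
  proof (rule the_equality)
    fix y assume y: "y \<in> Hom C (Dom C x) (Dom C (cycles C i X)) \<and> cycles C i X \<bullet> y = x"
    show "y = x'" by (rule monoD[OF cycles_arr(3)]) (use y assms in \<open>auto simp: in_Hom\<close>)
  qed (use assms in \<open>auto simp: in_Hom\<close>)
  then show ?thesis by (simp add: cls_def)
qed

lemma cycle_lift:
  assumes "cycle X i x"
  obtains x' where "x' \<in> Arr C" "Dom C x' = Dom C x" "Cod C x' = Dom C (cycles C i X)"
    "cycles C i X \<bullet> x' = x" "cls X i x = cohom_proj C i X \<bullet> x'"
  using kernel_lift[OF cycles_kernel, of x] cycleD[OF assms] cls_eq by (metis complex_arr(3,4) X)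

lemma cls_arr [simp]:
  assumes "cycle X i x"
  shows "cls X i x \<in> Arr C" "Dom C (cls X i x) = Dom C x" "Cod C (cls X i x) = cohom C i X"
  using cycle_lift[OF assms] by (metis cohom_proj_arr comp_arr)+

lemma cycle_comp:
  assumes "cycle X i x" "e \<in> Arr C" "Cod C e = Dom C x"
  shows "cycle X i (x \<bullet> e)"
  using cycleD[OF assms(1)] assms(2,3) comp_eq_left[OF cycleD(3)[OF assms(1)], of e]
  by (simp add: cycle_def)

lemma cls_comp:
  assumes "cycle X i x" "e \<in> Arr C" "Cod C e = Dom C x"
  shows "cls X i (x \<bullet> e) = cls X i x \<bullet> e"
proof -
  note [simp] = cycleD[OF assms(1)] assms(2,3)
  obtain x' where x' [simp]: "x' \<in> Arr C" "Dom C x' = Dom C x" "Cod C x' = Dom C (cycles C i X)"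
    and x: "cycles C i X \<bullet> x' = x" "cls X i x = cohom_proj C i X \<bullet> x'"
    using cycle_lift[OF assms(1)] .
  have "cls X i (x \<bullet> e) = cohom_proj C i X \<bullet> (x' \<bullet> e)"
    using comp_eq_left[OF x(1), of e] by (intro cls_eq) simp_all
  then show ?thesis by (simp add: x)
qed

lemma cycle_add:
  assumes "cycle X i x" "cycle X i y" "Dom C x = Dom C y"
  shows "cycle X i (x \<boxplus> y)"
  using cycleD[OF assms(1)] cycleD[OF assms(2)] assms(3) by (simp add: cycle_def)

lemma cycle_neg:
  assumes "cycle X i x"
  shows "cycle X i (Neg C x)"
  using cycleD[OF assms] by (simp add: cycle_def)

lemma cls_add:
  assumes "cycle X i x" "cycle X i y" "Dom C x = Dom C y"
  shows "cls X i (x \<boxplus> y) = cls X i x \<boxplus> cls X i y"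
proof -
  note [simp] = cycleD[OF assms(1)] cycleD[OF assms(2)] assms(3)
  obtain x' where x' [simp]: "x' \<in> Arr C" "Dom C x' = Dom C x" "Cod C x' = Dom C (cycles C i X)"
    and x: "cycles C i X \<bullet> x' = x" "cls X i x = cohom_proj C i X \<bullet> x'"
    using cycle_lift[OF assms(1)] .
  obtain y' where y' [simp]: "y' \<in> Arr C" "Dom C y' = Dom C y" "Cod C y' = Dom C (cycles C i X)"
    and y: "cycles C i X \<bullet> y' = y" "cls X i y = cohom_proj C i X \<bullet> y'"
    using cycle_lift[OF assms(2)] .
  have "cls X i (x \<boxplus> y) = cohom_proj C i X \<bullet> (x' \<boxplus> y')"
    by (intro cls_eq) (simp_all add: x y)
  then show ?thesis by (simp add: x y)
qed

lemma cls_neg: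
  assumes "cycle X i x"
  shows "cls X i (Neg C x) = Neg C (cls X i x)"
proof -
  note [simp] = cycleD[OF assms(1)]
  obtain x' where x' [simp]: "x' \<in> Arr C" "Dom C x' = Dom C x" "Cod C x' = Dom C (cycles C i X)"
    and x: "cycles C i X \<bullet> x' = x" "cls X i x = cohom_proj C i X \<bullet> x'"
    using cycle_lift[OF assms(1)] .
  have "cls X i (Neg C x) = cohom_proj C i X \<bullet> Neg C x'"
    by (intro cls_eq) (simp_all add: x)
  then show ?thesis by (simp add: x)
qed

text \<open>A vanishing class means that the lift of \<open>x\<close> to the cycles is killed by the
  cokernel of \<open>to_cycles\<close>, hence comes from degree \<open>i - 1\<close> over a cover.
  Conversely the class of a boundary vanishes after the cover, and the epimorphism can be
  cancelled.\<close>

lemma cls_zero_iff: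
  assumes "cycle X i x"
  shows "cls X i x = Zero C (Dom C x) (cohom C i X) \<longleftrightarrow> boundary X i x" (is "?l \<longleftrightarrow> ?r")
proof -
  note [simp] = cycleD[OF assms(1)]
  obtain x' where x' [simp]: "x' \<in> Arr C" "Dom C x' = Dom C x" "Cod C x' = Dom C (cycles C i X)"
    and x: "cycles C i X \<bullet> x' = x" "cls X i x = cohom_proj C i X \<bullet> x'"
    using cycle_lift[OF assms(1)] .
  show ?thesis
  proof
    assume ?l
    then have "coker C (to_cycles C i X) \<bullet> x' =
      Zero C (Dom C x') (Cod C (coker C (to_cycles C i X)))"
      using x by (simp flip: cohom_proj_def)
    then obtain e w where ew: "epimorphism C e" "Cod C e = Dom C x'" "w \<in> Arr C" "Dom C w = Dom C e"
      "Cod C w = Dom C (to_cycles C i X)" "to_cycles C i X \<bullet> w = x' \<bullet> e"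
      by (rule ker_coker_local_lift[rotated 3]) simp_all
    have [simp]: "e \<in> Arr C" using ew epi_arr by blast
    have "cdiff X (i - 1) \<bullet> w = cycles C i X \<bullet> to_cycles C i X \<bullet> w"
      using ew comp_eq_left[OF to_cycles_arr(4)[of i], of w] by simp
    also have "\<dots> = x \<bullet> e" using ew comp_eq_left[OF x(1), of e] by simp
    finally show ?r using ew unfolding boundary_def by (auto simp: in_Hom)
  next
    assume ?r
    then obtain e w where e: "epimorphism C e" and [simp]: "e \<in> Arr C" "Cod C e = Dom C x" "w \<in> Arr C"
      "Dom C w = Dom C e" "Cod C w = cobj X (i - 1)" and d: "cdiff X (i - 1) \<bullet> w = x \<bullet> e"
      by (rule boundary_obtain)
    have "cls X i x \<bullet> e = cls X i (x \<bullet> e)" using cls_comp[OF assms, of e] by simp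
    also have "\<dots> = cohom_proj C i X \<bullet> to_cycles C i X \<bullet> w"
      by (rule cls_eq) (simp_all add: d comp_eq_left[OF to_cycles_arr(4)[of i], of w])
    also have "\<dots> = Zero C (Dom C e) (cohom C i X)"
      using comp_eq_left[OF cohom_proj_arr(5)[of i], of w] by simp
    finally show ?l using epi_zeroD[OF e, of "cls X i x"] assms by simp
  qed
qed

lemma cls_eq_iff:
  assumes "cycle X i x" "cycle X i y" "Dom C x = Dom C y"
  shows "cls X i x = cls X i y \<longleftrightarrow> boundary X i (x \<boxplus> Neg C y)" (is "?l \<longleftrightarrow> ?r")
proof -
  note [simp] = cycleD(1,2)[OF assms(1)] cycleD(1,2)[OF assms(2)] assms
  have c: "cycle X i (x \<boxplus> Neg C y)" by (intro cycle_add cycle_neg) simp_all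
  have e: "cls X i (x \<boxplus> Neg C y) = cls X i x \<boxplus> Neg C (cls X i y)"
    by (subst cls_add) (simp_all add: cls_neg cycle_neg)
  have "?r \<longleftrightarrow> cls X i x \<boxplus> Neg C (cls X i y) = Zero C (Dom C y) (cohom C i X)"
    using cls_zero_iff[OF c] e by simp
  also have "\<dots> \<longleftrightarrow> ?l" using diff_zero_imp_eq[of "cls X i x" "cls X i y"] by auto
  finally show ?thesis by simp
qed

text \<open>The projection from cycles to cohomology is an epimorphism, so an arbitrary element of
  cohomology is represented by a cycle over a cover. Statements about cohomology objects can thus be
  checked on cycles.\<close>

lemma cls_surj:
  assumes "h \<in> Arr C" "Cod C h = cohom C i X"
  obtains e x where "epimorphism C e" "e \<in> Arr C" "Cod C e = Dom C h" "cycle X i x"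
    "Dom C x = Dom C e" "cls X i x = h \<bullet> e"
proof -
  obtain e b where e: "epimorphism C e" "Cod C e = Dom C h" and b [simp]: "b \<in> Arr C" "Dom C b = Dom C e"
    "Cod C b = Dom C (cohom_proj C i X)" and hb: "cohom_proj C i X \<bullet> b = h \<bullet> e"
    by (rule epi_local_lift[of "cohom_proj C i X" h]) (use assms in simp_all)
  have "cycle X i (cycles C i X \<bullet> b)" by (rule cycle_comp[OF cycle_cycles]) simp_all
  moreover have "cls X i (cycles C i X \<bullet> b) = cohom_proj C i X \<bullet> b" by (rule cls_eq) simp_all
  ultimately show ?thesis using that[of e "cycles C i X \<bullet> b"] e hb epi_arr by simp
qed

lemma cls_cycles: "cls X i (cycles C i X) = cohom_proj C i X"
  using cls_eq[of "Ident C (Dom C (cycles C i X))" "cycles C i X" i] by simp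

text \<open>The kernel \<open>cycles C i X\<close> is the universal cycle, and its class is the
  epimorphism \<open>cohom_proj C i X\<close>; agreement on this one class suffices.\<close>

lemma cls_ext:
  assumes "h \<in> Arr C" "h' \<in> Arr C" "Dom C h = cohom C i X" "Dom C h' = cohom C i X" "Cod C h = Cod C h'"
    and "\<And>x. cycle X i x \<Longrightarrow> h \<bullet> cls X i x = h' \<bullet> cls X i x"
  shows "h = h'"
  by (rule epiD[OF cohom_proj_arr(4)])
    (use assms assms(6)[OF cycle_cycles] in \<open>simp_all add: cls_cycles\<close>)

end

text \<open>Only one arrow and one pair of degrees are recorded. The relation therefore covers,
  besides chain maps, the connecting map, which changes the degree, the comparison with a shift,
  where differentials agree only up to sign, and the map from a cone to a quotient.\<close>

definition induces ::
  "('o, 'm) cpx \<Rightarrow> int \<Rightarrow> ('o, 'm) cpx \<Rightarrow> int \<Rightarrow> 'm \<Rightarrow> 'm \<Rightarrow> bool" where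
  "induces X i Y j \<phi> h \<longleftrightarrow> bounded_complex C X \<and> bounded_complex C Y \<and>
     \<phi> \<in> Hom C (cobj X i) (cobj Y j) \<and> h \<in> Hom C (cohom C i X) (cohom C j Y) \<and>
     (\<forall>x. cycle X i x \<longrightarrow> cycle Y j (\<phi> \<bullet> x) \<and> h \<bullet> cls X i x = cls Y j (\<phi> \<bullet> x))"

lemma inducesD:
  assumes "induces X i Y j \<phi> h"
  shows "bounded_complex C X" "bounded_complex C Y" "\<phi> \<in> Arr C" "Dom C \<phi> = cobj X i"
    "Cod C \<phi> = cobj Y j" "h \<in> Arr C" "Dom C h = cohom C i X" "Cod C h = cohom C j Y"
    "cycle X i x \<Longrightarrow> cycle Y j (\<phi> \<bullet> x)" "cycle X i x \<Longrightarrow> h \<bullet> cls X i x = cls Y j (\<phi> \<bullet> x)"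
  using assms by (auto simp: induces_def in_Hom)

text \<open>The class of the image of the universal cycle has to descend along the cokernel of
  \<open>to_cycles\<close>. For this the image of the single element \<open>cdiff X (i - 1)\<close>
  must be a boundary.\<close>

lemma induces_exists:
  assumes [simp]: "bounded_complex C X" "bounded_complex C Y"
    and [simp]: "\<phi> \<in> Arr C" "Dom C \<phi> = cobj X i" "Cod C \<phi> = cobj Y j"
    and cyc: "\<And>x. cycle X i x \<Longrightarrow> cycle Y j (\<phi> \<bullet> x)"
    and bd: "boundary Y j (\<phi> \<bullet> cdiff X (i - 1))"
  obtains h where "induces X i Y j \<phi> h"
proof -
  define u where "u = cls Y j (\<phi> \<bullet> cycles C i X)"
  have cc [simp]: "cycle Y j (\<phi> \<bullet> cycles C i X)" by (intro cyc cycle_cycles) simp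
  have [simp]: "u \<in> Arr C" "Dom C u = Dom C (cycles C i X)" "Cod C u = cohom C j Y"
    by (simp_all add: u_def)
  have "cycle X i (cdiff X (i - 1))" by (simp add: cycle_def)
  then have cd: "cycle Y j (\<phi> \<bullet> cdiff X (i - 1))" by (rule cyc)
  have "u \<bullet> to_cycles C i X = cls Y j ((\<phi> \<bullet> cycles C i X) \<bullet> to_cycles C i X)"
    unfolding u_def by (rule cls_comp[symmetric]) simp_all
  also have "\<dots> = Zero C (cobj X (i - 1)) (cohom C j Y)"
    using cls_zero_iff[OF _ cd] bd by simp
  finally obtain h where h [simp]: "h \<in> Arr C" "Dom C h = cohom C i X" "Cod C h = cohom C j Y"
    and hu: "h \<bullet> cohom_proj C i X = u"
    using cokernel_desc[OF coker_is_cokernel[of "to_cycles C i X"], of u]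
    by (auto simp flip: cohom_proj_def)
  have "h \<bullet> cls X i x = cls Y j (\<phi> \<bullet> x)" if x: "cycle X i x" for x
  proof -
    note [simp] = cycleD[OF x]
    obtain x' where x' [simp]: "x' \<in> Arr C" "Dom C x' = Dom C x" "Cod C x' = Dom C (cycles C i X)"
      and xx: "cycles C i X \<bullet> x' = x" "cls X i x = cohom_proj C i X \<bullet> x'"
      using cycle_lift[OF assms(1) x] .
    have "h \<bullet> cls X i x = u \<bullet> x'" unfolding xx(2) using comp_eq_left[OF hu, of x'] by simp
    also have "\<dots> = cls Y j ((\<phi> \<bullet> cycles C i X) \<bullet> x')"
      unfolding u_def by (rule cls_comp[symmetric]) simp_all
    also have "\<dots> = cls Y j (\<phi> \<bullet> x)" using xx by simp
    finally show ?thesis .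
  qed
  then show ?thesis using cyc by (intro that[of h]) (simp add: induces_def in_Hom)
qed

lemma induces_unique:
  assumes "induces X i Y j \<phi> h" "induces X i Y j \<phi> h'"
  shows "h = h'"
  by (rule cls_ext[of X _ _ i]) (use inducesD[OF assms(1)] inducesD[OF assms(2)] in simp_all)

lemma induces_comp:
  assumes "induces X i Y j \<phi> h" "induces Y j Z k \<psi> l"
  shows "induces X i Z k (\<psi> \<bullet> \<phi>) (l \<bullet> h)"
proof -
  note [simp] = inducesD[OF assms(1)] inducesD[OF assms(2)]
  have "cycle Z k ((\<psi> \<bullet> \<phi>) \<bullet> x) \<and> (l \<bullet> h) \<bullet> cls X i x = cls Z k ((\<psi> \<bullet> \<phi>) \<bullet> x)"
    if "cycle X i x" for x
    using that cycleD[OF that] inducesD(9)[OF assms(2) inducesD(9)[OF assms(1) that]] by simp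
  then show ?thesis by (simp add: induces_def in_Hom)
qed

lemma induces_ident:
  assumes "bounded_complex C X"
  shows "induces X i X i (Ident C (cobj X i)) (Ident C (cohom C i X))"
  using assms by (auto simp: induces_def in_Hom cycle_def)

lemma induces_mono_iff:
  assumes "induces X i Y j \<phi> h"
  shows "monomorphism C h \<longleftrightarrow> (\<forall>x. cycle X i x \<and> boundary Y j (\<phi> \<bullet> x) \<longrightarrow> boundary X i x)"
    (is "?l \<longleftrightarrow> ?r")
proof
  note [simp] = inducesD[OF assms]
  have eq: "h \<bullet> cls X i x = Zero C (Dom C x) (Cod C h) \<longleftrightarrow> boundary Y j (\<phi> \<bullet> x)" if "cycle X i x" for x
    using cls_zero_iff[of Y j "\<phi> \<bullet> x"] that cycleD[OF that] by simp
  show ?r if l: ?l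
  proof (intro allI impI, elim conjE)
    fix x assume x: "cycle X i x" "boundary Y j (\<phi> \<bullet> x)"
    then have "cls X i x = Zero C (Dom C x) (cohom C i X)"
      using mono_zeroD[OF l, of "cls X i x"] eq[OF x(1)] by simp
    then show "boundary X i x" using cls_zero_iff[of X i x] x by simp
  qed
  show ?l if r: ?r
  proof (rule monoI)
    fix t assume t [simp]: "t \<in> Arr C" "Cod C t = Dom C h" and ht: "h \<bullet> t = Zero C (Dom C t) (Cod C h)"
    obtain e x where e: "epimorphism C e" "e \<in> Arr C" "Cod C e = Dom C t" and x: "cycle X i x"
      "Dom C x = Dom C e" "cls X i x = t \<bullet> e"
      by (rule cls_surj[of X t i]) simp_all
    have "h \<bullet> cls X i x = Zero C (Dom C x) (Cod C h)"
      using comp_eq_left[OF ht, of e] e x by simp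
    then have "cls X i x = Zero C (Dom C x) (cohom C i X)"
      using eq[OF x(1)] r x(1) cls_zero_iff[of X i x] by simp
    then show "t = Zero C (Dom C t) (Dom C h)"
      using epi_zeroD[OF e(1), of t] e x by simp
  qed simp
qed

lemma induces_epi_iff:
  assumes "induces X i Y j \<phi> h"
  shows "epimorphism C h \<longleftrightarrow> (\<forall>y. cycle Y j y \<longrightarrow> (\<exists>e x. epimorphism C e \<and> Cod C e = Dom C y \<and>
    cycle X i x \<and> Dom C x = Dom C e \<and> boundary Y j ((\<phi> \<bullet> x) \<boxplus> Neg C (y \<bullet> e))))"
    (is "?l \<longleftrightarrow> ?r")
proof
  note [simp] = inducesD[OF assms]
  show ?r if l: ?l
  proof (intro allI impI)
    fix y assume y: "cycle Y j y"
    note [simp] = cycleD[OF y]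
    obtain e b where e: "epimorphism C e" "Cod C e = Dom C y" and b: "b \<in> Arr C" "Dom C b = Dom C e"
      "Cod C b = Dom C h" "h \<bullet> b = cls Y j y \<bullet> e"
      by (rule epi_local_lift[OF l, of "cls Y j y"]) (use y in simp_all)
    obtain f x where f: "epimorphism C f" "f \<in> Arr C" "Cod C f = Dom C b" and x: "cycle X i x"
      "Dom C x = Dom C f" "cls X i x = b \<bullet> f"
      by (rule cls_surj[of X b i]) (use b in simp_all)
    have [simp]: "e \<in> Arr C" using e epi_arr by blast
    have "cls Y j (\<phi> \<bullet> x) = h \<bullet> cls X i x" using inducesD(10)[OF assms x(1)] by simp
    also have "\<dots> = cls Y j (y \<bullet> e \<bullet> f)"
      using x b f e y comp_eq_left[OF b(4), of f] by (simp add: cls_comp)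
    finally have "boundary Y j ((\<phi> \<bullet> x) \<boxplus> Neg C (y \<bullet> e \<bullet> f))"
      using cls_eq_iff[of Y j "\<phi> \<bullet> x" "y \<bullet> e \<bullet> f"] x cycleD[OF x(1)] y b f e
        cycle_comp[of Y j y "e \<bullet> f"] by simp
    moreover have "epimorphism C (e \<bullet> f)" by (rule epi_comp[OF f(1) e(1)]) (use f b in simp)
    ultimately show "\<exists>e x. epimorphism C e \<and> Cod C e = Dom C y \<and>
      cycle X i x \<and> Dom C x = Dom C e \<and> boundary Y j ((\<phi> \<bullet> x) \<boxplus> Neg C (y \<bullet> e))"
      by (intro exI[of _ "e \<bullet> f"] exI[of _ x]) (use e f x b in simp)
  qed
  show ?l if r: ?r
  proof -
    \<comment> \<open>One test element suffices: a preimage of the universal cycle over a cover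
      \<open>e\<close> makes \<open>h\<close> composed with a class equal to the epimorphism
      \<open>cohom_proj C j Y \<bullet> e\<close>.\<close>
    have c: "cycle Y j (cycles C j Y)" by (rule cycle_cycles) simp
    then obtain e x where e: "epimorphism C e" "Cod C e = Dom C (cycles C j Y)" and x: "cycle X i x"
      "Dom C x = Dom C e" and b: "boundary Y j ((\<phi> \<bullet> x) \<boxplus> Neg C (cycles C j Y \<bullet> e))"
      using r by blast
    have [simp]: "e \<in> Arr C" using e epi_arr by blast
    have "cls Y j (\<phi> \<bullet> x) = cls Y j (cycles C j Y \<bullet> e)"
      using cls_eq_iff[of Y j "\<phi> \<bullet> x" "cycles C j Y \<bullet> e"] x cycleD[OF x(1)] b e c
        cycle_comp[of Y j "cycles C j Y" e] by simp
    also have "\<dots> = cohom_proj C j Y \<bullet> e" using c e by (simp add: cls_comp cls_cycles)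
    finally have "h \<bullet> cls X i x = cohom_proj C j Y \<bullet> e" using x by simp
    moreover have "epimorphism C (cohom_proj C j Y \<bullet> e)"
      by (rule epi_comp) (use e in simp_all)
    ultimately show ?l using x by (intro epi_cancel[of h "cls X i x"]) simp_all
  qed
qed

text \<open>Elements of the middle cohomology are classes of cycles over a cover, so exactness can
  be tested on cycles and boundaries. The conditions \<open>comp\<close> and \<open>loc\<close> are
  the usual element chase, with preimages allowed over covers.\<close>

lemma induces_exact:
  assumes "induces X i Y j \<phi> h" "induces Y j Z k \<psi> l"
    and comp: "\<And>x. cycle X i x \<Longrightarrow> boundary Z k (\<psi> \<bullet> \<phi> \<bullet> x)"
    and loc: "\<And>y. cycle Y j y \<Longrightarrow> boundary Z k (\<psi> \<bullet> y) \<Longrightarrow>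
      \<exists>e x. epimorphism C e \<and> Cod C e = Dom C y \<and>
        cycle X i x \<and> Dom C x = Dom C e \<and> boundary Y j ((\<phi> \<bullet> x) \<boxplus> Neg C (y \<bullet> e))"
  shows "exact_pair C h l"
proof -
  note [simp] = inducesD[OF assms(1)] inducesD[OF assms(2)]
  show ?thesis
  proof (rule exact_pairI)
    have "l \<bullet> h = Zero C (cohom C i X) (cohom C k Z)"
    proof (rule cls_ext[of X _ _ i])
      fix x assume x: "cycle X i x"
      show "(l \<bullet> h) \<bullet> cls X i x = Zero C (cohom C i X) (cohom C k Z) \<bullet> cls X i x"
        using x cls_zero_iff[of Z k "\<psi> \<bullet> \<phi> \<bullet> x"] comp[OF x] cycleD[OF x]
          inducesD(9)[OF assms(2) inducesD(9)[OF assms(1) x]] by simp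
    qed simp_all
    then show "l \<bullet> h = Zero C (Dom C h) (Cod C l)" by simp
  next
    fix t assume t [simp]: "t \<in> Arr C" "Cod C t = Dom C l" and lt: "l \<bullet> t = Zero C (Dom C t) (Cod C l)"
    obtain e y where e [simp]: "epimorphism C e" "e \<in> Arr C" "Cod C e = Dom C t" and y: "cycle Y j y"
      "Dom C y = Dom C e" "cls Y j y = t \<bullet> e"
      by (rule cls_surj[of Y t j]) simp_all
    note [simp] = cycleD[OF y(1)]
    have "l \<bullet> cls Y j y = Zero C (Dom C y) (Cod C l)"
      using comp_eq_left[OF lt, of e] y by simp
    then have "boundary Z k (\<psi> \<bullet> y)" using cls_zero_iff[of Z k "\<psi> \<bullet> y"] y(1,2) by simp
    then obtain f x where f: "epimorphism C f" "Cod C f = Dom C y" and x: "cycle X i x"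
      "Dom C x = Dom C f" and b: "boundary Y j ((\<phi> \<bullet> x) \<boxplus> Neg C (y \<bullet> f))"
      using loc[OF y(1)] by blast
    have [simp]: "f \<in> Arr C" using f epi_arr by blast
    have "h \<bullet> cls X i x = cls Y j (y \<bullet> f)"
      using cls_eq_iff[of Y j "\<phi> \<bullet> x" "y \<bullet> f"] x cycleD[OF x(1)] b f y cycle_comp[of Y j y f] by simp
    also have "\<dots> = t \<bullet> e \<bullet> f" using y f by (simp add: cls_comp)
    finally have "h \<bullet> cls X i x = t \<bullet> e \<bullet> f" .
    moreover have "epimorphism C (e \<bullet> f)" by (rule epi_comp[OF f(1)]) (use f y in simp_all)
    ultimately show "\<exists>e x. epimorphism C e \<and> Cod C e = Dom C t \<and> x \<in> Hom C (Dom C e) (Dom C h) \<and>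
        h \<bullet> x = t \<bullet> e"
      by (intro exI[of _ "e \<bullet> f"] exI[of _ "cls X i x"]) (use x f y in \<open>simp add: in_Hom\<close>)
  qed simp_all
qed

text \<open>\<open>cohom\<close> rests on arbitrary choices of a kernel and a cokernel. Uniqueness
  of both up to isomorphism permits the computation with whichever kernel and cokernel a concrete
  complex offers.\<close>

lemma isomorphic_cohom:
  assumes X [simp]: "bounded_complex C X" and k: "is_kernel C (cdiff X i) k"
    and b [simp]: "b \<in> Arr C" "Dom C b = cobj X (i - 1)" "Cod C b = Dom C k"
    and kb: "k \<bullet> b = cdiff X (i - 1)" and c: "is_cokernel C b c"
  shows "isomorphic C (cohom C i X) (Cod C c)"
proof -
  note [simp] = is_kernelD[OF k] is_cokernelD[OF c]
  obtain h where h: "isomorphism C h" "h \<in> Hom C (Dom C (cycles C i X)) (Dom C k)"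
    and kh: "k \<bullet> h = cycles C i X"
    using kernel_unique[OF cycles_kernel[OF X] k] .
  obtain h' where h' [simp]: "h' \<in> Arr C" "Dom C h' = Cod C h" "Cod C h' = Dom C h"
    "h' \<bullet> h = Ident C (Dom C h)" "h \<bullet> h' = Ident C (Cod C h)"
    using h(1) by (rule isomorphism_obtain)
  have [simp]: "h \<in> Arr C" "Dom C h = Dom C (cycles C i X)" "Cod C h = Dom C k"
    using h by (auto simp: in_Hom)
  have hb: "h \<bullet> to_cycles C i X = b"
    by (rule monoD[OF kernel_mono[OF k]])
      (use comp_eq_left[OF kh, of "to_cycles C i X"] kb in simp_all)
  have "is_cokernel C (to_cycles C i X) (c \<bullet> h)"
  proof (rule is_cokernelI)
    have "epimorphism C h"
    proof (rule epiI)
      fix g assume [simp]: "g \<in> Arr C" "Dom C g = Cod C h" and g: "g \<bullet> h = Zero C (Dom C h) (Cod C g)"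
      have "g = g \<bullet> h \<bullet> h'" by simp
      also have "\<dots> = Zero C (Cod C h) (Cod C g)"
        using comp_eq_left[OF g, of h'] by simp
      finally show "g = Zero C (Cod C h) (Cod C g)" .
    qed simp
    then show "epimorphism C (c \<bullet> h)" by (rule epi_comp) (simp_all add: cokernel_epi[OF c])
    fix g
    assume [simp]: "g \<in> Arr C" "Dom C g = Cod C (to_cycles C i X)"
      and g: "g \<bullet> to_cycles C i X = Zero C (Dom C (to_cycles C i X)) (Cod C g)"
    have "(g \<bullet> h') \<bullet> b = g \<bullet> (h' \<bullet> h) \<bullet> to_cycles C i X"
      unfolding hb[symmetric] by (simp del: h'(4))
    then have "(g \<bullet> h') \<bullet> b = Zero C (Dom C b) (Cod C (g \<bullet> h'))" using g by simp
    then obtain s where s: "s \<in> Arr C" "Dom C s = Cod C c" "Cod C s = Cod C g" "s \<bullet> c = g \<bullet> h'"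
      using cokernel_desc[OF c, of "g \<bullet> h'"] by auto
    have "s \<bullet> c \<bullet> h = g"
      using comp_eq_left[OF s(4), of h] s(1-3) by simp
    then show "\<exists>s \<in> Hom C (Cod C (c \<bullet> h)) (Cod C g). s \<bullet> c \<bullet> h = g"
      using s by (auto simp: in_Hom)
  qed (simp_all add: hb)
  from cokernel_unique[OF coker_is_cokernel this] show ?thesis
    by (simp flip: cohom_proj_def)
qed

end

section \<open>Chain maps\<close>

text \<open>Keeps the degree reached after two differentials in the form \<open>i + 2\<close> that
  \<open>bounded_complex\<close> uses.\<close>

lemma add_1_1_int [simp]: "i + 1 + 1 = i + (2::int)"
  by simp

lemma Chb_simps [simp]:
  "Obj (Chb C) = {X. bounded_complex C X}" "Arr (Chb C) = {f. chain_map C f}"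
  "Dom (Chb C) = cdom" "Cod (Chb C) = ccod"
  "Ident (Chb C) X = CMap X X (\<lambda>i. Ident C (cobj X i))"
  "g \<bullet>\<^bsub>Chb C\<^esub> f = CMap (cdom f) (ccod g) (\<lambda>i. ccomp g i \<bullet>\<^bsub>C\<^esub> ccomp f i)"
  by (simp_all add: Chb_def)

context abelian_category
begin

lemma isomorphism_iff: "isomorphism C f \<longleftrightarrow> monomorphism C f \<and> epimorphism C f"
  using isomorphism_mono isomorphism_epi mono_epi_isomorphism by blast

lemma chain_mapD [simp]:
  assumes "chain_map C f"
  shows "bounded_complex C (cdom f)" "bounded_complex C (ccod f)"
    "ccomp f i \<in> Arr C" "Dom C (ccomp f i) = cobj (cdom f) i" "Cod C (ccomp f i) = cobj (ccod f) i"
  using assms by (auto simp: chain_map_def in_Hom)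

lemma chain_map_comm:
  "chain_map C f \<Longrightarrow> cdiff (ccod f) i \<bullet> ccomp f i = ccomp f (i + 1) \<bullet> cdiff (cdom f) i"
  unfolding chain_map_def by blast

lemma chain_map_comm_comp:
  assumes "chain_map C f" "x \<in> Arr C" "Cod C x = cobj (cdom f) i"
  shows "cdiff (ccod f) i \<bullet> ccomp f i \<bullet> x = ccomp f (i + 1) \<bullet> cdiff (cdom f) i \<bullet> x"
  using comp_eq_left[OF chain_map_comm[OF assms(1)], of x i] assms by simp

lemma chain_mapI:
  assumes "bounded_complex C (cdom f)" "bounded_complex C (ccod f)"
    and "\<And>i. ccomp f i \<in> Hom C (cobj (cdom f) i) (cobj (ccod f) i)"
    and "\<And>i. cdiff (ccod f) i \<bullet> ccomp f i = ccomp f (i + 1) \<bullet> cdiff (cdom f) i"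
  shows "chain_map C f"
  using assms unfolding chain_map_def by blast

lemma bounded_complexI:
  assumes "\<And>i. cobj X i \<in> Obj C" "\<And>i. cdiff X i \<in> Arr C" "\<And>i. Dom C (cdiff X i) = cobj X i"
    "\<And>i. Cod C (cdiff X i) = cobj X (i + 1)"
    and "\<And>i. cdiff X (i + 1) \<bullet> cdiff X i = Zero C (cobj X i) (cobj X (i + 2))"
    and "\<And>i. \<bar>i\<bar> > m \<Longrightarrow> zero_object C (cobj X i)"
  shows "bounded_complex C X"
  using assms unfolding bounded_complex_def in_Hom by blast

lemma bounded_complex_bound:
  assumes "bounded_complex C X"
  obtains m where "\<And>i. \<bar>i\<bar> > m \<Longrightarrow> zero_object C (cobj X i)"
  using assms unfolding bounded_complex_def by blast

lemma chain_map_ident: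
  "bounded_complex C X \<Longrightarrow> chain_map C (CMap X X (\<lambda>i. Ident C (cobj X i)))"
  by (rule chain_mapI) (simp_all add: in_Hom)

lemma chain_map_comp:
  assumes "chain_map C f" "chain_map C g" "ccod f = cdom g"
  shows "chain_map C (CMap (cdom f) (ccod g) (\<lambda>i. ccomp g i \<bullet> ccomp f i))"
  by (rule chain_mapI)
    (use assms chain_map_comm[OF assms(1)] chain_map_comm_comp[OF assms(2), of "ccomp f _"]
      in \<open>simp_all add: in_Hom\<close>)

lemma category_Chb: "category (Chb C)"
proof
  fix f g X Y Z
  assume "f \<in> Hom (Chb C) X Y" "g \<in> Hom (Chb C) Y Z"
  then show "g \<bullet>\<^bsub>Chb C\<^esub> f \<in> Hom (Chb C) X Z"
    using chain_map_comp[of f g] by (simp add: in_Hom)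
next
  fix f g h W X Y Z
  assume "f \<in> Hom (Chb C) W X" "g \<in> Hom (Chb C) X Y" "h \<in> Hom (Chb C) Y Z"
  then show "(h \<bullet>\<^bsub>Chb C\<^esub> g) \<bullet>\<^bsub>Chb C\<^esub> f = h \<bullet>\<^bsub>Chb C\<^esub> g \<bullet>\<^bsub>Chb C\<^esub> f"
    by (auto simp: in_Hom)
qed (auto simp: in_Hom chain_map_ident cmap.expand)

lemma boundary_zero:
  assumes "bounded_complex C X" "T \<in> Obj C"
  shows "boundary X i (Zero C T (cobj X i))"
  by (rule boundaryI[of "Zero C T (cobj X (i - 1))"]) (use assms in simp_all)

lemma cycle_chain_map:
  assumes "chain_map C f" "cycle (cdom f) i x"
  shows "cycle (ccod f) i (ccomp f i \<bullet> x)"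
  using cycleD[OF assms(2)] assms(1) chain_map_comm_comp[OF assms(1), of x i] by (simp add: cycle_def)

text \<open>The elementwise map \<open>h\<close> satisfies the equation that defines
  \<open>cohom_map\<close>, as the class of the universal cycle shows, and that equation has only
  one solution because \<open>cohom_proj\<close> is epimorphic. From here on
  \<open>cohom_map\<close> is handled through cycles.\<close>

lemma induces_cohom_map:
  assumes f [simp]: "chain_map C f"
  shows "induces (cdom f) i (ccod f) i (ccomp f i) (cohom_map C i f)"
proof -
  have "ccomp f i \<bullet> cdiff (cdom f) (i - 1) = cdiff (ccod f) (i - 1) \<bullet> ccomp f (i - 1)"
    using chain_map_comm[OF f, of "i - 1"] by simp
  then have bd: "boundary (ccod f) i (ccomp f i \<bullet> cdiff (cdom f) (i - 1))"
    by (intro boundaryI[of "ccomp f (i - 1)"]) simp_all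
  obtain h where h: "induces (cdom f) i (ccod f) i (ccomp f i) h"
    by (rule induces_exists[OF _ _ _ _ _ _ bd]) (simp_all add: cycle_chain_map)
  note hD [simp] = inducesD[OF h]
  define g where "g = cycles_map C i f"
  have c [simp]: "cycle (cdom f) i (cycles C i (cdom f))"
    by (rule cycle_cycles) simp
  have c' [simp]: "cycle (ccod f) i (ccomp f i \<bullet> cycles C i (cdom f))"
    by (rule cycle_chain_map) simp_all
  have "\<exists>!g. g \<in> Hom C (Dom C (cycles C i (cdom f))) (Dom C (cycles C i (ccod f))) \<and>
        cycles C i (ccod f) \<bullet> g = ccomp f i \<bullet> cycles C i (cdom f)"
    by (rule is_kernel_univ[OF cycles_kernel]) (use cycleD[OF c'] in \<open>simp_all add: in_Hom\<close>)
  from theI'[OF this] have g [simp]: "g \<in> Arr C" "Dom C g = Dom C (cycles C i (cdom f))"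
    "Cod C g = Dom C (cycles C i (ccod f))"
    and cg: "cycles C i (ccod f) \<bullet> g = ccomp f i \<bullet> cycles C i (cdom f)"
    unfolding g_def cycles_map_def by (auto simp: in_Hom)
  have "cohom_proj C i (ccod f) \<bullet> g = cls (ccod f) i (ccomp f i \<bullet> cycles C i (cdom f))"
    by (rule cls_eq[symmetric]) (simp_all add: cg)
  also have "\<dots> = h \<bullet> cohom_proj C i (cdom f)"
    using hD(10)[OF c] by (simp add: cls_cycles)
  finally have hg: "h \<bullet> cohom_proj C i (cdom f) = cohom_proj C i (ccod f) \<bullet> g" by simp
  have "cohom_map C i f = h"
    unfolding cohom_map_def g_def[symmetric]
  proof (rule the_equality)
    fix h' assume h': "h' \<in> Hom C (cohom C i (cdom f)) (cohom C i (ccod f)) \<and>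
      h' \<bullet> cohom_proj C i (cdom f) = cohom_proj C i (ccod f) \<bullet> g"
    show "h' = h"
      by (rule epiD[of "cohom_proj C i (cdom f)"]) (use h' hg in \<open>auto simp: in_Hom\<close>)
  qed (use hg in \<open>auto simp: in_Hom\<close>)
  then show ?thesis using h by simp
qed

lemma cohom_map_ident:
  assumes "bounded_complex C X"
  shows "cohom_map C i (CMap X X (\<lambda>i. Ident C (cobj X i))) = Ident C (cohom C i X)"
  using induces_cohom_map[OF chain_map_ident[OF assms], of i] induces_ident[OF assms, of i]
  by (auto intro: induces_unique)

lemma cohom_map_comp:
  assumes "chain_map C f" "chain_map C g" "ccod f = cdom g"
  shows "cohom_map C i (CMap (cdom f) (ccod g) (\<lambda>i. ccomp g i \<bullet> ccomp f i)) =
    cohom_map C i g \<bullet> cohom_map C i f"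
proof (rule induces_unique)
  show "induces (cdom f) i (ccod g) i (ccomp g i \<bullet> ccomp f i)
      (cohom_map C i (CMap (cdom f) (ccod g) (\<lambda>i. ccomp g i \<bullet> ccomp f i)))"
    using induces_cohom_map[OF chain_map_comp[OF assms], of i] by simp
  show "induces (cdom f) i (ccod g) i (ccomp g i \<bullet> ccomp f i) (cohom_map C i g \<bullet> cohom_map C i f)"
    using induces_comp[OF induces_cohom_map[OF assms(1), of i]] induces_cohom_map[OF assms(2), of i]
      assms(3) by simp
qed

lemma zero_object_cohom:
  assumes [simp]: "bounded_complex C X" and z: "zero_object C (cobj X i)"
  shows "zero_object C (cohom C i X)"
proof -
  let ?Z = "Dom C (cycles C i X)"
  have "cycles C i X = Zero C ?Z (cobj X i)"
    by (rule to_zero_object[OF z]) simp_all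
  then have "Ident C ?Z = Zero C ?Z ?Z"
    using mono_zeroD[OF cycles_arr(3)[of X i], of "Ident C ?Z"] by simp
  then have "zero_object C ?Z" by (simp add: zero_object_iff_ident)
  then have "cohom_proj C i X = Zero C ?Z (cohom C i X)"
    using from_zero_object[of ?Z "cohom_proj C i X"] by simp
  then have "Ident C (cohom C i X) = Zero C (cohom C i X) (cohom C i X)"
    using epi_zeroD[OF cohom_proj_arr(4)[of X i], of "Ident C (cohom C i X)"] by simp
  then show ?thesis by (simp add: zero_object_iff_ident)
qed

section \<open>Shifts, stalk complexes and two-term complexes\<close>

lemma cobj_shift [simp]: "cobj (shift C n X) i = cobj X (i + n)"
  by (simp add: shift_def)

lemma bounded_complex_shift [simp]:
  assumes "bounded_complex C X"
  shows "bounded_complex C (shift C n X)"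
proof -
  note [simp] = assms
  obtain m where m: "\<And>i. \<bar>i\<bar> > m \<Longrightarrow> zero_object C (cobj X i)"
    using bounded_complex_bound[OF assms] by blast
  have idx [simp]: "i + 1 + n = i + n + 1" "i + 2 + n = i + n + 2" for i :: int by simp_all
  show ?thesis
  proof (rule bounded_complexI[where m = "m + \<bar>n\<bar>"])
    fix i :: int assume "m + \<bar>n\<bar> < \<bar>i\<bar>"
    then show "zero_object C (cobj (shift C n X) i)" unfolding cobj_shift by (intro m) linarith
  qed (simp_all add: shift_def)
qed

lemma cdiff_shift_comp:
  assumes "bounded_complex C X" "x \<in> Arr C" "Cod C x = cobj X (i + n)"
  shows "cdiff (shift C n X) i \<bullet> x =
    (if even n then cdiff X (i + n) \<bullet> x else Neg C (cdiff X (i + n) \<bullet> x))"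
  using assms by (simp add: shift_def)

lemma cycle_shift:
  assumes [simp]: "bounded_complex C X"
  shows "cycle (shift C n X) i x \<longleftrightarrow> cycle X (i + n) x"
proof (cases "x \<in> Arr C \<and> Cod C x = cobj X (i + n)")
  case True
  have [simp]: "i + 1 + n = i + n + 1" by simp
  with True show ?thesis by (simp add: cycle_def cdiff_shift_comp)
qed (auto simp: cycle_def)

text \<open>For odd \<open>n\<close> the differential changes sign, and the witness absorbs this:
  \<open>w\<close> is replaced by its negative.\<close>

lemma boundary_shift:
  assumes [simp]: "bounded_complex C X" and [simp]: "x \<in> Arr C" "Cod C x = cobj X (i + n)"
  shows "boundary (shift C n X) i x \<longleftrightarrow> boundary X (i + n) x"
proof -
  have idx [simp]: "i - 1 + n = i + n - 1" by simp
  show ?thesis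
  proof (cases "even n")
    case True
    then have "cdiff (shift C n X) (i - 1) = cdiff X (i + n - 1)" by (simp add: shift_def)
    then show ?thesis by (simp add: boundary_def)
  next
    case False
    then have d: "cdiff (shift C n X) (i - 1) = Neg C (cdiff X (i + n - 1))" by (simp add: shift_def)
    show ?thesis
    proof
      assume "boundary (shift C n X) i x"
      then obtain e w where [simp]: "epimorphism C e" "e \<in> Arr C" "Cod C e = Dom C x" "w \<in> Arr C"
        "Dom C w = Dom C e" "Cod C w = cobj X (i + n - 1)"
        and dw: "Neg C (cdiff X (i + n - 1)) \<bullet> w = x \<bullet> e"
        by (rule boundary_obtain) (simp add: d)
      show "boundary X (i + n) x" unfolding boundary_def
        by (intro exI[of _ e] exI[of _ "Neg C w"]) (use dw in \<open>simp add: in_Hom\<close>)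
    next
      assume "boundary X (i + n) x"
      then obtain e w where [simp]: "epimorphism C e" "e \<in> Arr C" "Cod C e = Dom C x" "w \<in> Arr C"
        "Dom C w = Dom C e" "Cod C w = cobj X (i + n - 1)"
        and dw: "cdiff X (i + n - 1) \<bullet> w = x \<bullet> e"
        by (rule boundary_obtain)
      show "boundary (shift C n X) i x" unfolding boundary_def d
        by (intro exI[of _ e] exI[of _ "Neg C w"]) (use dw in \<open>simp add: in_Hom\<close>)
    qed
  qed
qed

text \<open>The differentials on the two sides differ at most by a sign, so cycles and boundaries
  are the same and the identity of \<open>cobj X (i + n)\<close> induces an isomorphism.\<close>

lemma cohom_shift:
  assumes [simp]: "bounded_complex C X"
  shows "isomorphic C (cohom C i (shift C n X)) (cohom C (i + n) X)"
proof -
  let ?id = "Ident C (cobj X (i + n))"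
  have cyc: "cycle X (i + n) (?id \<bullet> x)" if "cycle (shift C n X) i x" for x
    using that cycleD[OF that] by (simp add: cycle_shift)
  have "cycle X (i + n) (?id \<bullet> cdiff (shift C n X) (i - 1))"
    by (rule cyc) (simp add: cycle_def)
  have "boundary (shift C n X) i (cdiff (shift C n X) (i - 1))"
    by (rule boundaryI[of "Ident C (cobj (shift C n X) (i - 1))"]) simp_all
  then have bd: "boundary X (i + n) (?id \<bullet> cdiff (shift C n X) (i - 1))"
    using complex_arr[of "shift C n X" "i - 1"] by (simp add: boundary_shift)
  obtain h where h: "induces (shift C n X) i X (i + n) ?id h"
    by (rule induces_exists[OF _ _ _ _ _ _ bd]) (simp_all add: cyc)
  note hD [simp] = inducesD[OF h]
  have "monomorphism C h"
    unfolding induces_mono_iff[OF h] by (auto simp: cycle_shift boundary_shift cycleD)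
  moreover have "epimorphism C h"
    unfolding induces_epi_iff[OF h]
  proof (intro allI impI)
    fix y assume y: "cycle X (i + n) y"
    show "\<exists>e x. epimorphism C e \<and> Cod C e = Dom C y \<and> cycle (shift C n X) i x \<and> Dom C x = Dom C e \<and>
      boundary X (i + n) ((?id \<bullet> x) \<boxplus> Neg C (y \<bullet> e))"
      by (intro exI[of _ "Ident C (Dom C y)"] exI[of _ y])
        (use y cycleD[OF y] in \<open>simp add: cycle_shift boundary_zero\<close>)
  qed
  ultimately have "isomorphism C h" by (simp add: isomorphism_iff)
  then show ?thesis unfolding isomorphic_def by (intro bexI[of _ h]) (simp_all add: in_Hom)
qed

lemma shift_map_simps [simp]:
  "cdom (shift_map C n f) = shift C n (cdom f)" "ccod (shift_map C n f) = shift C n (ccod f)"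
  "ccomp (shift_map C n f) i = ccomp f (i + n)"
  by (simp_all add: shift_map_def)

lemma chain_map_shift:
  assumes f [simp]: "chain_map C f"
  shows "chain_map C (shift_map C n f)"
proof (rule chain_mapI)
  fix i
  have idx: "i + 1 + n = i + n + 1" by simp
  show "cdiff (ccod (shift_map C n f)) i \<bullet> ccomp (shift_map C n f) i =
     ccomp (shift_map C n f) (i + 1) \<bullet> cdiff (cdom (shift_map C n f)) i"
    using chain_map_comm[OF f, of "i + n"] by (simp add: shift_def idx)
qed (simp_all add: in_Hom)

text \<open>This lets the suspension act on zigzags, since formal inverses must go to formal
  inverses. Shifting changes neither cycles nor boundaries, so the criteria for monomorphisms and
  epimorphisms carry over from degree \<open>i + n\<close>.\<close>

lemma quasi_iso_shift:
  assumes f: "f \<in> quasi_isos C"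
  shows "shift_map C n f \<in> quasi_isos C"
proof -
  have [simp]: "chain_map C f" and iso: "\<And>i. isomorphism C (cohom_map C i f)"
    using f by (auto simp: quasi_isos_def)
  have c: "chain_map C (shift_map C n f)" by (rule chain_map_shift) simp
  have "isomorphism C (cohom_map C i (shift_map C n f))" for i
  proof -
    note ind = induces_cohom_map[of f "i + n", simplified]
      induces_cohom_map[OF c, of i, simplified]
    have m: "monomorphism C (cohom_map C (i + n) f)" "epimorphism C (cohom_map C (i + n) f)"
      using iso isomorphism_iff by auto
    have "monomorphism C (cohom_map C i (shift_map C n f))"
      using m(1) unfolding induces_mono_iff[OF ind(1)] induces_mono_iff[OF ind(2)]
      by (auto simp: cycle_shift boundary_shift cycleD)
    moreover have "epimorphism C (cohom_map C i (shift_map C n f))"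
      unfolding induces_epi_iff[OF ind(2)]
    proof (intro allI impI)
      fix y assume "cycle (shift C n (ccod f)) i y"
      then have y: "cycle (ccod f) (i + n) y" by (simp add: cycle_shift)
      then obtain e x where e: "epimorphism C e" "Cod C e = Dom C y" and x: "cycle (cdom f) (i + n) x"
        "Dom C x = Dom C e" and b: "boundary (ccod f) (i + n) ((ccomp f (i + n) \<bullet> x) \<boxplus> Neg C (y \<bullet> e))"
        using m(2) unfolding induces_epi_iff[OF ind(1)] by blast
      have "boundary (shift C n (ccod f)) i ((ccomp f (i + n) \<bullet> x) \<boxplus> Neg C (y \<bullet> e))"
        using b e x y cycleD[OF x(1)] cycleD[OF y] epi_arr[OF e(1)] by (simp add: boundary_shift)
      then show "\<exists>e x. epimorphism C e \<and> Cod C e = Dom C y \<and> cycle (shift C n (cdom f)) i x \<and>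
          Dom C x = Dom C e \<and> boundary (shift C n (ccod f)) i ((ccomp f (i + n) \<bullet> x) \<boxplus> Neg C (y \<bullet> e))"
        using e x by (auto simp: cycle_shift)
    qed
    ultimately show ?thesis by (simp add: isomorphism_iff)
  qed
  then show ?thesis using c by (simp add: quasi_isos_def)
qed

section \<open>Complexes concentrated in one or two degrees\<close>

lemma isomorphic_cohom_ker:
  assumes [simp]: "bounded_complex C X" and z: "cdiff X (i - 1) = Zero C (cobj X (i - 1)) (cobj X i)"
    and k: "is_kernel C (cdiff X i) k"
  shows "isomorphic C (cohom C i X) (Dom C k)"
proof -
  note [simp] = is_kernelD[OF k]
  have [simp]: "Dom C k \<in> Obj C" by simp
  have "is_cokernel C (Zero C (cobj X (i - 1)) (Dom C k)) (Ident C (Dom C k))"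
    by (rule cokernel_of_zero) simp_all
  from isomorphic_cohom[OF _ k _ _ _ _ this] show ?thesis using z by simp
qed

lemma isomorphic_cohom_coker:
  assumes [simp]: "bounded_complex C X" and z: "cdiff X i = Zero C (cobj X i) (cobj X (i + 1))"
    and c: "is_cokernel C (cdiff X (i - 1)) c"
  shows "isomorphic C (cohom C i X) (Cod C c)"
proof -
  have "is_kernel C (cdiff X i) (Ident C (cobj X i))"
    unfolding z by (rule kernel_of_zero) simp_all
  from isomorphic_cohom[OF _ this _ _ _ _ c] show ?thesis by simp
qed

definition stalk_at :: "int \<Rightarrow> 'o \<Rightarrow> ('o, 'm) cpx" where
  "stalk_at n A = (let X = (\<lambda>i. if i = n then A else zero_obj C) in Cpx X (\<lambda>i. Zero C (X i) (X (i + 1))))"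

lemma stalk_at_simps [simp]:
  "cobj (stalk_at n A) i = (if i = n then A else zero_obj C)"
  "cdiff (stalk_at n A) i =
    Zero C (if i = n then A else zero_obj C) (if i + 1 = n then A else zero_obj C)"
  by (simp_all add: stalk_at_def Let_def)

lemma cpx_eqI:
  assumes "\<And>i. cobj X i = cobj Y i" "\<And>i. cdiff X i = cdiff Y i"
  shows "X = Y"
  using assms by (intro cpx.expand) auto

text \<open>Literal equality, not just isomorphism, because the sign in a shift does not affect zero
  differentials.\<close>

lemma shift_stalk:
  assumes "A \<in> Obj C"
  shows "shift C k (stalk C A) = stalk_at (- k) A"
proof (rule cpx_eqI)
  fix i
  show "cobj (shift C k (stalk C A)) i = cobj (stalk_at (- k) A) i"
    by (auto simp: stalk_def Let_def)
  have "i + k = 0 \<longleftrightarrow> i = - k" "i + k + 1 = 0 \<longleftrightarrow> i + 1 = - k" by auto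
  then show "cdiff (shift C k (stalk C A)) i = cdiff (stalk_at (- k) A) i"
    using assms by (simp add: stalk_def shift_def Let_def)
qed

lemma shift_stalk_at:
  assumes "A \<in> Obj C"
  shows "shift C k (stalk_at n A) = stalk_at (n - k) A"
proof (rule cpx_eqI)
  fix i
  show "cobj (shift C k (stalk_at n A)) i = cobj (stalk_at (n - k) A) i"
    by auto
  have "i + k = n \<longleftrightarrow> i = n - k" "i + k + 1 = n \<longleftrightarrow> i + 1 = n - k" by auto
  then show "cdiff (shift C k (stalk_at n A)) i = cdiff (stalk_at (n - k) A) i"
    using assms by (simp add: shift_def)
qed

lemma bounded_complex_stalk_at [simp]:
  assumes [simp]: "A \<in> Obj C"
  shows "bounded_complex C (stalk_at n A)"
proof -
  show ?thesis by (rule bounded_complexI[where m = "\<bar>n\<bar>"]) (auto simp: zero_obj_zero)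
qed

lemma cohom_stalk_at:
  assumes [simp]: "A \<in> Obj C"
  shows "isomorphic C (cohom C n (stalk_at n A)) A"
  using isomorphic_cohom_ker[of "stalk_at n A" n "Ident C A"] kernel_of_zero[of A] by simp

lemma cohom_stalk_at_zero:
  "A \<in> Obj C \<Longrightarrow> i \<noteq> n \<Longrightarrow> zero_object C (cohom C i (stalk_at n A))"
  by (rule zero_object_cohom) (simp_all add: zero_obj_zero)

definition two_term :: "int \<Rightarrow> 'm \<Rightarrow> ('o, 'm) cpx" where
  "two_term n f = (let X = (\<lambda>i. if i = n then Dom C f else if i = n + 1 then Cod C f else zero_obj C)
     in Cpx X (\<lambda>i. if i = n then f else Zero C (X i) (X (i + 1))))"

lemma two_term_simps [simp]:
  "cobj (two_term n f) i = (if i = n then Dom C f else if i = n + 1 then Cod C f else zero_obj C)"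
  "cdiff (two_term n f) i = (if i = n then f else
    Zero C (if i = n then Dom C f else if i = n + 1 then Cod C f else zero_obj C)
      (if i + 1 = n then Dom C f else if i = n then Cod C f else zero_obj C))"
  by (simp_all add: two_term_def Let_def)

lemma bounded_complex_two_term [simp]:
  assumes [simp]: "f \<in> Arr C"
  shows "bounded_complex C (two_term n f)"
proof -
  show ?thesis by (rule bounded_complexI[where m = "\<bar>n\<bar> + 1"]) (auto simp: zero_obj_zero)
qed

lemma cohom_two_term_ker:
  assumes [simp]: "f \<in> Arr C"
  shows "isomorphic C (cohom C n (two_term n f)) (Dom C (ker C f))"
  using ker_is_kernel[of f] by (intro isomorphic_cohom_ker) simp_all

lemma cohom_two_term_coker:
  assumes [simp]: "f \<in> Arr C"
  shows "isomorphic C (cohom C (n + 1) (two_term n f)) (Cod C (coker C f))"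
  using coker_is_cokernel[of f] by (intro isomorphic_cohom_coker) simp_all

section \<open>Mapping cones\<close>

text \<open>The cone is built from chosen biproduct tuples; naming their four arrows puts
  coordinates on it. Index 1 belongs to the summand of \<open>cdom u\<close>, in degree
  \<open>i + 1\<close>, and index 2 to the summand of \<open>ccod u\<close>, in degree
  \<open>i\<close>.\<close>

definition cone_i1 :: "('o, 'm) cmap \<Rightarrow> int \<Rightarrow> 'm" where
  "cone_i1 u i = (case biprod C (cobj (cdom u) (i + 1)) (cobj (ccod u) i) of (P, i1, i2, p1, p2) \<Rightarrow> i1)"

definition cone_i2 :: "('o, 'm) cmap \<Rightarrow> int \<Rightarrow> 'm" where
  "cone_i2 u i = (case biprod C (cobj (cdom u) (i + 1)) (cobj (ccod u) i) of (P, i1, i2, p1, p2) \<Rightarrow> i2)"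

definition cone_p1 :: "('o, 'm) cmap \<Rightarrow> int \<Rightarrow> 'm" where
  "cone_p1 u i = (case biprod C (cobj (cdom u) (i + 1)) (cobj (ccod u) i) of (P, i1, i2, p1, p2) \<Rightarrow> p1)"

definition cone_p2 :: "('o, 'm) cmap \<Rightarrow> int \<Rightarrow> 'm" where
  "cone_p2 u i = (case biprod C (cobj (cdom u) (i + 1)) (cobj (ccod u) i) of (P, i1, i2, p1, p2) \<Rightarrow> p2)"

context
  fixes u :: "('o, 'm) cmap"
  assumes u [simp]: "chain_map C u"
begin

lemma cone_biproduct [simp]:
  "cobj (cone C u) i \<in> Obj C"
  "cone_i1 u i \<in> Arr C" "Dom C (cone_i1 u i) = cobj (cdom u) (i + 1)"
  "Cod C (cone_i1 u i) = cobj (cone C u) i"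
  "cone_i2 u i \<in> Arr C" "Dom C (cone_i2 u i) = cobj (ccod u) i"
  "Cod C (cone_i2 u i) = cobj (cone C u) i"
  "cone_p1 u i \<in> Arr C" "Dom C (cone_p1 u i) = cobj (cone C u) i"
  "Cod C (cone_p1 u i) = cobj (cdom u) (i + 1)"
  "cone_p2 u i \<in> Arr C" "Dom C (cone_p2 u i) = cobj (cone C u) i"
  "Cod C (cone_p2 u i) = cobj (ccod u) i"
  "cone_p1 u i \<bullet> cone_i1 u i = Ident C (cobj (cdom u) (i + 1))"
  "cone_p2 u i \<bullet> cone_i2 u i = Ident C (cobj (ccod u) i)"
  "cone_p1 u i \<bullet> cone_i2 u i = Zero C (cobj (ccod u) i) (cobj (cdom u) (i + 1))"
  "cone_p2 u i \<bullet> cone_i1 u i = Zero C (cobj (cdom u) (i + 1)) (cobj (ccod u) i)"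
  and cone_decomp: "(cone_i1 u i \<bullet> cone_p1 u i) \<boxplus> (cone_i2 u i \<bullet> cone_p2 u i) =
    Ident C (cobj (cone C u) i)"
  using biprod_is_biproduct[of "cobj (cdom u) (i + 1)" "cobj (ccod u) i"]
  by (auto simp: is_biproduct_def cone_def Let_def cone_i1_def cone_i2_def cone_p1_def cone_p2_def
      in_Hom split: prod.splits)

lemma cone_biproduct_comp [simp]:
  assumes "x \<in> Arr C"
  shows "Cod C x = cobj (cdom u) (i + 1) \<Longrightarrow> cone_p1 u i \<bullet> cone_i1 u i \<bullet> x = x"
    "Cod C x = cobj (ccod u) i \<Longrightarrow> cone_p2 u i \<bullet> cone_i2 u i \<bullet> x = x"
    "Cod C x = cobj (ccod u) i \<Longrightarrow>
      cone_p1 u i \<bullet> cone_i2 u i \<bullet> x = Zero C (Dom C x) (cobj (cdom u) (i + 1))"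
    "Cod C x = cobj (cdom u) (i + 1) \<Longrightarrow>
      cone_p2 u i \<bullet> cone_i1 u i \<bullet> x = Zero C (Dom C x) (cobj (ccod u) i)"
  using comp_eq_left[OF cone_biproduct(14), of x i] comp_eq_left[OF cone_biproduct(15), of x i]
    comp_eq_left[OF cone_biproduct(16), of x i] comp_eq_left[OF cone_biproduct(17), of x i] assms
  by simp_all

text \<open>The decomposition of the identity of the biproduct rebuilds an arrow from its two
  coordinates.\<close>

lemma cone_ext:
  assumes "x \<in> Arr C" "y \<in> Arr C" "Cod C x = cobj (cone C u) i" "Cod C y = cobj (cone C u) i"
    "Dom C x = Dom C y"
    and p: "cone_p1 u i \<bullet> x = cone_p1 u i \<bullet> y" "cone_p2 u i \<bullet> x = cone_p2 u i \<bullet> y"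
  shows "x = y"
proof -
  have e: "z = (cone_i1 u i \<bullet> cone_p1 u i \<bullet> z) \<boxplus> (cone_i2 u i \<bullet> cone_p2 u i \<bullet> z)"
    if "z \<in> Arr C" "Cod C z = cobj (cone C u) i" for z
  proof -
    have "z = ((cone_i1 u i \<bullet> cone_p1 u i) \<boxplus> (cone_i2 u i \<bullet> cone_p2 u i)) \<bullet> z"
      unfolding cone_decomp using that by simp
    also have "\<dots> = (cone_i1 u i \<bullet> cone_p1 u i \<bullet> z) \<boxplus> (cone_i2 u i \<bullet> cone_p2 u i \<bullet> z)"
      using that by simp
    finally show ?thesis .
  qed
  show ?thesis using e[of x] e[of y] assms by metis
qed

lemma cdiff_cone:
  "cdiff (cone C u) i = (cone_i1 u (i + 1) \<bullet> Neg C (cdiff (cdom u) (i + 1)) \<bullet> cone_p1 u i) \<boxplus>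
     (cone_i2 u (i + 1) \<bullet> ccomp u (i + 1) \<bullet> cone_p1 u i) \<boxplus>
     (cone_i2 u (i + 1) \<bullet> cdiff (ccod u) i \<bullet> cone_p2 u i)"
  by (simp add: cone_def Let_def cone_i1_def cone_i2_def cone_p1_def cone_p2_def split: prod.splits)

lemma cdiff_cone_arr [simp]:
  "cdiff (cone C u) i \<in> Arr C" "Dom C (cdiff (cone C u) i) = cobj (cone C u) i"
  "Cod C (cdiff (cone C u) i) = cobj (cone C u) (i + 1)"
  by (simp_all add: cdiff_cone)

lemma cone_p_cdiff [simp]:
  "cone_p1 u (i + 1) \<bullet> cdiff (cone C u) i = Neg C (cdiff (cdom u) (i + 1) \<bullet> cone_p1 u i)"
  "cone_p2 u (i + 1) \<bullet> cdiff (cone C u) i =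
    (ccomp u (i + 1) \<bullet> cone_p1 u i) \<boxplus> (cdiff (ccod u) i \<bullet> cone_p2 u i)"
  by (simp_all add: cdiff_cone)

lemma cone_p_cdiff_comp [simp]:
  assumes "x \<in> Arr C" "Cod C x = cobj (cone C u) i"
  shows "cone_p1 u (i + 1) \<bullet> cdiff (cone C u) i \<bullet> x = Neg C (cdiff (cdom u) (i + 1) \<bullet> cone_p1 u i \<bullet> x)"
    "cone_p2 u (i + 1) \<bullet> cdiff (cone C u) i \<bullet> x =
      (ccomp u (i + 1) \<bullet> cone_p1 u i \<bullet> x) \<boxplus> (cdiff (ccod u) i \<bullet> cone_p2 u i \<bullet> x)"
  using comp_eq_left[OF cone_p_cdiff(1), of x i] comp_eq_left[OF cone_p_cdiff(2), of x i] assms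
  by simp_all

lemma bounded_complex_cone [simp]: "bounded_complex C (cone C u)"
proof -
  have dd: "cdiff (cone C u) (i + 1) \<bullet> cdiff (cone C u) i =
      Zero C (cobj (cone C u) i) (cobj (cone C u) (i + 2))" for i
  proof (rule cone_ext[where i = "i + 2"])
    show "cone_p1 u (i + 2) \<bullet> cdiff (cone C u) (i + 1) \<bullet> cdiff (cone C u) i =
      cone_p1 u (i + 2) \<bullet> Zero C (cobj (cone C u) i) (cobj (cone C u) (i + 2))"
      using cone_p_cdiff_comp(1)[of "cdiff (cone C u) i" "i + 1"]
        diff_diff_comp(1)[of "cdom u" "cone_p1 u i" "i + 1"] by simp
    \<comment> \<open>The two mixed terms cancel: \<open>u d\<close> carries the sign of
      \<open>- d\<close>, \<open>d u\<close> carries none, and \<open>u\<close> is a chain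
      map.\<close>
    show "cone_p2 u (i + 2) \<bullet> cdiff (cone C u) (i + 1) \<bullet> cdiff (cone C u) i =
      cone_p2 u (i + 2) \<bullet> Zero C (cobj (cone C u) i) (cobj (cone C u) (i + 2))"
      using cone_p_cdiff_comp(2)[of "cdiff (cone C u) i" "i + 1"]
        chain_map_comm_comp[OF u, of "cone_p1 u i" "i + 1"] by simp
  qed simp_all
  obtain m where m: "\<And>i. \<bar>i\<bar> > m \<Longrightarrow> zero_object C (cobj (cdom u) i)"
    using bounded_complex_bound[OF chain_mapD(1)[OF u]] by blast
  obtain m' where m': "\<And>i. \<bar>i\<bar> > m' \<Longrightarrow> zero_object C (cobj (ccod u) i)"
    using bounded_complex_bound[OF chain_mapD(2)[OF u]] by blast
  \<comment> \<open>The extra 1 accounts for the summand \<open>cobj (cdom u) (i + 1)\<close>.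
    Absolute values are taken because the bounds \<open>m\<close> and \<open>m'\<close> may be
    negative.\<close>
  have "zero_object C (cobj (cone C u) i)" if i: "\<bar>i\<bar> > \<bar>m\<bar> + \<bar>m'\<bar> + 1" for i
  proof -
    have z: "zero_object C (cobj (cdom u) (i + 1))" "zero_object C (cobj (ccod u) i)"
      using i by (intro m m'; linarith)+
    have "Ident C (cobj (cone C u) i) = Zero C (cobj (cone C u) i) (cobj (cone C u) i)"
      by (rule cone_ext[where i = i])
        (use to_zero_object[OF z(1), of "cone_p1 u i"] to_zero_object[OF z(2), of "cone_p2 u i"]
          in simp_all)
    then show ?thesis by (simp add: zero_object_iff_ident)
  qed
  then show ?thesis using dd by (intro bounded_complexI[where m = "\<bar>m\<bar> + \<bar>m'\<bar> + 1"]) simp_all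
qed

lemma cone_inj_simps [simp]:
  "cdom (cone_inj C u) = ccod u" "ccod (cone_inj C u) = cone C u"
  "ccomp (cone_inj C u) i = cone_i2 u i"
  by (simp_all add: cone_inj_def cone_i2_def)

lemma cone_proj_simps [simp]:
  "cdom (cone_proj C u) = cone C u" "ccod (cone_proj C u) = shift C 1 (cdom u)"
  "ccomp (cone_proj C u) i = cone_p1 u i"
  by (simp_all add: cone_proj_def cone_p1_def)

lemma chain_map_cone_inj [simp]: "chain_map C (cone_inj C u)"
proof (rule chain_mapI)
  fix i
  have "cdiff (cone C u) i \<bullet> cone_i2 u i = cone_i2 u (i + 1) \<bullet> cdiff (ccod u) i"
    by (rule cone_ext[where i = "i + 1"]) simp_all
  then show "cdiff (ccod (cone_inj C u)) i \<bullet> ccomp (cone_inj C u) i =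
    ccomp (cone_inj C u) (i + 1) \<bullet> cdiff (cdom (cone_inj C u)) i" by simp
qed (simp_all add: in_Hom)

lemma chain_map_cone_proj [simp]: "chain_map C (cone_proj C u)"
  by (rule chain_mapI) (simp_all add: in_Hom cdiff_shift_comp)

text \<open>In coordinates \<open>z = (x, y)\<close> the conditions read \<open>d x = 0\<close> and
  \<open>u x + d y = 0\<close>: a cycle \<open>x\<close> together with a reason why
  \<open>u x\<close> is a boundary.\<close>

lemma cycle_cone_iff:
  assumes "z \<in> Arr C" "Cod C z = cobj (cone C u) i"
  shows "cycle (cone C u) i z \<longleftrightarrow>
    cdiff (cdom u) (i + 1) \<bullet> cone_p1 u i \<bullet> z = Zero C (Dom C z) (cobj (cdom u) (i + 2)) \<and>
    (ccomp u (i + 1) \<bullet> cone_p1 u i \<bullet> z) \<boxplus> (cdiff (ccod u) i \<bullet> cone_p2 u i \<bullet> z) =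
      Zero C (Dom C z) (cobj (ccod u) (i + 1))" (is "?l \<longleftrightarrow> ?a \<and> ?b")
proof
  assume ?l
  then have d: "cdiff (cone C u) i \<bullet> z = Zero C (Dom C z) (cobj (cone C u) (i + 1))"
    by (rule cycleD)
  have "Neg C (cdiff (cdom u) (i + 1) \<bullet> cone_p1 u i \<bullet> z) =
      cone_p1 u (i + 1) \<bullet> cdiff (cone C u) i \<bullet> z"
    by (rule cone_p_cdiff_comp(1)[OF assms, symmetric])
  also have "\<dots> = Zero C (Dom C z) (cobj (cdom u) (i + 2))" unfolding d using assms by simp
  finally have a: ?a using assms by simp
  have "(ccomp u (i + 1) \<bullet> cone_p1 u i \<bullet> z) \<boxplus> (cdiff (ccod u) i \<bullet> cone_p2 u i \<bullet> z) =
      cone_p2 u (i + 1) \<bullet> cdiff (cone C u) i \<bullet> z"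
    by (rule cone_p_cdiff_comp(2)[OF assms, symmetric])
  also have "\<dots> = Zero C (Dom C z) (cobj (ccod u) (i + 1))" unfolding d using assms by simp
  finally show "?a \<and> ?b" using a by simp
next
  assume r: "?a \<and> ?b"
  have "cdiff (cone C u) i \<bullet> z = Zero C (Dom C z) (cobj (cone C u) (i + 1))"
    by (rule cone_ext[where i = "i + 1"]) (use assms r in simp_all)
  then show ?l using assms by (simp add: cycle_def)
qed

end

end

section \<open>The long exact sequence of a cone\<close>

context abelian_category
begin

lemma diff_cycle_comp:
  assumes "bounded_complex C X" "cycle X i x" "e \<in> Arr C" "Cod C e = Dom C x"
  shows "cdiff X i \<bullet> x \<bullet> e = Zero C (Dom C e) (cobj X (i + 1))"
  using cycleD(3)[OF cycle_comp[OF assms]] assms(3,4) cycleD(1)[OF assms(2)] by simp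

context
  fixes u :: "('o, 'm) cmap"
  assumes u [simp]: "chain_map C u"
begin

lemma cycle_coneD:
  assumes "cycle (cone C u) i z"
  shows "cdiff (cdom u) (i + 1) \<bullet> cone_p1 u i \<bullet> z = Zero C (Dom C z) (cobj (cdom u) (i + 2))"
    "cdiff (ccod u) i \<bullet> cone_p2 u i \<bullet> z = Neg C (ccomp u (i + 1) \<bullet> cone_p1 u i \<bullet> z)"
proof -
  note [simp] = cycleD(1,2)[OF assms]
  note z = assms[unfolded cycle_cone_iff[OF u cycleD(1,2)[OF assms]]]
  show "cdiff (cdom u) (i + 1) \<bullet> cone_p1 u i \<bullet> z = Zero C (Dom C z) (cobj (cdom u) (i + 2))"
    using z by blast
  show "cdiff (ccod u) i \<bullet> cone_p2 u i \<bullet> z = Neg C (ccomp u (i + 1) \<bullet> cone_p1 u i \<bullet> z)"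
    by (rule add_eq_zero_imp) (use z in simp_all)
qed

text \<open>The witness is \<open>(a, b)\<close>, whose differential is
  \<open>(- d a, u a + d b)\<close>.\<close>

lemma boundary_coneI:
  assumes "a \<in> Arr C" "Cod C a = cobj (cdom u) i" "Dom C a = Dom C z"
    and "b \<in> Arr C" "Cod C b = cobj (ccod u) (i - 1)" "Dom C b = Dom C z"
    and "z \<in> Arr C" "Cod C z = cobj (cone C u) i"
    and "cone_p1 u i \<bullet> z = Neg C (cdiff (cdom u) i \<bullet> a)"
    and "cone_p2 u i \<bullet> z = (ccomp u i \<bullet> a) \<boxplus> (cdiff (ccod u) (i - 1) \<bullet> b)"
  shows "boundary (cone C u) i z"
proof (rule boundaryI)
  let ?w = "(cone_i1 u (i - 1) \<bullet> a) \<boxplus> (cone_i2 u (i - 1) \<bullet> b)"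
  note [simp] = assms(1-8)
  show w: "?w \<in> Arr C" "Cod C ?w = cobj (cone C u) (i - 1)" "Dom C ?w = Dom C z" by simp_all
  have "cdiff (cone C u) (i - 1) \<in> Arr C" "Dom C (cdiff (cone C u) (i - 1)) = cobj (cone C u) (i - 1)"
    "Cod C (cdiff (cone C u) (i - 1)) = cobj (cone C u) i"
    using cdiff_cone_arr[of u "i - 1"] by simp_all
  note d = this
  have p: "cone_p1 u (i - 1) \<bullet> ?w = a" "cone_p2 u (i - 1) \<bullet> ?w = b" by simp_all
  show "cdiff (cone C u) (i - 1) \<bullet> ?w = z"
  proof (rule cone_ext[where i = i])
    show "cone_p1 u i \<bullet> cdiff (cone C u) (i - 1) \<bullet> ?w = cone_p1 u i \<bullet> z"
      using cone_p_cdiff_comp(1)[OF u w(1,2)] unfolding p assms(9) by simp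
    show "cone_p2 u i \<bullet> cdiff (cone C u) (i - 1) \<bullet> ?w = cone_p2 u i \<bullet> z"
      using cone_p_cdiff_comp(2)[OF u w(1,2)] unfolding p assms(10) by simp
  qed (use w d in \<open>simp_all del: comp_add\<close>)
qed (use assms in simp)

lemma boundary_cone_obtain:
  assumes "boundary (cone C u) i z" "z \<in> Arr C" "Cod C z = cobj (cone C u) i"
  obtains e a b where "epimorphism C e" "e \<in> Arr C" "Cod C e = Dom C z"
    "a \<in> Arr C" "Cod C a = cobj (cdom u) i" "Dom C a = Dom C e"
    "b \<in> Arr C" "Cod C b = cobj (ccod u) (i - 1)" "Dom C b = Dom C e"
    "cone_p1 u i \<bullet> z \<bullet> e = Neg C (cdiff (cdom u) i \<bullet> a)"
    "cone_p2 u i \<bullet> z \<bullet> e = (ccomp u i \<bullet> a) \<boxplus> (cdiff (ccod u) (i - 1) \<bullet> b)"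
proof -
  obtain e w where e [simp]: "epimorphism C e" "e \<in> Arr C" "Cod C e = Dom C z" and w [simp]: "w \<in> Arr C"
    "Dom C w = Dom C e" "Cod C w = cobj (cone C u) (i - 1)"
    and d: "cdiff (cone C u) (i - 1) \<bullet> w = z \<bullet> e"
    using boundary_obtain[OF assms(1)] .
  have "cone_p1 u i \<bullet> z \<bullet> e = Neg C (cdiff (cdom u) i \<bullet> cone_p1 u (i - 1) \<bullet> w)"
    "cone_p2 u i \<bullet> z \<bullet> e =
      (ccomp u i \<bullet> cone_p1 u (i - 1) \<bullet> w) \<boxplus> (cdiff (ccod u) (i - 1) \<bullet> cone_p2 u (i - 1) \<bullet> w)"
    using cone_p_cdiff_comp[OF u w(1,3)] d by simp_all
  then show ?thesis using that[of e "cone_p1 u (i - 1) \<bullet> w" "cone_p2 u (i - 1) \<bullet> w"] by simp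
qed

text \<open>The first projection is read as an arrow from degree \<open>i\<close> of the cone to
  degree \<open>i + 1\<close> of \<open>cdom u\<close>. It commutes with the differentials up to a
  sign, which the boundary witness absorbs.\<close>

lemma connecting_exists:
  obtains \<delta> where "induces (cone C u) i (cdom u) (i + 1) (cone_p1 u i) \<delta>"
proof (rule induces_exists)
  have "cone_p1 u i \<bullet> cdiff (cone C u) (i - 1) = Neg C (cdiff (cdom u) i \<bullet> cone_p1 u (i - 1))"
    using cone_p_cdiff(1)[OF u, of "i - 1"] by simp
  moreover have "cdiff (cone C u) (i - 1) \<in> Arr C" "Cod C (cdiff (cone C u) (i - 1)) = cobj (cone C u) i"
    using cdiff_cone_arr[OF u, of "i - 1"] by simp_all
  ultimately show "boundary (cdom u) (i + 1) (cone_p1 u i \<bullet> cdiff (cone C u) (i - 1))"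
    by (intro boundaryI[of "Neg C (cone_p1 u (i - 1))"]) simp_all
  fix x assume x: "cycle (cone C u) i x"
  show "cycle (cdom u) (i + 1) (cone_p1 u i \<bullet> x)"
    using cycleD(1,2)[OF x] cycle_coneD(1)[OF x] by (simp add: cycle_def)
qed simp_all

text \<open>A cycle \<open>(x, y)\<close> of the cone has \<open>u x = d (- y)\<close>. Conversely,
  if \<open>x\<close> is a cycle with \<open>u x = d w\<close>, then \<open>(x, - w)\<close> is a
  cycle of the cone.\<close>

lemma exact_connecting_cohom_map:
  assumes "induces (cone C u) i (cdom u) (i + 1) (cone_p1 u i) \<delta>"
  shows "exact_pair C \<delta> (cohom_map C (i + 1) u)"
proof (rule induces_exact[OF assms induces_cohom_map[OF u]])
  fix x assume x: "cycle (cone C u) i x"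
  show "boundary (ccod u) (i + 1) (ccomp u (i + 1) \<bullet> cone_p1 u i \<bullet> x)"
    by (rule boundaryI[of "Neg C (cone_p2 u i \<bullet> x)"])
      (use cycleD(1,2)[OF x] cycle_coneD(2)[OF x] in simp_all)
next
  fix y assume y: "cycle (cdom u) (i + 1) y" and b: "boundary (ccod u) (i + 1) (ccomp u (i + 1) \<bullet> y)"
  note [simp] = cycleD(1,2)[OF y]
  obtain e w where e [simp]: "epimorphism C e" "e \<in> Arr C" "Cod C e = Dom C y" and w [simp]: "w \<in> Arr C"
    "Dom C w = Dom C e" "Cod C w = cobj (ccod u) i"
    and d: "cdiff (ccod u) i \<bullet> w = ccomp u (i + 1) \<bullet> y \<bullet> e"
    by (rule boundary_obtain[OF b]) simp
  let ?x = "(cone_i1 u i \<bullet> y \<bullet> e) \<boxplus> (cone_i2 u i \<bullet> Neg C w)"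
  have x: "?x \<in> Arr C" "Cod C ?x = cobj (cone C u) i" "Dom C ?x = Dom C e" by simp_all
  have p: "cone_p1 u i \<bullet> ?x = y \<bullet> e" "cone_p2 u i \<bullet> ?x = Neg C w" by simp_all
  have "cycle (cone C u) i ?x"
    unfolding cycle_cone_iff[OF u x(1,2)] p
    using diff_cycle_comp[OF _ y e(2,3)] by (simp add: d)
  then show "\<exists>e x. epimorphism C e \<and> Cod C e = Dom C y \<and> cycle (cone C u) i x \<and> Dom C x = Dom C e \<and>
      boundary (cdom u) (i + 1) ((cone_p1 u i \<bullet> x) \<boxplus> Neg C (y \<bullet> e))"
    by (intro exI[of _ e] exI[of _ ?x]) (use p(1) in \<open>simp add: boundary_zero del: comp_add comp_neg\<close>)
qed

text \<open>For a cycle \<open>x\<close>, \<open>(0, u x)\<close> is the differential of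
  \<open>(x, 0)\<close>. Conversely, \<open>(0, y) = d (a, b)\<close> says that \<open>a\<close> is
  a cycle and \<open>y - u a = d b\<close>.\<close>

lemma exact_cohom_map_cone_inj:
  "exact_pair C (cohom_map C i u) (cohom_map C i (cone_inj C u))"
proof -
  note ind = induces_cohom_map[OF chain_map_cone_inj[OF u], of i, simplified cone_inj_simps[OF u]]
  show ?thesis
  proof (rule induces_exact[OF induces_cohom_map[OF u] ind])
    fix x assume x: "cycle (cdom u) i x"
    note [simp] = cycleD[OF x]
    show "boundary (cone C u) i (cone_i2 u i \<bullet> ccomp u i \<bullet> x)"
      by (rule boundary_coneI[of x _ _ "Zero C (Dom C x) (cobj (ccod u) (i - 1))"]) simp_all
  next
    fix y assume y: "cycle (ccod u) i y" and b: "boundary (cone C u) i (cone_i2 u i \<bullet> y)"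
    note [simp] = cycleD(1,2)[OF y]
    obtain e a b where e [simp]: "epimorphism C e" "e \<in> Arr C" "Cod C e = Dom C y" and
      ab [simp]: "a \<in> Arr C" "Cod C a = cobj (cdom u) i" "Dom C a = Dom C e"
      "b \<in> Arr C" "Cod C b = cobj (ccod u) (i - 1)" "Dom C b = Dom C e"
      and p: "cone_p1 u i \<bullet> (cone_i2 u i \<bullet> y) \<bullet> e = Neg C (cdiff (cdom u) i \<bullet> a)"
      "cone_p2 u i \<bullet> (cone_i2 u i \<bullet> y) \<bullet> e = (ccomp u i \<bullet> a) \<boxplus> (cdiff (ccod u) (i - 1) \<bullet> b)"
      by (rule boundary_cone_obtain[OF b]) simp_all
    have "cycle (cdom u) i a" using p(1)[symmetric] by (simp add: cycle_def)
    moreover have "boundary (ccod u) i ((ccomp u i \<bullet> a) \<boxplus> Neg C (y \<bullet> e))"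
      by (rule boundaryI[of "Neg C b"]) (use p(2) in simp_all)
    ultimately show "\<exists>e x. epimorphism C e \<and> Cod C e = Dom C y \<and> cycle (cdom u) i x \<and>
        Dom C x = Dom C e \<and> boundary (ccod u) i ((ccomp u i \<bullet> x) \<boxplus> Neg C (y \<bullet> e))"
      by (intro exI[of _ e] exI[of _ a]) simp
  qed
qed

text \<open>If \<open>(x, y)\<close> is a cycle with \<open>x = d w\<close>, then
  \<open>y + u w\<close> is a cycle, and \<open>(0, y + u w)\<close> differs from
  \<open>(x, y)\<close> by the differential of \<open>(w, 0)\<close>.\<close>

lemma exact_cone_inj_connecting:
  assumes "induces (cone C u) i (cdom u) (i + 1) (cone_p1 u i) \<delta>"
  shows "exact_pair C (cohom_map C i (cone_inj C u)) \<delta>"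
proof -
  note ind = induces_cohom_map[OF chain_map_cone_inj[OF u], of i, simplified cone_inj_simps[OF u]]
  show ?thesis
  proof (rule induces_exact[OF ind assms])
    fix x assume x: "cycle (ccod u) i x"
    show "boundary (cdom u) (i + 1) (cone_p1 u i \<bullet> cone_i2 u i \<bullet> x)"
      using cycleD[OF x] by (simp add: boundary_zero)
  next
    fix z assume z: "cycle (cone C u) i z" and b: "boundary (cdom u) (i + 1) (cone_p1 u i \<bullet> z)"
    note [simp] = cycleD(1,2)[OF z]
    obtain e w where e [simp]: "epimorphism C e" "e \<in> Arr C" "Cod C e = Dom C z" and w [simp]: "w \<in> Arr C"
      "Dom C w = Dom C e" "Cod C w = cobj (cdom u) i"
      and d: "cdiff (cdom u) i \<bullet> w = cone_p1 u i \<bullet> z \<bullet> e"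
      by (rule boundary_obtain[OF b]) simp
    let ?y = "(cone_p2 u i \<bullet> z \<bullet> e) \<boxplus> (ccomp u i \<bullet> w)"
    have "cycle (cone C u) i (z \<bullet> e)" by (rule cycle_comp[OF _ z]) simp_all
    from cycle_coneD(2)[OF this] have "cycle (ccod u) i ?y"
      by (simp add: cycle_def chain_map_comm_comp[OF u] d)
    moreover have "boundary (cone C u) i ((cone_i2 u i \<bullet> ?y) \<boxplus> Neg C (z \<bullet> e))"
      by (rule boundary_coneI[of w _ _ "Zero C (Dom C e) (cobj (ccod u) (i - 1))"])
        (simp_all add: d add_ac)
    ultimately show "\<exists>e x. epimorphism C e \<and> Cod C e = Dom C z \<and> cycle (ccod u) i x \<and>
        Dom C x = Dom C e \<and> boundary (cone C u) i ((cone_i2 u i \<bullet> x) \<boxplus> Neg C (z \<bullet> e))"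
      by (intro exI[of _ e] exI[of _ ?y]) simp
  qed
qed

text \<open>The stretch of the long exact sequence centred at \<open>ccod u\<close>, in the shape
  that the five-term condition of a narrow sequence expects.\<close>

lemma cohom_cone_five_term:
  obtains p q r s where
    "p \<in> Hom C (cohom C i (cone C u)) (cohom C (i + 1) (cdom u))"
    "q \<in> Hom C (cohom C (i + 1) (cdom u)) (cohom C (i + 1) (ccod u))"
    "r \<in> Hom C (cohom C (i + 1) (ccod u)) (cohom C (i + 1) (cone C u))"
    "s \<in> Hom C (cohom C (i + 1) (cone C u)) (cohom C (i + 2) (cdom u))"
    "exact_pair C p q" "exact_pair C q r" "exact_pair C r s"
proof -
  obtain p where p: "induces (cone C u) i (cdom u) (i + 1) (cone_p1 u i) p"
    by (rule connecting_exists)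
  obtain s where s: "induces (cone C u) (i + 1) (cdom u) (i + 1 + 1) (cone_p1 u (i + 1)) s"
    by (rule connecting_exists)
  let ?q = "cohom_map C (i + 1) u" and ?r = "cohom_map C (i + 1) (cone_inj C u)"
  note ind = induces_cohom_map[OF u, of "i + 1"]
    induces_cohom_map[OF chain_map_cone_inj[OF u], of "i + 1", simplified cone_inj_simps[OF u]]
  show ?thesis
  proof (rule that)
    show "exact_pair C p ?q" by (rule exact_connecting_cohom_map[OF p])
    show "exact_pair C ?q ?r" by (rule exact_cohom_map_cone_inj)
    show "exact_pair C ?r s" by (rule exact_cone_inj_connecting[OF s])
  qed (use inducesD[OF p] inducesD[OF s] inducesD[OF ind(1)] inducesD[OF ind(2)] in
      \<open>simp_all add: in_Hom\<close>)
qed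

text \<open>The isomorphism is induced by the projection from the cone to \<open>ccod u\<close> followed by \<open>g\<close>.\<close>

lemma cohom_cone_short_exact:
  assumes g [simp]: "chain_map C g" and ug [simp]: "cdom g = ccod u"
    and ses: "\<And>i. short_exact C (ccomp u i) (ccomp g i)"
  shows "isomorphic C (cohom C i (cone C u)) (cohom C i (ccod g))"
proof -
  have um: "monomorphism C (ccomp u i)" and ge: "epimorphism C (ccomp g i)"
    and ex: "exact_pair C (ccomp u i) (ccomp g i)" for i
    using ses[of i] by (auto simp: short_exact_def)
  have gu [simp]: "ccomp g i \<bullet> ccomp u i = Zero C (cobj (cdom u) i) (cobj (ccod g) i)" for i
    using exact_pairD(4)[OF ex] by simp
  have gux [simp]: "ccomp g i \<bullet> ccomp u i \<bullet> x = Zero C (Dom C x) (cobj (ccod g) i)"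
    if "x \<in> Arr C" "Cod C x = cobj (cdom u) i" for i x
    using that comp_eq_left[OF gu, of x i] by simp
  let ?\<phi> = "ccomp g i \<bullet> cone_p2 u i"
  have cyc: "cycle (ccod g) i (?\<phi> \<bullet> x)" if x: "cycle (cone C u) i x" for x
    using cycleD(1,2)[OF x] cycle_coneD(2)[OF x] chain_map_comm_comp[OF g, of "cone_p2 u i \<bullet> x" i]
    by (simp add: cycle_def)
  have "?\<phi> \<bullet> cdiff (cone C u) (i - 1) =
      cdiff (ccod g) (i - 1) \<bullet> ccomp g (i - 1) \<bullet> cone_p2 u (i - 1)"
    using cone_p_cdiff(2)[OF u, of "i - 1"] cdiff_cone_arr[OF u, of "i - 1"]
      chain_map_comm_comp[OF g, of "cone_p2 u (i - 1)" "i - 1"] by simp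
  then have bd: "boundary (ccod g) i (?\<phi> \<bullet> cdiff (cone C u) (i - 1))"
    using cdiff_cone_arr[OF u, of "i - 1"]
    by (intro boundaryI[of "ccomp g (i - 1) \<bullet> cone_p2 u (i - 1)"]) simp_all
  obtain h where h: "induces (cone C u) i (ccod g) i ?\<phi> h"
    by (rule induces_exists[OF _ _ _ _ _ cyc bd]) simp_all
  have "monomorphism C h"
    unfolding induces_mono_iff[OF h]
  proof (intro allI impI, elim conjE)
    fix x assume x: "cycle (cone C u) i x" and b: "boundary (ccod g) i (?\<phi> \<bullet> x)"
    note [simp] = cycleD(1,2)[OF x]
    obtain e1 t where e1 [simp]: "epimorphism C e1" "e1 \<in> Arr C" "Cod C e1 = Dom C x"
      and t [simp]: "t \<in> Arr C" "Dom C t = Dom C e1" "Cod C t = cobj (ccod g) (i - 1)"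
      and dt: "cdiff (ccod g) (i - 1) \<bullet> t = ccomp g i \<bullet> cone_p2 u i \<bullet> x \<bullet> e1"
      by (rule boundary_obtain[OF b]) simp
    \<comment> \<open>For the cycle \<open>x = (a, y)\<close> of the cone, the witness
      \<open>t\<close> of \<open>g y = d t\<close> lifts to \<open>s\<close>. Then
      \<open>y - d s\<close> is killed by \<open>g\<close> and equals \<open>u w\<close>. Applying
      \<open>d\<close> gives \<open>u (d w) = - u a\<close>, so \<open>d w = - a\<close>, and
      \<open>x\<close> is the differential of \<open>(w, s)\<close>; all this holds over
      covers.\<close>
    obtain e2 s where e2: "epimorphism C e2" and [simp]: "Cod C e2 = Dom C t"
      and s [simp]: "s \<in> Arr C" "Dom C s = Dom C e2" "Cod C s = cobj (ccod u) (i - 1)"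
      and gs: "ccomp g (i - 1) \<bullet> s = t \<bullet> e2"
      by (rule epi_local_lift[OF ge[of "i - 1"], of t]) simp_all
    have [simp]: "e2 \<in> Arr C" using e2 epi_arr by blast
    have d1: "Cod C (cdiff (ccod u) (i - 1)) = cobj (ccod u) i" "Cod C (cdiff (ccod g) (i - 1)) = cobj (ccod g) i"
      using complex_arr(4)[of "ccod u" "i - 1"] complex_arr(4)[of "ccod g" "i - 1"] by simp_all
    let ?y = "(cone_p2 u i \<bullet> x \<bullet> e1 \<bullet> e2) \<boxplus> Neg C (cdiff (ccod u) (i - 1) \<bullet> s)"
    have "ccomp g i \<bullet> cdiff (ccod u) (i - 1) \<bullet> s = cdiff (ccod g) (i - 1) \<bullet> t \<bullet> e2"
      using chain_map_comm_comp[OF g, of s "i - 1"] gs by simp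
    also have "\<dots> = ccomp g i \<bullet> cone_p2 u i \<bullet> x \<bullet> e1 \<bullet> e2"
      using comp_eq_left[OF dt, of e2] by simp
    finally have "ccomp g i \<bullet> ?y = Zero C (Dom C ?y) (Cod C (ccomp g i))" by (simp add: d1)
    then obtain e3 w where e3: "epimorphism C e3" and [simp]: "Cod C e3 = Dom C e2"
      and w [simp]: "w \<in> Arr C" "Dom C w = Dom C e3" "Cod C w = cobj (cdom u) i"
      and uw: "ccomp u i \<bullet> w = ?y \<bullet> e3"
      using exact_local_lift[OF ex[of i], of ?y] by (auto simp: d1)
    have [simp]: "e3 \<in> Arr C" using e3 epi_arr by blast
    let ?e = "e1 \<bullet> e2 \<bullet> e3"
    have c: "cycle (cone C u) i (x \<bullet> ?e)" by (rule cycle_comp[OF _ x]) simp_all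
    have "ccomp u (i + 1) \<bullet> cdiff (cdom u) i \<bullet> w = cdiff (ccod u) i \<bullet> ?y \<bullet> e3"
      using chain_map_comm_comp[OF u, of w i] uw by simp
    also have "\<dots> = Neg C (ccomp u (i + 1) \<bullet> cone_p1 u i \<bullet> x \<bullet> ?e)"
      using cycle_coneD(2)[OF c] by (simp add: d1)
    finally have uu: "ccomp u (i + 1) \<bullet> cdiff (cdom u) i \<bullet> w =
        ccomp u (i + 1) \<bullet> Neg C (cone_p1 u i \<bullet> x \<bullet> ?e)" by simp
    have "cdiff (cdom u) i \<bullet> w = Neg C (cone_p1 u i \<bullet> x \<bullet> ?e)"
      by (rule monoD[OF um[of "i + 1"] _ _ _ _ _ uu]) simp_all
    then have "boundary (cone C u) i (x \<bullet> ?e)"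
      using uw by (intro boundary_coneI[of w _ _ "s \<bullet> e3"]) (simp_all add: d1 add_ac)
    moreover have "epimorphism C ?e"
      by (intro epi_comp e1 e2 e3) simp_all
    ultimately show "boundary (cone C u) i x"
      by (rule boundary_local) simp_all
  qed
  moreover have "epimorphism C h"
    unfolding induces_epi_iff[OF h]
  proof (intro allI impI)
    fix y assume y: "cycle (ccod g) i y"
    note [simp] = cycleD(1,2)[OF y]
    \<comment> \<open>Lift \<open>y\<close> to \<open>s\<close>. Since
      \<open>g (d s) = d y = 0\<close>, some \<open>w\<close> has \<open>u w = d s\<close>, and
      \<open>(- w, s)\<close> is a cycle of the cone that maps to \<open>y\<close>, again over
      covers.\<close>
    obtain e1 s where e1: "epimorphism C e1" and [simp]: "Cod C e1 = Dom C y"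
      and s [simp]: "s \<in> Arr C" "Dom C s = Dom C e1" "Cod C s = cobj (ccod u) i"
      and gs: "ccomp g i \<bullet> s = y \<bullet> e1"
      by (rule epi_local_lift[OF ge[of i], of y]) simp_all
    have [simp]: "e1 \<in> Arr C" using e1 epi_arr by blast
    have "ccomp g (i + 1) \<bullet> cdiff (ccod u) i \<bullet> s =
        Zero C (Dom C (cdiff (ccod u) i \<bullet> s)) (Cod C (ccomp g (i + 1)))"
      using chain_map_comm_comp[OF g, of s i] gs diff_cycle_comp[OF _ y, of e1] by simp
    then obtain e2 w where e2: "epimorphism C e2" and [simp]: "Cod C e2 = Dom C e1"
      and w [simp]: "w \<in> Arr C" "Dom C w = Dom C e2" "Cod C w = cobj (cdom u) (i + 1)"
      and uw: "ccomp u (i + 1) \<bullet> w = cdiff (ccod u) i \<bullet> s \<bullet> e2"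
      using exact_local_lift[OF ex[of "i + 1"], of "cdiff (ccod u) i \<bullet> s"] epi_arr by auto
    have [simp]: "e2 \<in> Arr C" using e2 epi_arr by blast
    let ?x = "(cone_i1 u i \<bullet> Neg C w) \<boxplus> (cone_i2 u i \<bullet> s \<bullet> e2)"
    have xx: "?x \<in> Arr C" "Cod C ?x = cobj (cone C u) i" "Dom C ?x = Dom C e2" by simp_all
    have p: "cone_p1 u i \<bullet> ?x = Neg C w" "cone_p2 u i \<bullet> ?x = s \<bullet> e2" by simp_all
    have "ccomp u (i + 2) \<bullet> cdiff (cdom u) (i + 1) \<bullet> w =
        Zero C (Dom C w) (cobj (ccod u) (i + 2))"
      using chain_map_comm_comp[OF u, of w "i + 1"] uw by simp
    then have "cdiff (cdom u) (i + 1) \<bullet> w = Zero C (Dom C w) (cobj (cdom u) (i + 2))"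
      using mono_zeroD[OF um[of "i + 2"], of "cdiff (cdom u) (i + 1) \<bullet> w"] by simp
    then have "cycle (cone C u) i ?x"
      unfolding cycle_cone_iff[OF u xx(1,2)] p using uw by simp
    moreover have "?\<phi> \<bullet> ?x = y \<bullet> e1 \<bullet> e2" using comp_eq_left[OF gs, of e2] by simp
    moreover have "epimorphism C (e1 \<bullet> e2)" by (intro epi_comp e1 e2) simp
    ultimately show "\<exists>e x. epimorphism C e \<and> Cod C e = Dom C y \<and> cycle (cone C u) i x \<and>
        Dom C x = Dom C e \<and> boundary (ccod g) i ((?\<phi> \<bullet> x) \<boxplus> Neg C (y \<bullet> e))"
      by (intro exI[of _ "e1 \<bullet> e2"] exI[of _ ?x]) (simp add: boundary_zero)
  qed
  ultimately have "isomorphism C h" by (simp add: isomorphism_iff)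
  then show ?thesis using inducesD[OF h] unfolding isomorphic_def by (intro bexI[of _ h]) (simp_all add: in_Hom)
qed

end

end

section \<open>Zigzags and localization\<close>

lemma zz_path_append:
  "zz_path K W X p Y \<Longrightarrow> zz_path K W Y q Z \<Longrightarrow> zz_path K W X (p @ q) Z"
  by (induction rule: zz_path.induct) (auto intro: zz_path.intros)

inductive_cases zz_path_nilE [elim!]: "zz_path K W X [] Y"
inductive_cases zz_path_fwdE [elim!]: "zz_path K W X (Fwd f # p) Y"
inductive_cases zz_path_bwdE [elim!]: "zz_path K W X (Bwd w # p) Y"

text \<open>Each letter determines both of its endpoints. This aligns the two paths of an elementary
  step at their common prefix.\<close>

lemma zz_path_end_unique:
  "zz_path K W X p Y \<Longrightarrow> zz_path K W X p Y' \<Longrightarrow> Y = Y'"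
proof (induction arbitrary: Y' rule: zz_path.induct)
  case (fwd f X Y p Z)
  from fwd(4) obtain T where T: "f \<in> Hom K X T" "zz_path K W T p Y'" by (rule zz_path_fwdE)
  moreover have "T = Y" using T(1) fwd(1) by (simp add: in_Hom)
  ultimately show ?case using fwd(3) by simp
next
  case (bwd w Y X p Z)
  from bwd(5) obtain T where T: "w \<in> Hom K T X" "zz_path K W T p Y'" by (rule zz_path_bwdE)
  moreover have "T = Y" using T(1) bwd(2) by (simp add: in_Hom)
  ultimately show ?case using bwd(4) by simp
qed auto

lemma zz_step_append:
  assumes "zz_step K W X Y p p'" "zz_path K W Y q Z"
  shows "zz_step K W X Z (p @ q) (p' @ q)"
proof -
  obtain a l r b where "zz_rel K W l r" "p = a @ l @ b" "p' = a @ r @ b"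
    using assms(1) unfolding zz_step_def by blast
  then have "\<exists>a l r b. zz_rel K W l r \<and> p @ q = a @ l @ b \<and> p' @ q = a @ r @ b"
    by (intro exI[of _ a] exI[of _ l] exI[of _ r] exI[of _ "b @ q"]) simp
  moreover have "zz_path K W X p Y" "zz_path K W X p' Y" using assms(1) by (simp_all add: zz_step_def)
  ultimately show ?thesis using zz_path_append[OF _ assms(2)] by (simp add: zz_step_def)
qed

lemma zz_step_prepend:
  assumes "zz_path K W X q Y" "zz_step K W Y Z p p'"
  shows "zz_step K W X Z (q @ p) (q @ p')"
proof -
  obtain a l r b where "zz_rel K W l r" "p = a @ l @ b" "p' = a @ r @ b"
    using assms(2) unfolding zz_step_def by blast
  then have "\<exists>a l r b. zz_rel K W l r \<and> q @ p = a @ l @ b \<and> q @ p' = a @ r @ b"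
    by (intro exI[of _ "q @ a"] exI[of _ l] exI[of _ r] exI[of _ b]) simp
  moreover have "zz_path K W Y p Z" "zz_path K W Y p' Z" using assms(2) by (simp_all add: zz_step_def)
  ultimately show ?thesis using zz_path_append[OF assms(1)] by (simp add: zz_step_def)
qed

lemma equivclp_map:
  assumes "equivclp R p q" "\<And>p q. R p q \<Longrightarrow> S (f p) (f q)"
  shows "equivclp S (f p) (f q)"
  using assms(1)
proof (induction rule: equivclp_induct)
  case (step y z)
  then show ?case using assms(2)
    by (meson equivclp_into_equivclp)
qed simp

lemma equivclp_zz_path:
  assumes "equivclp (zz_step K W X Y) p q" "zz_path K W X p Y"
  shows "zz_path K W X q Y"
  using assms by (induction rule: equivclp_induct) (auto simp: zz_step_def)

lemma zz_class_eq_iff: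
  "zz_class K W X Y p = zz_class K W X Y q \<longleftrightarrow> equivclp (zz_step K W X Y) p q"
proof -
  have "equivp (equivclp (zz_step K W X Y))" by (rule equivp_evquivclp)
  then show ?thesis unfolding zz_class_def equivp_def by auto
qed

lemma equivclp_zz_append:
  assumes "equivclp (zz_step K W X Y) p p'" "equivclp (zz_step K W Y Z) q q'"
    "zz_path K W X p Y" "zz_path K W Y q Z"
  shows "equivclp (zz_step K W X Z) (p @ q) (p' @ q')"
proof -
  have "equivclp (zz_step K W X Z) (p @ q) (p' @ q)"
    using assms(1) by (rule equivclp_map[where f = "\<lambda>p. p @ q"]) (rule zz_step_append[OF _ assms(4)])
  moreover have "equivclp (zz_step K W X Z) (p' @ q) (p' @ q')"
    using assms(2) by (rule equivclp_map[where f = "\<lambda>q. p' @ q"])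
      (rule zz_step_prepend[OF equivclp_zz_path[OF assms(1,3)]])
  ultimately show ?thesis by (rule equivclp_trans)
qed

lemma loc_of_zz_simps [simp]:
  "ldom (loc_of_zz K W X Y p) = X" "lcod (loc_of_zz K W X Y p) = Y"
  "lcls (loc_of_zz K W X Y p) = zz_class K W X Y p"
  by (simp_all add: loc_of_zz_def)

lemma loc_of_zz_eq_iff:
  "loc_of_zz K W X Y p = loc_of_zz K W X Y q \<longleftrightarrow> equivclp (zz_step K W X Y) p q"
  by (simp add: loc_of_zz_def zz_class_eq_iff)

lemma localization_simps [simp]:
  "Obj (localization K W) = Obj K"
  "Dom (localization K W) = ldom" "Cod (localization K W) = lcod"
  "Ident (localization K W) X = loc_of_zz K W X X []"
  by (simp_all add: localization_def)

lemma Hom_localization: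
  "f \<in> Hom (localization K W) X Y \<longleftrightarrow> (\<exists>p. zz_path K W X p Y \<and> f = loc_of_zz K W X Y p)"
  by (auto simp: in_Hom localization_def)

text \<open>Composition is defined as a union over all representatives. Concatenation respects the
  equivalence, so all members of the union are one and the same class, and \<open>p\<close> and
  \<open>q\<close> themselves show that it is nonempty.\<close>

lemma localization_comp:
  assumes "zz_path K W X p Y" "zz_path K W Y q Z"
  shows "loc_of_zz K W Y Z q \<bullet>\<^bsub>localization K W\<^esub> loc_of_zz K W X Y p = loc_of_zz K W X Z (p @ q)"
proof -
  have "zz_class K W X Z (p' @ q') = zz_class K W X Z (p @ q)"
    if "p' \<in> zz_class K W X Y p" "q' \<in> zz_class K W Y Z q" for p' q'
    using that equivclp_zz_append[of K W X Y p p' Z q q'] assms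
    by (simp add: zz_class_eq_iff zz_class_def[of _ _ _ _ p] zz_class_def[of _ _ _ _ q] equivclp_sym)
  moreover have "p \<in> zz_class K W X Y p" "q \<in> zz_class K W Y Z q" by (simp_all add: zz_class_def)
  ultimately have "(\<Union>p' \<in> zz_class K W X Y p. \<Union>q' \<in> zz_class K W Y Z q.
      zz_class K W X Z (p' @ q')) = zz_class K W X Z (p @ q)" by blast
  then show ?thesis by (simp add: localization_def loc_of_zz_def)
qed

lemma equivclp_zz_step:
  assumes "zz_path K W X l Y" "zz_path K W X r Y" "zz_rel K W l r"
  shows "equivclp (zz_step K W X Y) l r"
proof -
  have "zz_step K W X Y l r" unfolding zz_step_def
    using assms by (intro conjI exI[of _ "[]"] exI[of _ l] exI[of _ r]) auto
  then show ?thesis by auto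
qed

section \<open>Arrows and isomorphisms in the localization\<close>

context category
begin

lemma loc_map_Hom: "f \<in> Hom C X Y \<Longrightarrow> loc_map C W f \<in> Hom (localization C W) X Y"
  unfolding Hom_localization
  by (rule exI[of _ "[Fwd f]"]) (auto intro!: zz_path.intros simp: in_Hom loc_map_def)

lemma loc_map_comp:
  assumes "f \<in> Hom C X Y" "g \<in> Hom C Y Z"
  shows "loc_map C W g \<bullet>\<^bsub>localization C W\<^esub> loc_map C W f = loc_map C W (g \<bullet> f)"
proof -
  have p: "zz_path C W X [Fwd f] Y" "zz_path C W Y [Fwd g] Z" "zz_path C W X [Fwd f, Fwd g] Z"
    "zz_path C W X [Fwd (g \<bullet> f)] Z"
    using assms comp_in[OF assms] by (auto intro!: zz_path.intros simp: in_Hom)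
  have "loc_of_zz C W X Z ([Fwd f] @ [Fwd g]) = loc_of_zz C W X Z [Fwd (g \<bullet> f)]"
    unfolding loc_of_zz_eq_iff using p zz_rel.comp[OF assms] by (intro equivclp_zz_step) auto
  then show ?thesis
    using localization_comp[OF p(1,2)] assms comp_in[OF assms] by (simp add: loc_map_def in_Hom)
qed

lemma loc_map_ident:
  assumes "X \<in> Obj C"
  shows "loc_map C W (Ident C X) = Ident (localization C W) X"
proof -
  have "zz_path C W X [Fwd (Ident C X)] X" "zz_path C W X [] X"
    using assms ident_in by (auto intro!: zz_path.intros)
  then have "equivclp (zz_step C W X X) [Fwd (Ident C X)] []"
    by (rule equivclp_zz_step) (rule zz_rel.ident[OF assms])
  then show ?thesis using assms by (simp add: loc_map_def loc_of_zz_eq_iff)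
qed

lemma isomorphic_localization:
  assumes "isomorphic C X Y"
  shows "isomorphic (localization C W) X Y"
proof -
  obtain f where f: "f \<in> Hom C X Y" "isomorphism C f"
    using assms unfolding isomorphic_def by blast
  obtain g where g: "g \<in> Hom C Y X" "g \<bullet> f = Ident C X" "f \<bullet> g = Ident C Y"
    using f unfolding isomorphism_def by (auto simp: in_Hom)
  have XY: "X \<in> Obj C" "Y \<in> Obj C" using f by (auto simp: in_Hom)
  have "isomorphism (localization C W) (loc_map C W f)"
    unfolding isomorphism_def
    using loc_map_Hom[OF f(1), of W] loc_map_Hom[OF g(1), of W] loc_map_comp[OF f(1) g(1), of W]
      loc_map_comp[OF g(1) f(1), of W] g(2,3) loc_map_ident XY
    by (auto simp: in_Hom)
  then show ?thesis using loc_map_Hom[OF f(1)] unfolding isomorphic_def by blast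
qed

lemma localization_ident_in:
  "X \<in> Obj C \<Longrightarrow> Ident (localization C W) X \<in> Hom (localization C W) X X"
  unfolding Hom_localization by (auto intro: zz_path.intros)

lemma zz_path_obj: "zz_path C W X p Y \<Longrightarrow> X \<in> Obj C \<and> Y \<in> Obj C"
  by (induction rule: zz_path.induct) (auto simp: in_Hom)

lemma zz_path_split:
  "zz_path C W X (p @ q) Z \<Longrightarrow> \<exists>Y. zz_path C W X p Y \<and> zz_path C W Y q Z"
proof (induction p arbitrary: X)
  case Nil
  then show ?case using zz_path_obj[OF Nil] by (auto intro: zz_path.nil)
next
  case (Cons l p)
  show ?case
  proof (cases l)
    case (Fwd f)
    obtain T where T: "f \<in> Hom C X T" "zz_path C W T (p @ q) Z"
      using Cons.prems unfolding Fwd append_Cons by (rule zz_path_fwdE)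
    then show ?thesis using Cons.IH[OF T(2)] zz_path.fwd[OF T(1)] unfolding Fwd by blast
  next
    case (Bwd w)
    obtain T where T: "w \<in> W" "w \<in> Hom C T X" "zz_path C W T (p @ q) Z"
      using Cons.prems unfolding Bwd append_Cons by (rule zz_path_bwdE)
    then show ?thesis using Cons.IH[OF T(3)] zz_path.bwd[OF T(1,2)] unfolding Bwd by blast
  qed
qed

lemma localization_ident_comp:
  assumes "f \<in> Hom (localization C W) X Y"
  shows "Ident (localization C W) Y \<bullet>\<^bsub>localization C W\<^esub> f = f"
    "f \<bullet>\<^bsub>localization C W\<^esub> Ident (localization C W) X = f"
proof -
  obtain p where p: "zz_path C W X p Y" "f = loc_of_zz C W X Y p"
    using assms unfolding Hom_localization by blast
  have "zz_path C W X [] X" "zz_path C W Y [] Y" using zz_path_obj[OF p(1)] by (auto intro: zz_path.intros)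
  then show "Ident (localization C W) Y \<bullet>\<^bsub>localization C W\<^esub> f = f"
    "f \<bullet>\<^bsub>localization C W\<^esub> Ident (localization C W) X = f"
    using localization_comp[OF p(1), of "[]" Y] localization_comp[of C W X "[]" X p Y] p by simp_all
qed

lemma localization_isomorphism_ident:
  assumes "X \<in> Obj C"
  shows "isomorphism (localization C W) (Ident (localization C W) X)"
  using localization_ident_in[OF assms, of W] localization_ident_comp[OF localization_ident_in[OF assms, of W]]
  unfolding isomorphism_def by (intro conjI bexI[of _ "Ident (localization C W) X"]) (simp_all add: in_Hom)

end

text \<open>Two functors are meant: cohomology, which sends quasi-isomorphisms to isomorphisms, and
  the shift of complexes, which sends them to quasi-isomorphisms.\<close>

locale category_functor = K: category K + D: category D
  for K :: "('o, 'm, 'z) cat_scheme" and D :: "('p, 'n, 'y) cat_scheme" +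
  fixes Fo :: "'o \<Rightarrow> 'p" and F :: "'m \<Rightarrow> 'n"
  assumes map_in: "f \<in> Hom K X Y \<Longrightarrow> F f \<in> Hom D (Fo X) (Fo Y)"
    and map_ident: "X \<in> Obj K \<Longrightarrow> F (Ident K X) = Ident D (Fo X)"
    and map_comp: "f \<in> Hom K X Y \<Longrightarrow> g \<in> Hom K Y Z \<Longrightarrow> F (g \<bullet>\<^bsub>K\<^esub> f) = F g \<bullet>\<^bsub>D\<^esub> F f"
begin

lemma map_obj [simp]: "X \<in> Obj K \<Longrightarrow> Fo X \<in> Obj D"
  using map_in[OF K.ident_in, of X] D.dom_in[of "F (Ident K X)"] by (auto simp: in_Hom)

lemma map_arr [simp]:
  assumes "f \<in> Arr K"
  shows "F f \<in> Arr D" "Dom D (F f) = Fo (Dom K f)" "Cod D (F f) = Fo (Cod K f)"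
  using map_in[of f "Dom K f" "Cod K f"] assms by (auto simp: in_Hom)

lemma zz_path_map:
  assumes "\<And>w. w \<in> W \<Longrightarrow> F w \<in> V"
  shows "zz_path K W X p Y \<Longrightarrow> zz_path D V (Fo X) (map (map_zz_letter F) p) (Fo Y)"
  by (induction rule: zz_path.induct) (auto intro: zz_path.intros map_in assms)

lemma zz_rel_map:
  assumes "\<And>w. w \<in> W \<Longrightarrow> F w \<in> V"
  shows "zz_rel K W l r \<Longrightarrow> zz_rel D V (map (map_zz_letter F) l) (map (map_zz_letter F) r)"
  by (induction rule: zz_rel.induct)
    (auto intro: zz_rel.intros map_in assms simp: map_ident map_comp)

lemma zz_step_map:
  assumes W: "\<And>w. w \<in> W \<Longrightarrow> F w \<in> V" and s: "zz_step K W X Y p q"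
  shows "zz_step D V (Fo X) (Fo Y) (map (map_zz_letter F) p) (map (map_zz_letter F) q)"
proof -
  obtain a l r b where "zz_rel K W l r" and pq: "p = a @ l @ b" "q = a @ r @ b"
    using s unfolding zz_step_def by blast
  then have "zz_rel D V (map (map_zz_letter F) l) (map (map_zz_letter F) r)"
    using zz_rel_map[OF W] by blast
  moreover have "zz_path D V (Fo X) (map (map_zz_letter F) p) (Fo Y)"
    "zz_path D V (Fo X) (map (map_zz_letter F) q) (Fo Y)"
    using s zz_path_map[OF W] unfolding zz_step_def by blast+
  ultimately show ?thesis unfolding zz_step_def
    using pq by (metis map_append)
qed

definition inverse_arr :: "'n \<Rightarrow> 'n" where
  "inverse_arr f = (SOME g. g \<in> Hom D (Cod D f) (Dom D f) \<and>
     g \<bullet>\<^bsub>D\<^esub> f = Ident D (Dom D f) \<and> f \<bullet>\<^bsub>D\<^esub> g = Ident D (Cod D f))"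

lemma inverse_arr:
  assumes "isomorphism D f"
  shows "inverse_arr f \<in> Hom D (Cod D f) (Dom D f)"
    "inverse_arr f \<bullet>\<^bsub>D\<^esub> f = Ident D (Dom D f)" "f \<bullet>\<^bsub>D\<^esub> inverse_arr f = Ident D (Cod D f)"
proof -
  have "\<exists>g. g \<in> Hom D (Cod D f) (Dom D f) \<and>
     g \<bullet>\<^bsub>D\<^esub> f = Ident D (Dom D f) \<and> f \<bullet>\<^bsub>D\<^esub> g = Ident D (Cod D f)"
    using assms unfolding isomorphism_def by blast
  from someI_ex[OF this] show "inverse_arr f \<in> Hom D (Cod D f) (Dom D f)"
    "inverse_arr f \<bullet>\<^bsub>D\<^esub> f = Ident D (Dom D f)" "f \<bullet>\<^bsub>D\<^esub> inverse_arr f = Ident D (Cod D f)"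
    unfolding inverse_arr_def by blast+
qed

text \<open>The extension of \<open>F\<close> to zigzags from the universal property of
  localization, with formal inverses sent to chosen inverses. The start object is an argument
  because the empty zigzag carries no object at which to take the identity.\<close>

fun zz_eval :: "'o \<Rightarrow> 'm zigzag \<Rightarrow> 'n" where
  "zz_eval X [] = Ident D (Fo X)"
| "zz_eval X (Fwd f # p) = zz_eval (Cod K f) p \<bullet>\<^bsub>D\<^esub> F f"
| "zz_eval X (Bwd w # p) = zz_eval (Dom K w) p \<bullet>\<^bsub>D\<^esub> inverse_arr (F w)"

context
  fixes W
  assumes W_iso: "\<And>w. w \<in> W \<Longrightarrow> isomorphism D (F w)"
    and W_arr: "W \<subseteq> Arr K"
begin

lemma zz_eval_in: "zz_path K W X p Y \<Longrightarrow> zz_eval X p \<in> Hom D (Fo X) (Fo Y)"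
proof (induction rule: zz_path.induct)
  case (bwd w Y X p Z)
  then show ?case using inverse_arr(1)[OF W_iso[OF bwd(1)]] by (auto simp: in_Hom)
qed (auto simp: in_Hom)

lemma zz_eval_append:
  "zz_path K W X p Y \<Longrightarrow> zz_path K W Y q Z \<Longrightarrow> zz_eval X (p @ q) = zz_eval Y q \<bullet>\<^bsub>D\<^esub> zz_eval X p"
proof (induction rule: zz_path.induct)
  case (nil X)
  then show ?case using zz_eval_in[OF nil(2)] by (auto simp: in_Hom)
next
  case (fwd f X Y p Z')
  then show ?case using zz_eval_in[OF fwd(2)] zz_eval_in[OF fwd(4)] by (auto simp: in_Hom)
next
  case (bwd w Y X p Z')
  then show ?case using zz_eval_in[OF bwd(3)] zz_eval_in[OF bwd(5)] inverse_arr(1)[OF W_iso[OF bwd(1)]]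
    by (auto simp: in_Hom)
qed

text \<open>Equality of the endpoints is part of the conclusion because the two sides are cut out of
  longer paths, where the end of each factor is known only separately.\<close>

lemma zz_eval_rel:
  assumes "zz_rel K W l r" "zz_path K W X l Y" "zz_path K W X r Y'"
  shows "Y = Y' \<and> zz_eval X l = zz_eval X r"
  using assms
proof (induction rule: zz_rel.induct)
  case (ident X)
  then show ?case by (auto simp: in_Hom map_ident)
next
  case (comp f X Y g Z)
  then show ?case using map_comp[OF comp(1,2)] by (auto simp: in_Hom)
next
  case (fwd_bwd w)
  then show ?case using inverse_arr[OF W_iso[OF fwd_bwd(1)]] by (auto simp: in_Hom)
next
  case (bwd_fwd w)
  then show ?case using inverse_arr[OF W_iso[OF bwd_fwd(1)]] by (auto simp: in_Hom)
qed

text \<open>Both zigzags are cut at the rewritten factor. The prefixes end at the same object, the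
  two factors have the same value and end, and evaluation turns concatenation into
  composition.\<close>

lemma zz_eval_step:
  assumes "zz_step K W X Y p q"
  shows "zz_eval X p = zz_eval X q"
proof -
  obtain a l r b where rel: "zz_rel K W l r" and pq: "p = a @ l @ b" "q = a @ r @ b"
    and paths: "zz_path K W X p Y" "zz_path K W X q Y"
    using assms unfolding zz_step_def by blast
  note split = K.zz_path_split
  obtain Z where Z: "zz_path K W X a Z" "zz_path K W Z (l @ b) Y"
    using split[OF paths(1)[unfolded pq]] by blast
  obtain Z' where "zz_path K W X a Z'" "zz_path K W Z' (r @ b) Y"
    using split[OF paths(2)[unfolded pq]] by blast
  then have Z': "zz_path K W Z (r @ b) Y"
    using zz_path_end_unique[OF Z(1)] by blast
  obtain T where T: "zz_path K W Z l T" "zz_path K W T b Y" using split[OF Z(2)] by blast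
  obtain T' where T': "zz_path K W Z r T'" "zz_path K W T' b Y" using split[OF Z'] by blast
  have "T = T'" "zz_eval Z l = zz_eval Z r" using zz_eval_rel[OF rel T(1) T'(1)] by auto
  then have "zz_eval Z (l @ b) = zz_eval Z (r @ b)"
    using zz_eval_append[OF T] zz_eval_append[OF T'] by simp
  then show ?thesis
    unfolding pq using zz_eval_append[OF Z] zz_eval_append[OF Z(1) Z'] by simp
qed

lemma zz_eval_equiv:
  "equivclp (zz_step K W X Y) p q \<Longrightarrow> zz_eval X p = zz_eval X q"
  by (induction rule: equivclp_induct) (auto dest: zz_eval_step)

text \<open>Evaluation is constant on classes, so representatives of an isomorphism and of its
  inverse evaluate to mutually inverse arrows of \<open>D\<close>.\<close>

lemma isomorphic_of_localization:
  assumes "isomorphic (localization K W) X Y"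
  shows "isomorphic D (Fo X) (Fo Y)"
proof -
  obtain p q where p: "zz_path K W X p Y" and q: "zz_path K W Y q X"
    and pq: "loc_of_zz K W Y X q \<bullet>\<^bsub>localization K W\<^esub> loc_of_zz K W X Y p = loc_of_zz K W X X []"
    and qp: "loc_of_zz K W X Y p \<bullet>\<^bsub>localization K W\<^esub> loc_of_zz K W Y X q = loc_of_zz K W Y Y []"
    using assms unfolding isomorphic_def isomorphism_def Hom_localization
    by (auto simp: Hom_localization)
  have "zz_eval X (p @ q) = zz_eval X []" "zz_eval Y (q @ p) = zz_eval Y []"
    using pq qp unfolding localization_comp[OF p q] localization_comp[OF q p] loc_of_zz_eq_iff
    by (blast intro: zz_eval_equiv)+
  then have "zz_eval Y q \<bullet>\<^bsub>D\<^esub> zz_eval X p = Ident D (Fo X)"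
    "zz_eval X p \<bullet>\<^bsub>D\<^esub> zz_eval Y q = Ident D (Fo Y)"
    using zz_eval_append[OF p q] zz_eval_append[OF q p] by simp_all
  then have "isomorphism D (zz_eval X p)"
    using zz_eval_in[OF p] zz_eval_in[OF q]
    by (intro D.isomorphismI[of _ "zz_eval Y q"]) (auto simp: in_Hom)
  then show ?thesis using zz_eval_in[OF p] unfolding isomorphic_def by blast
qed

end

end

section \<open>The bounded derived category\<close>

lemma Db_simps [simp]:
  "Obj (Db C) = {X. bounded_complex C X}"
  "Dom (Db C) = ldom" "Cod (Db C) = lcod" "Susp (Db C) = shift C 1"
  "Triangles (Db C) = Db_triangles C"
  by (simp_all add: Db_def Db_cat_def cat.defs tri_cat.defs)

text \<open>\<open>Db C\<close> extends the record \<open>Db_cat C\<close>, and isomorphisms see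
  only the category fields.\<close>

lemma isomorphic_Db: "isomorphic (Db C) X Y \<longleftrightarrow> isomorphic (Db_cat C) X Y"
proof -
  have "Obj (Db C) = Obj (Db_cat C)" "Arr (Db C) = Arr (Db_cat C)" "Dom (Db C) = Dom (Db_cat C)"
    "Cod (Db C) = Cod (Db_cat C)" "Ident (Db C) = Ident (Db_cat C)" "Comp (Db C) = Comp (Db_cat C)"
    by (simp_all add: Db_def cat.defs tri_cat.defs)
  then show ?thesis unfolding isomorphic_def isomorphism_def Hom_def by simp
qed

context abelian_category
begin

lemma isomorphic_cohom_of_Db:
  assumes "isomorphic (Db C) X Y"
  shows "isomorphic C (cohom C i X) (cohom C i Y)"
proof -
  interpret K: category "Chb C" by (rule category_Chb)
  interpret H: category_functor "Chb C" C "cohom C i" "cohom_map C i"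
  proof
    fix f X Y assume "f \<in> Hom (Chb C) X Y"
    then show "cohom_map C i f \<in> Hom C (cohom C i X) (cohom C i Y)"
      using inducesD[OF induces_cohom_map[of f i]] by (auto simp: in_Hom)
  next
    fix X assume "X \<in> Obj (Chb C)"
    then show "cohom_map C i (Ident (Chb C) X) = Ident C (cohom C i X)"
      by (simp add: cohom_map_ident)
  next
    fix f g X Y Z assume "f \<in> Hom (Chb C) X Y" "g \<in> Hom (Chb C) Y Z"
    then show "cohom_map C i (g \<bullet>\<^bsub>Chb C\<^esub> f) = cohom_map C i g \<bullet> cohom_map C i f"
      using cohom_map_comp[of f g i] by (auto simp: in_Hom)
  qed
  show ?thesis
  proof (rule H.isomorphic_of_localization)
    show "isomorphic (localization (Chb C) (quasi_isos C)) X Y"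
      using assms unfolding isomorphic_Db Db_cat_def .
  qed (auto simp: quasi_isos_def)
qed

lemma isomorphic_Db_stalk_at:
  assumes "isomorphic C A B"
  shows "isomorphic (Db C) (stalk_at n A) (stalk_at n B)"
proof -
  interpret K: category "Chb C" by (rule category_Chb)
  obtain f where f: "f \<in> Hom C A B" "isomorphism C f"
    using assms unfolding isomorphic_def by blast
  obtain g where g: "g \<in> Arr C" "Dom C g = Cod C f" "Cod C g = Dom C f"
    "g \<bullet> f = Ident C (Dom C f)" "f \<bullet> g = Ident C (Cod C f)" "f \<in> Arr C"
    using f(2) by (rule isomorphism_obtain)
  have AB [simp]: "A \<in> Obj C" "B \<in> Obj C" "Dom C f = A" "Cod C f = B"
    using f g by (auto simp: in_Hom)
  define ext where "ext X Y h = CMap (stalk_at n X) (stalk_at n Y)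
    (\<lambda>i. if i = n then h else Zero C (zero_obj C) (zero_obj C))" for X Y h
  have ch: "chain_map C (ext X Y h)" if "h \<in> Hom C X Y" for X Y h
  proof -
    have [simp]: "h \<in> Arr C" "Dom C h = X" "Cod C h = Y" "X \<in> Obj C" "Y \<in> Obj C"
      using that by (auto simp: in_Hom)
    show ?thesis unfolding ext_def by (rule chain_mapI) (auto simp: in_Hom)
  qed
  \<comment> \<open>Outside degree \<open>n\<close> the extended arrow is zero, which is the
    identity there because the object is zero.\<close>
  have z: "Zero C (zero_obj C) (zero_obj C) = Ident C (zero_obj C)"
    using zero_obj_zero by (simp add: zero_object_iff_ident)
  have comp: "ext Y X k \<bullet>\<^bsub>Chb C\<^esub> ext X Y h = Ident (Chb C) (stalk_at n X)"
    if "k \<bullet> h = Ident C X" for X Y h k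
    using that by (auto simp: ext_def fun_eq_iff z)
  have dc: "cdom (ext X Y h) = stalk_at n X" "ccod (ext X Y h) = stalk_at n Y" for X Y h
    by (simp_all add: ext_def)
  have c: "chain_map C (ext A B f)" "chain_map C (ext B A g)"
    using ch[of f A B] ch[of g B A] g by (simp_all add: in_Hom)
  have "ext B A g \<bullet>\<^bsub>Chb C\<^esub> ext A B f = Ident (Chb C) (stalk_at n A)"
    "ext A B f \<bullet>\<^bsub>Chb C\<^esub> ext B A g = Ident (Chb C) (stalk_at n B)"
    using comp[of g f A B] comp[of f g B A] g by (simp_all del: Chb_simps(5,6))
  then have "isomorphism (Chb C) (ext A B f)"
    using c by (intro K.isomorphismI[of _ "ext B A g"]) (simp_all add: dc del: Chb_simps(5,6))
  then have "isomorphic (Chb C) (stalk_at n A) (stalk_at n B)"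
    using c unfolding isomorphic_def by (intro bexI[of _ "ext A B f"]) (simp_all add: in_Hom dc)
  then show ?thesis unfolding isomorphic_Db Db_cat_def by (rule K.isomorphic_localization)
qed

lemma isomorphic_Db_bounded:
  assumes "isomorphic (Db C) X Y"
  shows "bounded_complex C X"
proof -
  interpret K: category "Chb C" by (rule category_Chb)
  obtain f where "f \<in> Hom (Db_cat C) X Y"
    using assms unfolding isomorphic_Db unfolding isomorphic_def by blast
  then obtain p where "zz_path (Chb C) (quasi_isos C) X p Y"
    unfolding Db_cat_def Hom_localization by blast
  from K.zz_path_obj[OF this] show ?thesis by simp
qed

section \<open>Distinguished triangles and cones\<close>

lemma standard_triangle:
  assumes u: "chain_map C u"
  shows "(Db_of C u, Db_of C (cone_inj C u), Db_of C (cone_proj C u)) \<in> Db_triangles C"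
proof -
  let ?W = "quasi_isos C"
  interpret K: category "Chb C" by (rule category_Chb)
  interpret S: category_functor "Chb C" "Chb C" "shift C 1" "shift_map C 1"
  proof
    fix f X Y assume "f \<in> Hom (Chb C) X Y"
    then show "shift_map C 1 f \<in> Hom (Chb C) (shift C 1 X) (shift C 1 Y)"
      by (auto simp: in_Hom chain_map_shift)
  qed (auto simp: shift_map_def in_Hom)
  note [simp] = u
  \<comment> \<open>\<open>Db_susp\<close> is defined by a union over representatives. Shifting
    preserves elementary steps, so all representatives of an identity contribute the same class, and
    identities can serve as the comparison isomorphisms of the triangle.\<close>
  have susp: "Db_susp C (Ident (Db_cat C) X) = Ident (Db_cat C) (shift C 1 X)" for X
  proof -
    have "zz_class (Chb C) ?W (shift C 1 X) (shift C 1 X) (map (map_zz_letter (shift_map C 1)) p) =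
      zz_class (Chb C) ?W (shift C 1 X) (shift C 1 X) []" if "p \<in> zz_class (Chb C) ?W X X []" for p
    proof -
      have "equivclp (zz_step (Chb C) ?W X X) [] p" using that by (simp add: zz_class_def)
      then have "equivclp (zz_step (Chb C) ?W (shift C 1 X) (shift C 1 X))
          (map (map_zz_letter (shift_map C 1)) []) (map (map_zz_letter (shift_map C 1)) p)"
        by (rule equivclp_map) (rule S.zz_step_map, rule quasi_iso_shift)
      then show ?thesis unfolding zz_class_eq_iff by (simp add: equivclp_sym)
    qed
    moreover have "[] \<in> zz_class (Chb C) ?W X X []" by (simp add: zz_class_def)
    ultimately have "(\<Union>p \<in> zz_class (Chb C) ?W X X []. zz_class (Chb C) ?W (shift C 1 X) (shift C 1 X)
        (map (map_zz_letter (shift_map C 1)) p)) = zz_class (Chb C) ?W (shift C 1 X) (shift C 1 X) []"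
      by blast
    then show ?thesis by (simp add: Db_susp_def Db_cat_def loc_of_zz_def)
  qed
  have hom: "Db_of C u \<in> Hom (Db_cat C) (cdom u) (ccod u)"
    "Db_of C (cone_inj C u) \<in> Hom (Db_cat C) (ccod u) (cone C u)"
    "Db_of C (cone_proj C u) \<in> Hom (Db_cat C) (cone C u) (shift C 1 (cdom u))"
    unfolding Db_of_def Db_cat_def by (rule K.loc_map_Hom; simp add: in_Hom)+
  have id: "isomorphism (Db_cat C) (Ident (Db_cat C) X)"
    "Ident (Db_cat C) X \<in> Hom (Db_cat C) X X" if "bounded_complex C X" for X
    unfolding Db_cat_def using that
    by (auto intro!: K.localization_isomorphism_ident K.localization_ident_in simp del: localization_simps)
  note idc = K.localization_ident_comp[where W = ?W, folded Db_cat_def]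
  show ?thesis
    unfolding Db_triangles_def
    by (rule CollectI, rule case_prodI, rule case_prodI,
        rule exI[of _ "cdom u"], rule exI[of _ "ccod u"], rule exI[of _ "cone C u"],
        intro conjI hom exI[of _ u] exI[of _ "Ident (Db_cat C) (cdom u)"]
          exI[of _ "Ident (Db_cat C) (ccod u)"] exI[of _ "Ident (Db_cat C) (cone C u)"] u id)
      (simp_all add: susp idc(1)[OF hom(1)] idc(2)[OF hom(1)] idc(1)[OF hom(2)] idc(2)[OF hom(2)]
        idc(1)[OF hom(3)] idc(2)[OF hom(3)])
qed

lemma preaisle_cone:
  assumes "preaisle (Db C) U" "chain_map C u" "cdom u \<in> U" "cone C u \<in> U"
  shows "ccod u \<in> U"
proof -
  have "\<forall>(f, g, h) \<in> Db_triangles C. ldom f \<in> U \<and> lcod g \<in> U \<longrightarrow> lcod f \<in> U"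
    using assms(1) unfolding preaisle_def by simp
  from bspec[OF this standard_triangle[OF assms(2)]] show ?thesis
    using assms by (simp add: Db_of_def loc_map_def)
qed

text \<open>Of a distinguished triangle only the isomorphism classes of its three objects are kept,
  since membership in a strict subcategory sees nothing more.\<close>

lemma triangle_standard:
  assumes "(f, g, h) \<in> Db_triangles C"
  obtains u where "chain_map C u" "isomorphic (Db C) (ldom f) (cdom u)"
    "isomorphic (Db C) (lcod f) (ccod u)" "isomorphic (Db C) (lcod g) (cone C u)"
proof -
  obtain X Y Z u a b c where f: "f \<in> Hom (Db_cat C) X Y" and g: "g \<in> Hom (Db_cat C) Y Z"
    and u: "chain_map C u"
    and a: "isomorphism (Db_cat C) a" "a \<in> Hom (Db_cat C) X (cdom u)"
    and b: "isomorphism (Db_cat C) b" "b \<in> Hom (Db_cat C) Y (ccod u)"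
    and c: "isomorphism (Db_cat C) c" "c \<in> Hom (Db_cat C) Z (cone C u)"
    using assms unfolding Db_triangles_def by blast
  have "ldom f = X" "lcod f = Y" "lcod g = Z"
    using f g by (auto simp: in_Hom Db_cat_def)
  then show ?thesis using that[OF u] a b c unfolding isomorphic_Db unfolding isomorphic_def by blast
qed

end

section \<open>Narrow sequences and homology-determined preaisles\<close>

lemma strict_full_iso:
  "strict_full_subcategory K S \<Longrightarrow> X \<in> S \<Longrightarrow> isomorphic K X Y \<Longrightarrow> Y \<in> Obj K \<Longrightarrow> Y \<in> S"
  unfolding strict_full_subcategory_def by blast

context abelian_category
begin

text \<open>With its companion below, this provides the degreewise exactness of the sequence that
  presents a two-term complex as an extension of two stalks.\<close>

lemma short_exact_zero_ident:
  assumes Z: "zero_object C Z" and [simp]: "A \<in> Obj C"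
  shows "short_exact C (Zero C Z A) (Ident C A)"
  unfolding short_exact_def
proof (intro conjI)
  have [simp]: "Z \<in> Obj C" using Z by (rule zero_object_obj)
  show "monomorphism C (Zero C Z A)"
    using to_zero_object[OF Z] by (intro monoI) auto
  show "exact_pair C (Zero C Z A) (Ident C A)"
  proof (rule exact_pairI)
    fix y assume "y \<in> Arr C" "Cod C y = Dom C (Ident C A)"
      "Ident C A \<bullet> y = Zero C (Dom C y) (Cod C (Ident C A))"
    then show "\<exists>e x. epimorphism C e \<and> Cod C e = Dom C y \<and>
        x \<in> Hom C (Dom C e) (Dom C (Zero C Z A)) \<and> Zero C Z A \<bullet> x = y \<bullet> e"
      by (intro exI[of _ "Ident C (Dom C y)"] exI[of _ "Zero C (Dom C y) Z"]) (simp add: in_Hom)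
  qed simp_all
qed simp

lemma short_exact_ident_zero:
  assumes Z: "zero_object C Z" and [simp]: "A \<in> Obj C"
  shows "short_exact C (Ident C A) (Zero C A Z)"
  unfolding short_exact_def
proof (intro conjI)
  have [simp]: "Z \<in> Obj C" using Z by (rule zero_object_obj)
  show "epimorphism C (Zero C A Z)"
    using from_zero_object[OF Z] by (intro epiI) auto
  show "exact_pair C (Ident C A) (Zero C A Z)"
  proof (rule exact_pairI)
    fix y assume "y \<in> Arr C" "Cod C y = Dom C (Zero C A Z)"
    then show "\<exists>e x. epimorphism C e \<and> Cod C e = Dom C y \<and>
        x \<in> Hom C (Dom C e) (Dom C (Ident C A)) \<and> Ident C A \<bullet> x = y \<bullet> e"
      by (intro exI[of _ "Ident C (Dom C y)"] exI[of _ y]) (simp add: in_Hom)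
  qed simp_all
qed simp

lemma zero_zero_obj: "Zero C (zero_obj C) (zero_obj C) = Ident C (zero_obj C)"
  using zero_obj_zero by (simp add: zero_object_iff_ident)

lemma short_exact_zero_zero:
  "short_exact C (Zero C (zero_obj C) (zero_obj C)) (Zero C (zero_obj C) (zero_obj C))"
  using short_exact_zero_ident[OF zero_obj_zero, of "zero_obj C"] by (simp add: zero_zero_obj)

lemma narrow_iso:
  assumes "narrow C N" "A \<in> N" "isomorphic C A B"
  shows "B \<in> N"
  using assms strict_full_iso[of C N A B] isomorphic_obj[OF assms(3)] unfolding narrow_def by blast

text \<open>Narrow subcategories are nonempty, and a zero object is a cokernel of the identity of
  any member.\<close>

lemma narrow_zero_object:
  assumes N: "narrow C N" and Z: "zero_object C Z"
  shows "Z \<in> N"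
proof -
  obtain A where A: "A \<in> N" and [simp]: "A \<in> Obj C"
    using N unfolding narrow_def strict_full_subcategory_def by blast
  have [simp]: "Z \<in> Obj C" using Z by (rule zero_object_obj)
  have "is_cokernel C (Ident C A) (Zero C A Z)"
  proof (rule is_cokernelI)
    show "epimorphism C (Zero C A Z)"
      using short_exact_ident_zero[OF Z, of A] by (simp add: short_exact_def)
    fix g assume "g \<in> Arr C" "Dom C g = Cod C (Ident C A)"
      "g \<bullet> Ident C A = Zero C (Dom C (Ident C A)) (Cod C g)"
    then show "\<exists>h \<in> Hom C (Cod C (Zero C A Z)) (Cod C g). h \<bullet> Zero C A Z = g"
      by (intro bexI[of _ "Zero C Z (Cod C g)"]) (simp_all add: in_Hom)
  qed simp_all
  moreover have "Dom C (Ident C A) \<in> N" "Cod C (Ident C A) \<in> N" using A by simp_all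
  ultimately have "Cod C (Zero C A Z) \<in> N"
    using N unfolding narrow_def by blast
  then show ?thesis by simp
qed

subsection \<open>From narrow sequences to preaisles\<close>

lemma theta_iff:
  "X \<in> theta C N \<longleftrightarrow> bounded_complex C X \<and> (\<forall>i. cohom C i X \<in> N (- i))"
proof -
  have "(\<forall>k. homology C k X \<in> N k) \<longleftrightarrow> (\<forall>i. cohom C i X \<in> N (- i))"
    by (metis minus_minus)
  then show ?thesis by (simp add: theta_def)
qed

lemma narrow_sequenceD:
  assumes "N \<in> narrow_sequences C"
  shows "narrow C (N k)" "N k \<subseteq> N (k + 1)"
    "p \<in> Hom C A B \<Longrightarrow> q \<in> Hom C B X \<Longrightarrow> r \<in> Hom C X D \<Longrightarrow> s \<in> Hom C D E \<Longrightarrow>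
      exact_pair C p q \<Longrightarrow> exact_pair C q r \<Longrightarrow> exact_pair C r s \<Longrightarrow>
      A \<in> N (k + 1) \<Longrightarrow> B \<in> N k \<Longrightarrow> D \<in> N k \<Longrightarrow> E \<in> N (k - 1) \<Longrightarrow> X \<in> N k"
  using assms unfolding narrow_sequences_def narrow_sequence_def by blast+

text \<open>Away from degree \<open>n\<close> the cohomology is zero, and zero objects lie in every
  \<open>N k\<close>, so only degree \<open>n\<close> imposes a condition. The sign is the passage
  from cohomological to homological degree.\<close>

lemma stalk_at_in_theta:
  assumes N: "N \<in> narrow_sequences C" and A: "A \<in> Obj C"
  shows "stalk_at n A \<in> theta C N \<longleftrightarrow> A \<in> N (- n)"
proof
  assume "stalk_at n A \<in> theta C N"
  then show "A \<in> N (- n)"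
    using narrow_iso[OF narrow_sequenceD(1)[OF N] _ cohom_stalk_at[OF A]] by (auto simp: theta_iff)
next
  assume "A \<in> N (- n)"
  then have "cohom C n (stalk_at n A) \<in> N (- n)"
    using narrow_iso[OF narrow_sequenceD(1)[OF N] _ isomorphic_sym[OF cohom_stalk_at[OF A]]] by blast
  moreover have "cohom C i (stalk_at n A) \<in> N (- i)" if "i \<noteq> n" for i
    using narrow_zero_object[OF narrow_sequenceD(1)[OF N] cohom_stalk_at_zero[OF A that]] .
  ultimately show "stalk_at n A \<in> theta C N"
    using A by (metis theta_iff bounded_complex_stalk_at)
qed

lemma theta_iso:
  assumes N: "N \<in> narrow_sequences C" and "X \<in> theta C N" "isomorphic (Db C) X Y" "bounded_complex C Y"
  shows "Y \<in> theta C N"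
  using assms(2,4) narrow_iso[OF narrow_sequenceD(1)[OF N] _ isomorphic_cohom_of_Db[OF assms(3)]]
  by (auto simp: theta_iff)

lemma theta_cone:
  assumes N: "N \<in> narrow_sequences C" and u: "chain_map C u"
    and "cdom u \<in> theta C N" "cone C u \<in> theta C N"
  shows "ccod u \<in> theta C N"
proof -
  have "cohom C i (ccod u) \<in> N (- i)" for i
  proof -
    \<comment> \<open>With \<open>k = - i\<close>, the cohomology of the cone in degree
      \<open>i - 1\<close> is homology in degree \<open>k + 1\<close>, and that of
      \<open>cdom u\<close> in degree \<open>i + 1\<close> is homology in degree
      \<open>k - 1\<close>: the outer terms of the five-term condition.\<close>
    have idx: "i - 1 + 1 = i" "i - 1 + 2 = i + 1" by simp_all
    obtain p q r s where
      "p \<in> Hom C (cohom C (i - 1) (cone C u)) (cohom C i (cdom u))"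
      "q \<in> Hom C (cohom C i (cdom u)) (cohom C i (ccod u))"
      "r \<in> Hom C (cohom C i (ccod u)) (cohom C i (cone C u))"
      "s \<in> Hom C (cohom C i (cone C u)) (cohom C (i + 1) (cdom u))"
      "exact_pair C p q" "exact_pair C q r" "exact_pair C r s"
      by (rule cohom_cone_five_term[OF u, of "i - 1", unfolded idx])
    then show ?thesis
    proof (rule narrow_sequenceD(3)[OF N])
      have "cohom C (i - 1) (cone C u) \<in> N (- (i - 1))" "cohom C (i + 1) (cdom u) \<in> N (- (i + 1))"
        using assms by (simp_all only: theta_iff)
      moreover have "- (i - 1) = - i + 1" "- (i + 1) = - i - 1" by simp_all
      ultimately show "cohom C (i - 1) (cone C u) \<in> N (- i + 1)"
        "cohom C (i + 1) (cdom u) \<in> N (- i - 1)" by simp_all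
    qed (use assms in \<open>simp_all add: theta_iff\<close>)
  qed
  then show ?thesis using u by (simp add: theta_iff)
qed

lemma theta_in_hd_preaisles:
  assumes N: "N \<in> narrow_sequences C"
  shows "theta C N \<in> hd_preaisles C"
proof -
  have "stalk_at 0 (zero_obj C) \<in> theta C N"
    using stalk_at_in_theta[OF N, of "zero_obj C" 0] narrow_zero_object[OF narrow_sequenceD(1)[OF N]]
    by (simp add: zero_obj_zero)
  then have "theta C N \<noteq> {}" by blast
  moreover have "theta C N \<subseteq> Obj (Db C)" by (auto simp: theta_iff)
  ultimately have strict: "strict_full_subcategory (Db C) (theta C N)"
    using theta_iso[OF N] by (simp add: strict_full_subcategory_def)
  \<comment> \<open>The homology of \<open>X[1]\<close> in degree \<open>k\<close> is that of
    \<open>X\<close> in degree \<open>k - 1\<close>, and \<open>N (k - 1)\<close> is contained in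
    \<open>N k\<close>.\<close>
  have susp: "shift C 1 X \<in> theta C N" if X: "X \<in> theta C N" for X
  proof -
    have b: "bounded_complex C X" using X by (simp add: theta_iff)
    have "cohom C i (shift C 1 X) \<in> N (- i)" for i
    proof -
      have "cohom C (i + 1) X \<in> N (- (i + 1))" using X by (simp only: theta_iff)
      then have "cohom C (i + 1) X \<in> N (- i)"
        using narrow_sequenceD(2)[OF N, of "- (i + 1)"] by auto
      then show ?thesis
        using narrow_iso[OF narrow_sequenceD(1)[OF N] _ isomorphic_sym[OF cohom_shift[OF b]]] by blast
    qed
    then show ?thesis using b by (simp add: theta_iff)
  qed
  \<comment> \<open>Isomorphic objects of \<open>Db C\<close> have isomorphic cohomology, so the
    triangle may be replaced by that of a cone.\<close>
  have tri: "lcod f \<in> theta C N"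
    if t: "(f, g, h) \<in> Db_triangles C" "ldom f \<in> theta C N" "lcod g \<in> theta C N" for f g h
  proof -
    obtain u where u: "chain_map C u" and iso: "isomorphic (Db C) (ldom f) (cdom u)"
      "isomorphic (Db C) (lcod f) (ccod u)" "isomorphic (Db C) (lcod g) (cone C u)"
      by (rule triangle_standard[OF t(1)])
    have "cdom u \<in> theta C N" "cone C u \<in> theta C N"
      using theta_iso[OF N t(2) iso(1)] theta_iso[OF N t(3) iso(3)] u by simp_all
    then have "ccod u \<in> theta C N" by (rule theta_cone[OF N u])
    moreover have "bounded_complex C (lcod f)" by (rule isomorphic_Db_bounded[OF iso(2)])
    ultimately show ?thesis
      using narrow_iso[OF narrow_sequenceD(1)[OF N] _ isomorphic_sym[OF isomorphic_cohom_of_Db[OF iso(2)]]]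
      by (auto simp: theta_iff)
  qed
  have "homology_determined C (theta C N)"
    unfolding homology_determined_def
  proof (intro ballI)
    fix X assume "X \<in> Obj (Db C)"
    then have X: "bounded_complex C X" by simp
    have "shift C k (stalk C (homology C k X)) \<in> theta C N \<longleftrightarrow> homology C k X \<in> N k" for k
      using stalk_at_in_theta[OF N, of "homology C k X" "- k"] X by (simp add: shift_stalk)
    then show "X \<in> theta C N \<longleftrightarrow> (\<forall>k. shift C k (stalk C (homology C k X)) \<in> theta C N)"
      using X by (simp add: theta_def)
  qed
  then show ?thesis using strict susp tri by (auto simp: hd_preaisles_def preaisle_def)
qed

lemma mu_theta:
  assumes N: "N \<in> narrow_sequences C"
  shows "mu C (theta C N) = N"
proof
  fix k
  have Nk: "N k \<subseteq> Obj C"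
    using narrow_sequenceD(1)[OF N] unfolding narrow_def strict_full_subcategory_def by blast
  show "mu C (theta C N) k = N k"
  proof (intro equalityI subsetI)
    fix A assume "A \<in> mu C (theta C N) k"
    then obtain X where X: "X \<in> theta C N" "isomorphic C (homology C k X) A" unfolding mu_def by blast
    show "A \<in> N k"
      by (rule narrow_iso[OF narrow_sequenceD(1)[OF N] _ X(2)]) (use X(1) in \<open>simp add: theta_def\<close>)
  next
    fix A assume A: "A \<in> N k"
    then have "A \<in> Obj C" using Nk by blast
    then show "A \<in> mu C (theta C N) k"
      using A stalk_at_in_theta[OF N, of A "- k"] cohom_stalk_at[of A "- k"] unfolding mu_def
      by (intro CollectI conjI bexI[of _ "stalk_at (- k) A"]) simp_all
  qed
qed

subsection \<open>From preaisles to narrow sequences\<close>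

context
  fixes U
  assumes U: "U \<in> hd_preaisles C"
begin

lemma preaisle_U: "preaisle (Db C) U"
  using U by (simp add: hd_preaisles_def)

lemma U_complex: "X \<in> U \<Longrightarrow> bounded_complex C X"
  using preaisle_U by (auto simp: preaisle_def strict_full_subcategory_def)

lemma U_iff:
  assumes "bounded_complex C X"
  shows "X \<in> U \<longleftrightarrow> (\<forall>k. stalk_at (- k) (homology C k X) \<in> U)"
  using U assms by (simp add: hd_preaisles_def homology_determined_def shift_stalk)

lemma U_stalk_iso:
  assumes "stalk_at n A \<in> U" "isomorphic C A B"
  shows "stalk_at n B \<in> U"
  using preaisle_U isomorphic_obj[OF assms(2)]
  by (intro strict_full_iso[OF _ assms(1) isomorphic_Db_stalk_at[OF assms(2)]])
    (simp_all add: preaisle_def)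

text \<open>If \<open>X\<close> in \<open>U\<close> has homology \<open>A\<close> in degree
  \<open>k\<close>, homology-determinedness puts \<open>A[k]\<close> into \<open>U\<close>;
  conversely \<open>A\<close> is the homology of \<open>A[k]\<close>. The essential image thus
  becomes a condition on a single complex.\<close>

lemma mu_iff: "A \<in> mu C U k \<longleftrightarrow> A \<in> Obj C \<and> stalk_at (- k) A \<in> U"
proof
  assume "A \<in> mu C U k"
  then obtain X where X: "X \<in> U" "isomorphic C (homology C k X) A" and A: "A \<in> Obj C"
    unfolding mu_def by blast
  have "stalk_at (- k) (homology C k X) \<in> U"
    using U_iff[OF U_complex[OF X(1)]] X(1) by blast
  then show "A \<in> Obj C \<and> stalk_at (- k) A \<in> U" using U_stalk_iso X(2) A by blast
next
  assume "A \<in> Obj C \<and> stalk_at (- k) A \<in> U"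
  then show "A \<in> mu C U k"
    using cohom_stalk_at[of A "- k"] unfolding mu_def by blast
qed

lemma homology_in_mu: "X \<in> U \<Longrightarrow> isomorphic C (cohom C (- k) X) A \<Longrightarrow> A \<in> mu C U k"
  using isomorphic_obj unfolding mu_def by blast

lemma U_short_exact:
  assumes u: "chain_map C u" and g: "chain_map C g" and ug: "cdom g = ccod u"
    and ses: "\<And>i. short_exact C (ccomp u i) (ccomp g i)"
    and mem: "cdom u \<in> U" "ccod g \<in> U"
  shows "ccod u \<in> U"
proof (rule preaisle_cone[OF preaisle_U u mem(1)])
  have "stalk_at (- k) (homology C k (cone C u)) \<in> U" for k
  proof (rule U_stalk_iso)
    show "stalk_at (- k) (homology C k (ccod g)) \<in> U"
      using U_iff[of "ccod g"] mem(2) g by simp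
    show "isomorphic C (homology C k (ccod g)) (homology C k (cone C u))"
      by (rule isomorphic_sym[OF cohom_cone_short_exact[OF u g ug ses]])
  qed
  then show "cone C u \<in> U" using U_iff[of "cone C u"] u by simp
qed

text \<open>Closure of \<open>U\<close> under suspension, applied to \<open>A[k]\<close>, whose
  suspension is literally \<open>A[k + 1]\<close>.\<close>

lemma mu_mono: "mu C U k \<subseteq> mu C U (k + 1)"
proof
  fix A assume "A \<in> mu C U k"
  then have A: "A \<in> Obj C" "stalk_at (- k) A \<in> U" by (simp_all add: mu_iff)
  then have "shift C 1 (stalk_at (- k) A) \<in> U"
    using preaisle_U by (simp add: preaisle_def)
  then show "A \<in> mu C U (k + 1)" using A by (simp add: mu_iff shift_stalk_at)
qed

lemma mu_extension:
  assumes "short_exact C f g" "Dom C f \<in> mu C U k" "Cod C g \<in> mu C U k"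
  shows "Cod C f \<in> mu C U k"
proof -
  have ex: "exact_pair C f g" using assms(1) by (simp add: short_exact_def)
  note [simp] = exact_pairD(1-3)[OF ex]
  let ?z = "Zero C (zero_obj C) (zero_obj C)"
  let ?u = "CMap (stalk_at (- k) (Dom C f)) (stalk_at (- k) (Cod C f)) (\<lambda>i. if i = - k then f else ?z)"
  let ?g = "CMap (stalk_at (- k) (Cod C f)) (stalk_at (- k) (Cod C g)) (\<lambda>i. if i = - k then g else ?z)"
  have "ccod ?u \<in> U"
  proof (rule U_short_exact)
    show "chain_map C ?u" by (rule chain_mapI) (auto simp: in_Hom)
    show "chain_map C ?g" by (rule chain_mapI) (auto simp: in_Hom)
    show "short_exact C (ccomp ?u i) (ccomp ?g i)" for i
      using assms(1) short_exact_zero_zero by simp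
  qed (use assms in \<open>simp_all add: mu_iff\<close>)
  then show ?thesis by (simp add: mu_iff)
qed

text \<open>The two-term complex \<open>A \<rightarrow> B\<close> with \<open>B\<close> in homological degree \<open>k\<close> is an extension
  of \<open>A[k + 1]\<close> by \<open>B[k]\<close>, so it lies in \<open>U\<close>; its homology consists of the kernel and the cokernel.\<close>

lemma mu_ker_coker:
  assumes [simp]: "f \<in> Arr C" and mem: "Dom C f \<in> mu C U (k + 1)" "Cod C f \<in> mu C U k"
  shows "Dom C (ker C f) \<in> mu C U (k + 1)" "Cod C (coker C f) \<in> mu C U k"
proof -
  \<comment> \<open>The cohomological degree of the domain of \<open>f\<close>, which sits in
    homological degree \<open>k + 1\<close>; the codomain is then in degree
    \<open>n + 1 = - k\<close>.\<close>
  define n where "n = - (k + 1)"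
  have n: "- (k + 1) = n" "- k = n + 1" by (simp_all add: n_def)
  let ?A = "Dom C f" and ?B = "Cod C f" and ?O = "zero_obj C"
  let ?u = "CMap (stalk_at (n + 1) ?B) (two_term n f)
    (\<lambda>i. if i = n + 1 then Ident C ?B else if i = n then Zero C ?O ?A else Zero C ?O ?O)"
  let ?g = "CMap (two_term n f) (stalk_at n ?A)
    (\<lambda>i. if i = n + 1 then Zero C ?B ?O else if i = n then Ident C ?A else Zero C ?O ?O)"
  have "ccod ?u \<in> U"
  proof (rule U_short_exact)
    show "chain_map C ?u" by (rule chain_mapI) (auto simp: in_Hom)
    show "chain_map C ?g" by (rule chain_mapI) (auto simp: in_Hom)
    show "short_exact C (ccomp ?u i) (ccomp ?g i)" for i
      using short_exact_zero_zero short_exact_ident_zero[OF zero_obj_zero, of ?B]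
        short_exact_zero_ident[OF zero_obj_zero, of ?A] by simp
  qed (use mem in \<open>simp_all add: mu_iff n\<close>)
  then have t: "two_term n f \<in> U" by simp
  show "Dom C (ker C f) \<in> mu C U (k + 1)"
    by (rule homology_in_mu[OF t]) (unfold n, rule cohom_two_term_ker, simp)
  show "Cod C (coker C f) \<in> mu C U k"
    by (rule homology_in_mu[OF t]) (unfold n, rule cohom_two_term_coker, simp)
qed

text \<open>Exactness at \<open>B\<close> makes the arrow \<open>q'\<close> out of the cokernel of
  \<open>p\<close> monomorphic, exactness at \<open>D\<close> makes the arrow \<open>r'\<close> into
  the kernel of \<open>s\<close> epimorphic, and exactness at \<open>X\<close> completes the short
  exact sequence.\<close>

lemma mu_five_term:
  assumes Hom: "p \<in> Hom C A B" "q \<in> Hom C B X" "r \<in> Hom C X D" "s \<in> Hom C D E"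
    and ex: "exact_pair C p q" "exact_pair C q r" "exact_pair C r s"
    and mem: "A \<in> mu C U (k + 1)" "B \<in> mu C U k" "D \<in> mu C U k" "E \<in> mu C U (k - 1)"
  shows "X \<in> mu C U k"
proof -
  have [simp]: "p \<in> Arr C" "Dom C p = A" "Cod C p = B" "q \<in> Arr C" "Dom C q = B" "Cod C q = X"
    "r \<in> Arr C" "Dom C r = X" "Cod C r = D" "s \<in> Arr C" "Dom C s = D" "Cod C s = E"
    using Hom by (auto simp: in_Hom)
  have [simp]: "X \<in> Obj C" "B \<in> Obj C" using cod_obj[of q] dom_obj[of q] by simp_all
  let ?c = "coker C p" and ?m = "ker C s"
  have K: "Cod C ?c \<in> mu C U k" using mu_ker_coker(2)[of p k] mem by simp
  \<comment> \<open>The two-term argument is used one degree lower, because \<open>E\<close> lies in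
    \<open>mu C U (k - 1)\<close>; the kernel then lands in degree
    \<open>(k - 1) + 1 = k\<close>.\<close>
  have L: "Dom C ?m \<in> mu C U k" using mu_ker_coker(1)[of s "k - 1"] mem by simp
  obtain q' where q' [simp]: "q' \<in> Arr C" "Dom C q' = Cod C ?c" "Cod C q' = X" and qc: "q' \<bullet> ?c = q"
    using cokernel_desc[OF coker_is_cokernel[of p], of q] exact_pairD(4)[OF ex(1)] by auto
  obtain r' where r' [simp]: "r' \<in> Arr C" "Dom C r' = X" "Cod C r' = Dom C ?m" and mr: "?m \<bullet> r' = r"
    using kernel_lift[OF ker_is_kernel[of s], of r] exact_pairD(4)[OF ex(3)] by auto
  have "monomorphism C q'"
  proof (rule monoI)
    fix t assume [simp]: "t \<in> Arr C" "Cod C t = Dom C q'" and qt: "q' \<bullet> t = Zero C (Dom C t) (Cod C q')"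
    obtain e b where e: "epimorphism C e" and [simp]: "Cod C e = Dom C t" "b \<in> Arr C"
      "Dom C b = Dom C e" "Cod C b = Dom C ?c" and cb: "?c \<bullet> b = t \<bullet> e"
      by (rule epi_local_lift[of ?c t]) simp_all
    have [simp]: "e \<in> Arr C" using e epi_arr by blast
    have "q \<bullet> b = q' \<bullet> ?c \<bullet> b" using comp_eq_left[OF qc, of b] by simp
    also have "\<dots> = Zero C (Dom C b) (Cod C q)" unfolding cb using comp_eq_left[OF qt, of e] by simp
    finally have "q \<bullet> b = Zero C (Dom C b) (Cod C q)" .
    then obtain e' a where e': "epimorphism C e'" and [simp]: "Cod C e' = Dom C b" "a \<in> Arr C"
      "Dom C a = Dom C e'" "Cod C a = Dom C p" and pa: "p \<bullet> a = b \<bullet> e'"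
      using exact_local_lift[OF ex(1), of b] by auto
    have [simp]: "e' \<in> Arr C" using e' epi_arr by blast
    have "t \<bullet> e \<bullet> e' = ?c \<bullet> p \<bullet> a" unfolding pa using comp_eq_left[OF cb, of e'] by simp
    also have "\<dots> = Zero C (Dom C e') (Cod C ?c)" using comp_eq_left[OF coker_arr(3)[of p], of a] by simp
    finally have te: "t \<bullet> e \<bullet> e' = Zero C (Dom C e') (Cod C ?c)" .
    have "epimorphism C (e \<bullet> e')" by (intro epi_comp e e') simp
    from epi_zeroD[OF this, of t] te show "t = Zero C (Dom C t) (Dom C q')" by simp
  qed simp
  moreover have "epimorphism C r'"
  proof -
    obtain e x where e: "epimorphism C e" and [simp]: "Cod C e = Dom C ?m" "x \<in> Arr C"
      "Dom C x = Dom C e" "Cod C x = X" and rx: "r \<bullet> x = ?m \<bullet> e"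
      using exact_local_lift[OF ex(3), of ?m] by auto
    have [simp]: "e \<in> Arr C" using e epi_arr by blast
    have eq: "?m \<bullet> r' \<bullet> x = ?m \<bullet> e" using comp_eq_left[OF mr, of x] rx by simp
    have "r' \<bullet> x = e" by (rule monoD[OF ker_arr(4)[of s] _ _ _ _ _ eq]) simp_all
    then show ?thesis using e by (intro epi_cancel[of r' x]) simp_all
  qed
  moreover have "exact_pair C q' r'"
  proof (rule exact_pairI)
    have "r' \<bullet> q = Zero C B (Dom C ?m)"
    proof (rule monoD[OF ker_arr(4)[of s]])
      show "?m \<bullet> r' \<bullet> q = ?m \<bullet> Zero C B (Dom C ?m)"
        using comp_eq_left[OF mr, of q] exact_pairD(4)[OF ex(2)] by simp
    qed simp_all
    then have "(r' \<bullet> q') \<bullet> ?c = Zero C B (Dom C ?m)" using qc by simp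
    then show "r' \<bullet> q' = Zero C (Dom C q') (Cod C r')"
      using epi_zeroD[OF coker_arr(4)[of p], of "r' \<bullet> q'"] by simp
    fix x assume [simp]: "x \<in> Arr C" "Cod C x = Dom C r'" and rx: "r' \<bullet> x = Zero C (Dom C x) (Cod C r')"
    have "r \<bullet> x = Zero C (Dom C x) (Cod C r)" using comp_eq_left[OF mr, of x] rx by simp
    then obtain e b where e: "epimorphism C e" and [simp]: "Cod C e = Dom C x" "b \<in> Arr C"
      "Dom C b = Dom C e" "Cod C b = Dom C q" and qb: "q \<bullet> b = x \<bullet> e"
      using exact_local_lift[OF ex(2), of x] by auto
    show "\<exists>e b. epimorphism C e \<and> Cod C e = Dom C x \<and> b \<in> Hom C (Dom C e) (Dom C q') \<and> q' \<bullet> b = x \<bullet> e"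
      using e comp_eq_left[OF qc, of b] qb
      by (intro exI[of _ e] exI[of _ "?c \<bullet> b"]) (simp add: in_Hom)
  qed simp_all
  ultimately have "short_exact C q' r'" by (simp add: short_exact_def)
  then show ?thesis using mu_extension[of q' r' k] K L by simp
qed

lemma mu_in_narrow_sequences: "mu C U \<in> narrow_sequences C"
proof -
  have "narrow C (mu C U k)" for k
    unfolding narrow_def
  proof (intro conjI allI impI; (elim conjE)?)
    obtain X where X: "X \<in> U"
      using preaisle_U unfolding preaisle_def strict_full_subcategory_def by blast
    have "homology C k X \<in> mu C U k"
      using U_complex[OF X] by (intro homology_in_mu[OF X] isomorphic_refl) simp
    then show "strict_full_subcategory C (mu C U k)"
      using U_stalk_iso unfolding strict_full_subcategory_def by (auto simp: mu_iff)
  next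
    fix f g assume "short_exact C f g" "Dom C f \<in> mu C U k" "Cod C g \<in> mu C U k"
    then show "Cod C f \<in> mu C U k" by (rule mu_extension)
  next
    fix f c assume c: "is_cokernel C f c" and mem: "Dom C f \<in> mu C U k" "Cod C f \<in> mu C U k"
    have f: "f \<in> Arr C" using c by (rule is_cokernelD)
    \<comment> \<open>Monotonicity moves the domain of \<open>f\<close> into
      \<open>mu C U (k + 1)\<close>, where the two-term argument expects it.\<close>
    have "Cod C (coker C f) \<in> mu C U k" using mu_ker_coker(2)[OF f, of k] mem mu_mono by blast
    moreover have "isomorphic C (Cod C (coker C f)) (Cod C c)"
      by (rule cokernel_unique[OF coker_is_cokernel[OF f] c])
    ultimately show "Cod C c \<in> mu C U k"
      using U_stalk_iso isomorphic_obj by (auto simp: mu_iff)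
  qed
  then show ?thesis
    unfolding narrow_sequences_def narrow_sequence_def using mu_mono mu_five_term by blast
qed

lemma theta_mu: "theta C (mu C U) = U"
proof (intro equalityI subsetI)
  fix X assume "X \<in> theta C (mu C U)"
  then show "X \<in> U" using U_iff[of X] by (simp add: theta_def mu_iff)
next
  fix X assume X: "X \<in> U"
  then show "X \<in> theta C (mu C U)"
    using U_iff[of X] U_complex[OF X] by (simp add: theta_def mu_iff)
qed

end

end

theorem theorem1p1:
  fixes C :: "('o, 'm, 'z) add_cat_scheme"
  assumes "abelian_category C"
  shows "bij_betw (theta C) (narrow_sequences C) (hd_preaisles C) \<and>
    bij_betw (mu C) (hd_preaisles C) (narrow_sequences C) \<and>
    (\<forall>N \<in> narrow_sequences C. mu C (theta C N) = N) \<and>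
    (\<forall>U \<in> hd_preaisles C. theta C (mu C U) = U)"
proof -
  interpret abelian_category C by fact
  have "bij_betw (theta C) (narrow_sequences C) (hd_preaisles C)"
    by (rule bij_betw_byWitness[where f' = "mu C"])
      (auto simp: mu_theta theta_mu theta_in_hd_preaisles mu_in_narrow_sequences)
  moreover have "bij_betw (mu C) (hd_preaisles C) (narrow_sequences C)"
    by (rule bij_betw_byWitness[where f' = "theta C"])
      (auto simp: mu_theta theta_mu theta_in_hd_preaisles mu_in_narrow_sequences)
  ultimately show ?thesis by (simp add: mu_theta theta_mu)
qed

end
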